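(* Let $\mathcal{C}$ be a finite tensor category and let $\mathcal{M}$ be a finite left $\mathcal{C}$-module category with action functor $\rho:\mathcal{C}\to\mathrm{Rex}(\mathcal{M})$ and right adjoint $\rho^{\mathrm{ra}}$. Then there is an adjoint pair $$\big(\mathcal{Z}(\rho):\mathcal{Z}(\mathcal{C})\to\mathrm{Rex}_{\mathcal{C}}(\mathcal{M}),\quad \mathcal{Z}(\rho^{\mathrm{ra}}):\mathrm{Rex}_{\mathcal{C}}(\mathcal{M})\to\mathcal{Z}(\mathcal{C})\big)$$ (with $\mathcal{Z}(\rho)$ left adjoint to $\mathcal{Z}(\rho^{\mathrm{ra}})$), where $\mathcal{Z}(\mathrm{Rex}(\mathcal{M}))$ is identified with $\mathrm{Rex}_{\mathcal{C}}(\mathcal{M})$.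
   Context: $k$ is an algebraically closed field. A finite abelian category is a $k$-linear category equivalent to finite-dimensional left modules over a finite-dimensional $k$-algebra. A finite tensor category is a rigid monoidal category $\mathcal{C}$ that is finite abelian, with $k$-linear tensor product in each variable and simple unit $\mathbf{1}$. A finite left $\mathcal{C}$-module category is a left $\mathcal{C}$-module category that is finite abelian with action $k$-linear and right exact in each variable. $\mathrm{Rex}(\mathcal{M})$ is the category of $k$-linear right exact endofunctors of $\mathcal{M}$; $\mathrm{Rex}_{\mathcal{C}}(\mathcal{M})$ is the category of $k$-linear right exact left $\mathcal{C}$-module endofunctors $(F,s)$, $s_{X,M}:X\otimes F(M)\to F(X\otimes M)$. Associativity constraints are suppressed. $\mathrm{Rex}(\mathcal{M})$ is a $\mathcal{C}$-bimodule category by $(X\otimes F)(M)=X\otimes F(M)$ and $(F\otimes X)(M)=F(X\otimes M)$. The action functor $\rho(X)=X\otimes\mathrm{id}_{\mathcal{M}}$ is a $k$-linear exact $\mathcal{C}$-bimodule functor; it has a right adjoint $\rho^{\mathrm{ra}}$, which is a $\mathcal{C}$-bimodule functor in such a way that the unit and counit of the adjunction are $\mathcal{C}$-bimodule transformations. For a $\mathcal{C}$-bimodule category $\mathcal{N}$, $\mathcal{Z}(\mathcal{N})$ is the category of pairs $(N,\sigma)$ with $N\in\mathcal{N}$ and $\sigma_X:N\otimes X\to X\otimes N$ ($X\in\mathcal{C}$) a natural isomorphism with $\sigma_{\mathbf{1}}=\mathrm{id}_N$ and $\sigma_{X\otimes Y}=(\mathrm{id}_X\otimes\sigma_Y)\circ(\sigma_X\otimes\mathrm{id}_Y)$;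 morphisms are those of $\mathcal{N}$ commuting with the $\sigma$'s. $\mathcal{Z}(\mathcal{C})$ is the Drinfeld center. $\mathcal{Z}(\mathrm{Rex}(\mathcal{M}))$ is identified with $\mathrm{Rex}_{\mathcal{C}}(\mathcal{M})$ by $(F,\sigma)\leftrightarrow(F,s=\sigma^{-1})$. For a $k$-linear $\mathcal{C}$-bimodule functor $F:\mathcal{N}\to\mathcal{N}'$ with structure isomorphisms $\ell_{X,N}:X\otimes F(N)\to F(X\otimes N)$ and $r_{N,X}:F(N)\otimes X\to F(N\otimes X)$, the functor $\mathcal{Z}(F):\mathcal{Z}(\mathcal{N})\to\mathcal{Z}(\mathcal{N}')$ is $\mathcal{Z}(F)(N,\sigma)=(F(N),\ \ell^{-1}\circ F(\sigma)\circ r)$ and acts as $F$ on morphisms. *)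

theory Defs
  imports "HOL-Algebra.Module" "HOL-Algebra.Algebraic_Closure"
begin

section \<open>Categories, functors, adjunctions\<close>

record ('o, 'm) category =
  Obj :: "'o set"
  Arr :: "'m set"
  Dom :: "'m \<Rightarrow> 'o"
  Cod :: "'m \<Rightarrow> 'o"
  idt :: "'o \<Rightarrow> 'm"
  Comp :: "'m \<Rightarrow> 'm \<Rightarrow> 'm"  (infixr \<open>\<cdot>\<index>\<close> 75)

definition homset :: "('o, 'm, 'z) category_scheme \<Rightarrow> 'o \<Rightarrow> 'o \<Rightarrow> 'm set" where
  "homset C A B = {f \<in> Arr C. Dom C f = A \<and> Cod C f = B}"

locale category =
  fixes C :: "('o, 'm, 'z) category_scheme" (structure)
  assumes Dom_closed: "f \<in> Arr C \<Longrightarrow> Dom C f \<in> Obj C"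
    and Cod_closed: "f \<in> Arr C \<Longrightarrow> Cod C f \<in> Obj C"
    and idt_closed: "A \<in> Obj C \<Longrightarrow> idt C A \<in> homset C A A"
    and Comp_closed: "f \<in> homset C A B \<Longrightarrow> g \<in> homset C B D \<Longrightarrow> g \<cdot> f \<in> homset C A D"
    and Comp_idt_left: "f \<in> homset C A B \<Longrightarrow> idt C B \<cdot> f = f"
    and Comp_idt_right: "f \<in> homset C A B \<Longrightarrow> f \<cdot> idt C A = f"
    and Comp_assoc: "f \<in> homset C A B \<Longrightarrow> g \<in> homset C B D \<Longrightarrow> h \<in> homset C D E
      \<Longrightarrow> (h \<cdot> g) \<cdot> f = h \<cdot> (g \<cdot> f)"

definition inverse_arrows :: "('o, 'm, 'z) category_scheme \<Rightarrow> 'm \<Rightarrow> 'm \<Rightarrow> bool" where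
  "inverse_arrows C f g \<longleftrightarrow>
     f \<in> Arr C \<and> g \<in> homset C (Cod C f) (Dom C f) \<and>
     g \<cdot>\<^bsub>C\<^esub> f = idt C (Dom C f) \<and> f \<cdot>\<^bsub>C\<^esub> g = idt C (Cod C f)"

definition iso_arrow :: "('o, 'm, 'z) category_scheme \<Rightarrow> 'm \<Rightarrow> bool" where
  "iso_arrow C f \<longleftrightarrow> (\<exists>g. inverse_arrows C f g)"

definition inv_arrow :: "('o, 'm, 'z) category_scheme \<Rightarrow> 'm \<Rightarrow> 'm" where
  "inv_arrow C f = (THE g. inverse_arrows C f g)"

definition monic :: "('o, 'm, 'z) category_scheme \<Rightarrow> 'm \<Rightarrow> bool" where
  "monic C f \<longleftrightarrow> f \<in> Arr C \<and>
     (\<forall>B. \<forall>g \<in> homset C B (Dom C f). \<forall>h \<in> homset C B (Dom C f). f \<cdot>\<^bsub>C\<^esub> g = f \<cdot>\<^bsub>C\<^esub> h \<longrightarrow> g = h)"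

record ('o, 'm, 'p, 'q) fctr =
  fobj :: "'o \<Rightarrow> 'p"
  farr :: "'m \<Rightarrow> 'q"

locale cat_functor = C: category C + D: category D
  for C :: "('o, 'm, 'y) category_scheme" and D :: "('p, 'q, 'z) category_scheme"
    and F :: "('o, 'm, 'p, 'q, 'w) fctr_scheme" +
  assumes fobj_closed: "A \<in> Obj C \<Longrightarrow> fobj F A \<in> Obj D"
    and farr_closed: "f \<in> homset C A B \<Longrightarrow> farr F f \<in> homset D (fobj F A) (fobj F B)"
    and farr_idt: "A \<in> Obj C \<Longrightarrow> farr F (idt C A) = idt D (fobj F A)"
    and farr_Comp: "f \<in> homset C A B \<Longrightarrow> g \<in> homset C B E
      \<Longrightarrow> farr F (g \<cdot>\<^bsub>C\<^esub> f) = farr F g \<cdot>\<^bsub>D\<^esub> farr F f"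

definition id_fctr :: "('o, 'm, 'z) category_scheme \<Rightarrow> ('o, 'm, 'o, 'm) fctr" where
  "id_fctr C = \<lparr>fobj = (\<lambda>A \<in> Obj C. A), farr = (\<lambda>f \<in> Arr C. f)\<rparr>"

definition comp_fctr ::
  "('p, 'q, 'r, 's, 'y) fctr_scheme \<Rightarrow> ('o, 'm, 'p, 'q, 'z) fctr_scheme \<Rightarrow> ('o, 'm, 'r, 's) fctr" where
  "comp_fctr G F = \<lparr>fobj = fobj G \<circ> fobj F, farr = farr G \<circ> farr F\<rparr>"

locale nat_trans = F: cat_functor C D F + G: cat_functor C D G
  for C :: "('o, 'm, 'x) category_scheme" and D :: "('p, 'q, 'y) category_scheme"
    and F :: "('o, 'm, 'p, 'q, 'z) fctr_scheme" and G :: "('o, 'm, 'p, 'q, 'w) fctr_scheme"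
    and \<alpha> :: "'o \<Rightarrow> 'q" +
  assumes component_closed: "A \<in> Obj C \<Longrightarrow> \<alpha> A \<in> homset D (fobj F A) (fobj G A)"
    and naturality: "f \<in> homset C A B \<Longrightarrow> farr G f \<cdot>\<^bsub>D\<^esub> \<alpha> A = \<alpha> B \<cdot>\<^bsub>D\<^esub> farr F f"

definition nat_iso ::
  "('o, 'm, 'x) category_scheme \<Rightarrow> ('p, 'q, 'y) category_scheme \<Rightarrow> ('o, 'm, 'p, 'q, 'z) fctr_scheme
    \<Rightarrow> ('o, 'm, 'p, 'q, 'w) fctr_scheme \<Rightarrow> ('o \<Rightarrow> 'q) \<Rightarrow> bool" where
  "nat_iso C D F G \<alpha> \<longleftrightarrow> nat_trans C D F G \<alpha> \<and> (\<forall>A \<in> Obj C. iso_arrow D (\<alpha> A))"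

text \<open>\<open>F\<close> is left adjoint to \<open>G\<close>, with unit \<open>\<eta>\<close> and counit \<open>\<epsilon>\<close>.\<close>

definition adjunction ::
  "('o, 'm, 'x) category_scheme \<Rightarrow> ('p, 'q, 'y) category_scheme \<Rightarrow> ('o, 'm, 'p, 'q, 'z) fctr_scheme
    \<Rightarrow> ('p, 'q, 'o, 'm, 'w) fctr_scheme \<Rightarrow> ('o \<Rightarrow> 'm) \<Rightarrow> ('p \<Rightarrow> 'q) \<Rightarrow> bool" where
  "adjunction C D F G \<eta> \<epsilon> \<longleftrightarrow>
     cat_functor C D F \<and> cat_functor D C G \<and>
     nat_trans C C (id_fctr C) (comp_fctr G F) \<eta> \<and>
     nat_trans D D (comp_fctr F G) (id_fctr D) \<epsilon> \<and>
     (\<forall>A \<in> Obj C. \<epsilon> (fobj F A) \<cdot>\<^bsub>D\<^esub> farr F (\<eta> A) = idt D (fobj F A)) \<and>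
     (\<forall>B \<in> Obj D. farr G (\<epsilon> B) \<cdot>\<^bsub>C\<^esub> \<eta> (fobj G B) = idt C (fobj G B))"

definition adjoint_pair ::
  "('o, 'm, 'x) category_scheme \<Rightarrow> ('p, 'q, 'y) category_scheme \<Rightarrow> ('o, 'm, 'p, 'q, 'z) fctr_scheme
    \<Rightarrow> ('p, 'q, 'o, 'm, 'w) fctr_scheme \<Rightarrow> bool" where
  "adjoint_pair C D F G \<longleftrightarrow> (\<exists>\<eta> \<epsilon>. adjunction C D F G \<eta> \<epsilon>)"

definition inverse_functors ::
  "('o, 'm, 'x) category_scheme \<Rightarrow> ('p, 'q, 'y) category_scheme \<Rightarrow> ('o, 'm, 'p, 'q, 'z) fctr_scheme
    \<Rightarrow> ('p, 'q, 'o, 'm, 'w) fctr_scheme \<Rightarrow> bool" where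
  "inverse_functors C D F G \<longleftrightarrow>
     cat_functor C D F \<and> cat_functor D C G \<and>
     (\<forall>A \<in> Obj C. fobj G (fobj F A) = A) \<and> (\<forall>f \<in> Arr C. farr G (farr F f) = f) \<and>
     (\<forall>B \<in> Obj D. fobj F (fobj G B) = B) \<and> (\<forall>g \<in> Arr D. farr F (farr G g) = g)"


section \<open>Linear categories\<close>

record ('o, 'm, 'k) lincat = "('o, 'm) category" +
  ladd :: "'m \<Rightarrow> 'm \<Rightarrow> 'm"
  lzero :: "'o \<Rightarrow> 'o \<Rightarrow> 'm"
  lsmult :: "'k \<Rightarrow> 'm \<Rightarrow> 'm"

text \<open>The ring multiplication and unit that a \<open>module\<close> record carries play no role here.\<close>

definition hom_module :: "('o, 'm, 'k, 'z) lincat_scheme \<Rightarrow> 'o \<Rightarrow> 'o \<Rightarrow> ('k, 'm) module" where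
  "hom_module C A B =
     \<lparr>carrier = homset C A B, monoid.mult = (\<lambda>_ _. undefined), one = undefined,
      ring.zero = lzero C A B, ring.add = ladd C, smult = lsmult C\<rparr>"

locale linear_category = field K + category C
  for K :: "'k ring" and C :: "('o, 'm, 'k, 'z) lincat_scheme" +
  assumes hom_vector_space: "A \<in> Obj C \<Longrightarrow> B \<in> Obj C \<Longrightarrow> module K (hom_module C A B)"
    and Comp_ladd_left: "f \<in> homset C A B \<Longrightarrow> g \<in> homset C B D \<Longrightarrow> g' \<in> homset C B D
      \<Longrightarrow> ladd C g g' \<cdot>\<^bsub>C\<^esub> f = ladd C (g \<cdot>\<^bsub>C\<^esub> f) (g' \<cdot>\<^bsub>C\<^esub> f)"
    and Comp_ladd_right: "f \<in> homset C A B \<Longrightarrow> f' \<in> homset C A B \<Longrightarrow> g \<in> homset C B D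
      \<Longrightarrow> g \<cdot>\<^bsub>C\<^esub> ladd C f f' = ladd C (g \<cdot>\<^bsub>C\<^esub> f) (g \<cdot>\<^bsub>C\<^esub> f')"
    and Comp_lsmult_left: "a \<in> carrier K \<Longrightarrow> f \<in> homset C A B \<Longrightarrow> g \<in> homset C B D
      \<Longrightarrow> lsmult C a g \<cdot>\<^bsub>C\<^esub> f = lsmult C a (g \<cdot>\<^bsub>C\<^esub> f)"
    and Comp_lsmult_right: "a \<in> carrier K \<Longrightarrow> f \<in> homset C A B \<Longrightarrow> g \<in> homset C B D
      \<Longrightarrow> g \<cdot>\<^bsub>C\<^esub> lsmult C a f = lsmult C a (g \<cdot>\<^bsub>C\<^esub> f)"

locale linear_functor = cat_functor C D F
  for K :: "'k ring" and C :: "('o, 'm, 'k, 'x) lincat_scheme"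
    and D :: "('p, 'q, 'k, 'y) lincat_scheme" and F :: "('o, 'm, 'p, 'q, 'z) fctr_scheme" +
  assumes farr_ladd: "f \<in> homset C A B \<Longrightarrow> g \<in> homset C A B
      \<Longrightarrow> farr F (ladd C f g) = ladd D (farr F f) (farr F g)"
    and farr_lsmult: "a \<in> carrier K \<Longrightarrow> f \<in> homset C A B
      \<Longrightarrow> farr F (lsmult C a f) = lsmult D a (farr F f)"

definition is_cokernel :: "('o, 'm, 'k, 'z) lincat_scheme \<Rightarrow> 'm \<Rightarrow> 'm \<Rightarrow> bool" where
  "is_cokernel C f c \<longleftrightarrow>
     f \<in> Arr C \<and> c \<in> Arr C \<and> Dom C c = Cod C f \<and> c \<cdot>\<^bsub>C\<^esub> f = lzero C (Dom C f) (Cod C c) \<and>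
     (\<forall>B. \<forall>h \<in> homset C (Cod C f) B. h \<cdot>\<^bsub>C\<^esub> f = lzero C (Dom C f) B
        \<longrightarrow> (\<exists>!u. u \<in> homset C (Cod C c) B \<and> u \<cdot>\<^bsub>C\<^esub> c = h))"

text \<open>Exactness of \<open>A \<rightarrow> B \<rightarrow> E \<rightarrow> 0\<close> says that \<open>B \<rightarrow> E\<close> is a cokernel of \<open>A \<rightarrow> B\<close>.\<close>

definition right_exact ::
  "('o, 'm, 'k, 'x) lincat_scheme \<Rightarrow> ('p, 'q, 'k, 'y) lincat_scheme
    \<Rightarrow> ('o, 'm, 'p, 'q, 'z) fctr_scheme \<Rightarrow> bool" where
  "right_exact C D F \<longleftrightarrow> (\<forall>f c. is_cokernel C f c \<longrightarrow> is_cokernel D (farr F f) (farr F c))"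

definition simple_object :: "('o, 'm, 'k, 'z) lincat_scheme \<Rightarrow> 'o \<Rightarrow> bool" where
  "simple_object C S \<longleftrightarrow>
     S \<in> Obj C \<and> idt C S \<noteq> lzero C S S \<and>
     (\<forall>f. monic C f \<and> Cod C f = S \<longrightarrow> f = lzero C (Dom C f) S \<or> iso_arrow C f)"

definition linearly_equivalent ::
  "'k ring \<Rightarrow> ('o, 'm, 'k, 'x) lincat_scheme \<Rightarrow> ('p, 'q, 'k, 'y) lincat_scheme \<Rightarrow> bool" where
  "linearly_equivalent K C D \<longleftrightarrow>
     (\<exists>(F :: ('o, 'm, 'p, 'q) fctr) (G :: ('p, 'q, 'o, 'm) fctr) \<eta> \<epsilon>.
        linear_functor K C D F \<and> linear_functor K D C G \<and>
        nat_iso C C (id_fctr C) (comp_fctr G F) \<eta> \<and> nat_iso D D (comp_fctr F G) (id_fctr D) \<epsilon>)"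


section \<open>Finite abelian categories\<close>

definition finite_dimensional :: "'k ring \<Rightarrow> ('k, 'v, 'z) module_scheme \<Rightarrow> bool" where
  "finite_dimensional K V \<longleftrightarrow>
     (\<exists>B. finite B \<and> B \<subseteq> carrier V \<and>
        (\<forall>v \<in> carrier V. \<exists>c \<in> B \<rightarrow> carrier K. v = (\<Oplus>\<^bsub>V\<^esub>b\<in>B. c b \<odot>\<^bsub>V\<^esub> b)))"

text \<open>The library's \<open>algebra\<close> is commutative and its \<open>module\<close> requires a commutative ring of
  scalars, so the noncommutative notions are spelled out.\<close>

definition fd_algebra :: "'k ring \<Rightarrow> ('k, 'a) module \<Rightarrow> bool" where
  "fd_algebra K A \<longleftrightarrow>
     ring A \<and> module K A \<and> finite_dimensional K A \<and>
     (\<forall>a \<in> carrier K. \<forall>x \<in> carrier A. \<forall>y \<in> carrier A.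
        (a \<odot>\<^bsub>A\<^esub> x) \<otimes>\<^bsub>A\<^esub> y = a \<odot>\<^bsub>A\<^esub> (x \<otimes>\<^bsub>A\<^esub> y) \<and> x \<otimes>\<^bsub>A\<^esub> (a \<odot>\<^bsub>A\<^esub> y) = a \<odot>\<^bsub>A\<^esub> (x \<otimes>\<^bsub>A\<^esub> y))"

definition left_module :: "('a, 'z) ring_scheme \<Rightarrow> ('a, 'v) module \<Rightarrow> bool" where
  "left_module A V \<longleftrightarrow>
     abelian_group V \<and>
     (\<forall>a \<in> carrier A. \<forall>x \<in> carrier V. a \<odot>\<^bsub>V\<^esub> x \<in> carrier V) \<and>
     (\<forall>a \<in> carrier A. \<forall>b \<in> carrier A. \<forall>x \<in> carrier V.
        (a \<oplus>\<^bsub>A\<^esub> b) \<odot>\<^bsub>V\<^esub> x = a \<odot>\<^bsub>V\<^esub> x \<oplus>\<^bsub>V\<^esub> b \<odot>\<^bsub>V\<^esub> x \<and>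
        (a \<otimes>\<^bsub>A\<^esub> b) \<odot>\<^bsub>V\<^esub> x = a \<odot>\<^bsub>V\<^esub> (b \<odot>\<^bsub>V\<^esub> x)) \<and>
     (\<forall>a \<in> carrier A. \<forall>x \<in> carrier V. \<forall>y \<in> carrier V.
        a \<odot>\<^bsub>V\<^esub> (x \<oplus>\<^bsub>V\<^esub> y) = a \<odot>\<^bsub>V\<^esub> x \<oplus>\<^bsub>V\<^esub> a \<odot>\<^bsub>V\<^esub> y) \<and>
     (\<forall>x \<in> carrier V. \<one>\<^bsub>A\<^esub> \<odot>\<^bsub>V\<^esub> x = x)"

definition restrict_scalars :: "('k, 'a) module \<Rightarrow> ('a, 'v) module \<Rightarrow> ('k, 'v) module" where
  "restrict_scalars A V =
     \<lparr>carrier = carrier V, monoid.mult = monoid.mult V, one = one V,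
      ring.zero = ring.zero V, ring.add = ring.add V,
      smult = (\<lambda>a x. (a \<odot>\<^bsub>A\<^esub> \<one>\<^bsub>A\<^esub>) \<odot>\<^bsub>V\<^esub> x)\<rparr>"

definition module_maps :: "('a, 'z) ring_scheme \<Rightarrow> ('a, 'v) module \<Rightarrow> ('a, 'v) module \<Rightarrow> ('v \<Rightarrow> 'v) set" where
  "module_maps A V W =
     {f \<in> carrier V \<rightarrow>\<^sub>E carrier W.
        (\<forall>x \<in> carrier V. \<forall>y \<in> carrier V. f (x \<oplus>\<^bsub>V\<^esub> y) = f x \<oplus>\<^bsub>W\<^esub> f y) \<and>
        (\<forall>a \<in> carrier A. \<forall>x \<in> carrier V. f (a \<odot>\<^bsub>V\<^esub> x) = a \<odot>\<^bsub>W\<^esub> f x)}"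

text \<open>Finite-dimensional left \<open>A\<close>-modules with elements in the type \<open>'v\<close>. As in all the
  concrete categories below, an arrow is a triple (source, target, underlying map).\<close>

definition fd_modules ::
  "'k ring \<Rightarrow> ('k, 'a) module \<Rightarrow>
    (('a, 'v) module, ('a, 'v) module \<times> ('a, 'v) module \<times> ('v \<Rightarrow> 'v), 'k) lincat" where
  "fd_modules K A =
    (let Ob = {V. left_module A V \<and> finite_dimensional K (restrict_scalars A V)} in
     \<lparr>Obj = Ob,
      Arr = {(V, W, f). V \<in> Ob \<and> W \<in> Ob \<and> f \<in> module_maps A V W},
      Dom = fst,
      Cod = fst \<circ> snd,
      idt = (\<lambda>V. (V, V, \<lambda>x \<in> carrier V. x)),
      Comp = (\<lambda>(V', W', g) (V, W, f). (V, W', compose (carrier V) g f)),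
      ladd = (\<lambda>(V, W, f) (V', W', g). (V, W, \<lambda>x \<in> carrier V. f x \<oplus>\<^bsub>W\<^esub> g x)),
      lzero = (\<lambda>V W. (V, W, \<lambda>x \<in> carrier V. \<zero>\<^bsub>W\<^esub>)),
      lsmult = (\<lambda>a (V, W, f). (V, W, \<lambda>x \<in> carrier V. (a \<odot>\<^bsub>A\<^esub> \<one>\<^bsub>A\<^esub>) \<odot>\<^bsub>W\<^esub> f x))\<rparr>)"

text \<open>The type \<open>nat \<Rightarrow> 'k\<close> contains a copy of every finite-dimensional space over \<open>K\<close>, so that
  up to isomorphism every finite-dimensional algebra and every finite-dimensional module over it
  occurs.\<close>

definition finite_abelian :: "'k ring \<Rightarrow> ('o, 'm, 'k, 'z) lincat_scheme \<Rightarrow> bool" where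
  "finite_abelian K C \<longleftrightarrow>
     linear_category K C \<and>
     (\<exists>A :: ('k, nat \<Rightarrow> 'k) module. fd_algebra K A \<and>
        linearly_equivalent K C
          (fd_modules K A :: ((nat \<Rightarrow> 'k, nat \<Rightarrow> 'k) module, _, 'k) lincat))"


section \<open>Finite tensor categories and finite module categories\<close>

definition bifunctor ::
  "('o, 'm, 'x) category_scheme \<Rightarrow> ('p, 'q, 'y) category_scheme \<Rightarrow> ('r, 's, 'z) category_scheme
    \<Rightarrow> ('o \<Rightarrow> 'p \<Rightarrow> 'r) \<Rightarrow> ('m \<Rightarrow> 'q \<Rightarrow> 's) \<Rightarrow> bool" where
  "bifunctor C D E tO tA \<longleftrightarrow>
     (\<forall>U \<in> Obj C. \<forall>V \<in> Obj D. tO U V \<in> Obj E \<and> tA (idt C U) (idt D V) = idt E (tO U V)) \<and>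
     (\<forall>f \<in> Arr C. \<forall>g \<in> Arr D.
        tA f g \<in> homset E (tO (Dom C f) (Dom D g)) (tO (Cod C f) (Cod D g))) \<and>
     (\<forall>f \<in> Arr C. \<forall>f' \<in> Arr C. \<forall>g \<in> Arr D. \<forall>g' \<in> Arr D.
        Dom C f' = Cod C f \<and> Dom D g' = Cod D g
        \<longrightarrow> tA (f' \<cdot>\<^bsub>C\<^esub> f) (g' \<cdot>\<^bsub>D\<^esub> g) = tA f' g' \<cdot>\<^bsub>E\<^esub> tA f g)"

definition fix_left ::
  "('o, 'm, 'x) category_scheme \<Rightarrow> ('o \<Rightarrow> 'p \<Rightarrow> 'r) \<Rightarrow> ('m \<Rightarrow> 'q \<Rightarrow> 's) \<Rightarrow> 'o \<Rightarrow> ('p, 'q, 'r, 's) fctr" where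
  "fix_left C tO tA U = \<lparr>fobj = tO U, farr = tA (idt C U)\<rparr>"

definition fix_right ::
  "('p, 'q, 'x) category_scheme \<Rightarrow> ('o \<Rightarrow> 'p \<Rightarrow> 'r) \<Rightarrow> ('m \<Rightarrow> 'q \<Rightarrow> 's) \<Rightarrow> 'p \<Rightarrow> ('o, 'm, 'r, 's) fctr" where
  "fix_right D tO tA V = \<lparr>fobj = (\<lambda>U. tO U V), farr = (\<lambda>f. tA f (idt D V))\<rparr>"

definition linear_in_each_variable where
  "linear_in_each_variable K C D E tO tA \<longleftrightarrow>
     (\<forall>U \<in> Obj C. linear_functor K D E (fix_left C tO tA U)) \<and>
     (\<forall>V \<in> Obj D. linear_functor K C E (fix_right D tO tA V))"

definition right_exact_in_each_variable where
  "right_exact_in_each_variable C D E tO tA \<longleftrightarrow>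
     (\<forall>U \<in> Obj C. right_exact D E (fix_left C tO tA U)) \<and>
     (\<forall>V \<in> Obj D. right_exact C E (fix_right D tO tA V))"

record ('o, 'm, 'k) moncat = "('o, 'm, 'k) lincat" +
  tenO :: "'o \<Rightarrow> 'o \<Rightarrow> 'o"
  tenA :: "'m \<Rightarrow> 'm \<Rightarrow> 'm"
  unt :: 'o
  asc :: "'o \<Rightarrow> 'o \<Rightarrow> 'o \<Rightarrow> 'm"
  lun :: "'o \<Rightarrow> 'm"
  run :: "'o \<Rightarrow> 'm"

locale monoidal_category = category C
  for C :: "('o, 'm, 'k) moncat" (structure) +
  assumes ten_bifunctor: "bifunctor C C C (tenO C) (tenA C)"
    and unt_closed: "unt C \<in> Obj C"
    and asc_closed: "U \<in> Obj C \<Longrightarrow> V \<in> Obj C \<Longrightarrow> W \<in> Obj C \<Longrightarrow>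
      asc C U V W \<in> homset C (tenO C (tenO C U V) W) (tenO C U (tenO C V W)) \<and> iso_arrow C (asc C U V W)"
    and asc_natural: "f \<in> homset C U U' \<Longrightarrow> g \<in> homset C V V' \<Longrightarrow> h \<in> homset C W W' \<Longrightarrow>
      asc C U' V' W' \<cdot> tenA C (tenA C f g) h = tenA C f (tenA C g h) \<cdot> asc C U V W"
    and lun_closed: "U \<in> Obj C \<Longrightarrow>
      lun C U \<in> homset C (tenO C (unt C) U) U \<and> iso_arrow C (lun C U)"
    and lun_natural: "f \<in> homset C U U' \<Longrightarrow>
      lun C U' \<cdot> tenA C (idt C (unt C)) f = f \<cdot> lun C U"
    and run_closed: "U \<in> Obj C \<Longrightarrow>
      run C U \<in> homset C (tenO C U (unt C)) U \<and> iso_arrow C (run C U)"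
    and run_natural: "f \<in> homset C U U' \<Longrightarrow>
      run C U' \<cdot> tenA C f (idt C (unt C)) = f \<cdot> run C U"
    and pentagon: "T \<in> Obj C \<Longrightarrow> U \<in> Obj C \<Longrightarrow> V \<in> Obj C \<Longrightarrow> W \<in> Obj C \<Longrightarrow>
      asc C T U (tenO C V W) \<cdot> asc C (tenO C T U) V W =
      tenA C (idt C T) (asc C U V W) \<cdot> asc C T (tenO C U V) W \<cdot> tenA C (asc C T U V) (idt C W)"
    and triangle: "U \<in> Obj C \<Longrightarrow> V \<in> Obj C \<Longrightarrow>
      tenA C (idt C U) (lun C V) \<cdot> asc C U (unt C) V = tenA C (run C U) (idt C V)"

text \<open>\<open>V\<close> is left dual to \<open>U\<close> (equivalently, \<open>U\<close> is right dual to \<open>V\<close>), with evaluation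
  \<open>V \<otimes> U \<rightarrow> 1\<close> and coevaluation \<open>1 \<rightarrow> U \<otimes> V\<close>.\<close>

definition dual_pair :: "('o, 'm, 'k) moncat \<Rightarrow> 'o \<Rightarrow> 'o \<Rightarrow> 'm \<Rightarrow> 'm \<Rightarrow> bool" where
  "dual_pair C V U ev coev \<longleftrightarrow>
     ev \<in> homset C (tenO C V U) (unt C) \<and> coev \<in> homset C (unt C) (tenO C U V) \<and>
     run C U \<cdot>\<^bsub>C\<^esub> tenA C (idt C U) ev \<cdot>\<^bsub>C\<^esub> asc C U V U \<cdot>\<^bsub>C\<^esub> tenA C coev (idt C U) = lun C U \<and>
     lun C V \<cdot>\<^bsub>C\<^esub> tenA C ev (idt C V) \<cdot>\<^bsub>C\<^esub> inv_arrow C (asc C V U V) \<cdot>\<^bsub>C\<^esub> tenA C (idt C V) coev = run C V"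

definition rigid :: "('o, 'm, 'k) moncat \<Rightarrow> bool" where
  "rigid C \<longleftrightarrow> (\<forall>U \<in> Obj C.
     (\<exists>V \<in> Obj C. \<exists>ev coev. dual_pair C V U ev coev) \<and>
     (\<exists>V \<in> Obj C. \<exists>ev coev. dual_pair C U V ev coev))"

locale finite_tensor_category = algebraically_closed K + monoidal_category C
  for K :: "'k ring" and C :: "('o, 'm, 'k) moncat" +
  assumes finite_abelian: "finite_abelian K C"
    and rigid: "rigid C"
    and ten_linear: "linear_in_each_variable K C C C (tenO C) (tenA C)"
    and unt_simple: "simple_object C (unt C)"

record ('n, 'p, 'k, 'o, 'm) modcat = "('n, 'p, 'k) lincat" +
  actO :: "'o \<Rightarrow> 'n \<Rightarrow> 'n"
  actA :: "'m \<Rightarrow> 'p \<Rightarrow> 'p"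
  mas :: "'o \<Rightarrow> 'o \<Rightarrow> 'n \<Rightarrow> 'p"
  mun :: "'n \<Rightarrow> 'p"

locale left_module_category = C: monoidal_category C + M: category M
  for C :: "('o, 'm, 'k) moncat" and M :: "('n, 'p, 'k, 'o, 'm) modcat" (structure) +
  assumes act_bifunctor: "bifunctor C M M (actO M) (actA M)"
    and mas_closed: "U \<in> Obj C \<Longrightarrow> V \<in> Obj C \<Longrightarrow> A \<in> Obj M \<Longrightarrow>
      mas M U V A \<in> homset M (actO M (tenO C U V) A) (actO M U (actO M V A)) \<and> iso_arrow M (mas M U V A)"
    and mas_natural: "f \<in> homset C U U' \<Longrightarrow> g \<in> homset C V V' \<Longrightarrow> h \<in> homset M A A' \<Longrightarrow>
      mas M U' V' A' \<cdot> actA M (tenA C f g) h = actA M f (actA M g h) \<cdot> mas M U V A"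
    and mun_closed: "A \<in> Obj M \<Longrightarrow>
      mun M A \<in> homset M (actO M (unt C) A) A \<and> iso_arrow M (mun M A)"
    and mun_natural: "h \<in> homset M A A' \<Longrightarrow>
      mun M A' \<cdot> actA M (idt C (unt C)) h = h \<cdot> mun M A"
    and mas_pentagon: "U \<in> Obj C \<Longrightarrow> V \<in> Obj C \<Longrightarrow> W \<in> Obj C \<Longrightarrow> A \<in> Obj M \<Longrightarrow>
      mas M U V (actO M W A) \<cdot> mas M (tenO C U V) W A =
      actA M (idt C U) (mas M V W A) \<cdot> mas M U (tenO C V W) A \<cdot> actA M (asc C U V W) (idt M A)"
    and mun_triangle: "U \<in> Obj C \<Longrightarrow> A \<in> Obj M \<Longrightarrow>
      actA M (idt C U) (mun M A) \<cdot> mas M U (unt C) A = actA M (run C U) (idt M A)"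

locale finite_module_category = left_module_category C M
  for K :: "'k ring" and C :: "('o, 'm, 'k) moncat" and M :: "('n, 'p, 'k, 'o, 'm) modcat" +
  assumes finite_abelian: "finite_abelian K M"
    and act_linear: "linear_in_each_variable K C M M (actO M) (actA M)"
    and act_right_exact: "right_exact_in_each_variable C M M (actO M) (actA M)"


section \<open>Bimodule categories, bimodule functors and the center construction\<close>

text \<open>The actions \<open>U \<rhd> N\<close> and \<open>N \<lhd> U\<close> with constraints
  \<open>bla U V N : (U \<otimes> V) \<rhd> N \<rightarrow> U \<rhd> (V \<rhd> N)\<close>, \<open>blu N : 1 \<rhd> N \<rightarrow> N\<close>,
  \<open>bra N U V : (N \<lhd> U) \<lhd> V \<rightarrow> N \<lhd> (U \<otimes> V)\<close>, \<open>bru N : N \<lhd> 1 \<rightarrow> N\<close>,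
  \<open>bma U N V : (U \<rhd> N) \<lhd> V \<rightarrow> U \<rhd> (N \<lhd> V)\<close>.\<close>

record ('n, 'p, 'k, 'o, 'm) bimodcat = "('n, 'p, 'k) lincat" +
  blO :: "'o \<Rightarrow> 'n \<Rightarrow> 'n"
  blA :: "'m \<Rightarrow> 'p \<Rightarrow> 'p"
  brO :: "'n \<Rightarrow> 'o \<Rightarrow> 'n"
  brA :: "'p \<Rightarrow> 'm \<Rightarrow> 'p"
  bla :: "'o \<Rightarrow> 'o \<Rightarrow> 'n \<Rightarrow> 'p"
  blu :: "'n \<Rightarrow> 'p"
  bra :: "'n \<Rightarrow> 'o \<Rightarrow> 'o \<Rightarrow> 'p"
  bru :: "'n \<Rightarrow> 'p"
  bma :: "'o \<Rightarrow> 'n \<Rightarrow> 'o \<Rightarrow> 'p"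

definition regular_bimodule :: "('o, 'm, 'k) moncat \<Rightarrow> ('o, 'm, 'k, 'o, 'm) bimodcat" where
  "regular_bimodule C = lincat.extend (lincat.truncate C)
     (bimodcat.fields (tenO C) (tenA C) (tenO C) (tenA C)
        (asc C) (lun C) (asc C) (run C) (asc C))"

text \<open>Structure isomorphisms \<open>bfl F U N : U \<rhd> F N \<rightarrow> F (U \<rhd> N)\<close> and
  \<open>bfr F N U : F N \<lhd> U \<rightarrow> F (N \<lhd> U)\<close>.\<close>

record ('n, 'p, 'n2, 'p2, 'o) bimod_fctr = "('n, 'p, 'n2, 'p2) fctr" +
  bfl :: "'o \<Rightarrow> 'n \<Rightarrow> 'p2"
  bfr :: "'n \<Rightarrow> 'o \<Rightarrow> 'p2"

locale bimodule_functor = linear_functor K N N' F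
  for K :: "'k ring" and C :: "('o, 'm, 'k) moncat"
    and N :: "('n, 'p, 'k, 'o, 'm) bimodcat" and N' :: "('n2, 'p2, 'k, 'o, 'm) bimodcat" (structure)
    and F :: "('n, 'p, 'n2, 'p2, 'o) bimod_fctr" +
  assumes bfl_closed: "U \<in> Obj C \<Longrightarrow> A \<in> Obj N \<Longrightarrow>
      bfl F U A \<in> homset N' (blO N' U (fobj F A)) (fobj F (blO N U A)) \<and> iso_arrow N' (bfl F U A)"
    and bfl_natural: "f \<in> homset C U V \<Longrightarrow> g \<in> homset N A B \<Longrightarrow>
      bfl F V B \<cdot> blA N' f (farr F g) = farr F (blA N f g) \<cdot> bfl F U A"
    and bfr_closed: "U \<in> Obj C \<Longrightarrow> A \<in> Obj N \<Longrightarrow>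
      bfr F A U \<in> homset N' (brO N' (fobj F A) U) (fobj F (brO N A U)) \<and> iso_arrow N' (bfr F A U)"
    and bfr_natural: "f \<in> homset C U V \<Longrightarrow> g \<in> homset N A B \<Longrightarrow>
      bfr F B V \<cdot> brA N' (farr F g) f = farr F (brA N g f) \<cdot> bfr F A U"
    and bfl_assoc: "U \<in> Obj C \<Longrightarrow> V \<in> Obj C \<Longrightarrow> A \<in> Obj N \<Longrightarrow>
      farr F (bla N U V A) \<cdot> bfl F (tenO C U V) A =
      bfl F U (blO N V A) \<cdot> blA N' (idt C U) (bfl F V A) \<cdot> bla N' U V (fobj F A)"
    and bfl_unit: "A \<in> Obj N \<Longrightarrow> farr F (blu N A) \<cdot> bfl F (unt C) A = blu N' (fobj F A)"
    and bfr_assoc: "U \<in> Obj C \<Longrightarrow> V \<in> Obj C \<Longrightarrow> A \<in> Obj N \<Longrightarrow>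
      farr F (bra N A U V) \<cdot> bfr F (brO N A U) V \<cdot> brA N' (bfr F A U) (idt C V) =
      bfr F A (tenO C U V) \<cdot> bra N' (fobj F A) U V"
    and bfr_unit: "A \<in> Obj N \<Longrightarrow> farr F (bru N A) \<cdot> bfr F A (unt C) = bru N' (fobj F A)"
    and bf_middle: "U \<in> Obj C \<Longrightarrow> V \<in> Obj C \<Longrightarrow> A \<in> Obj N \<Longrightarrow>
      farr F (bma N U A V) \<cdot> bfr F (blO N U A) V \<cdot> brA N' (bfl F U A) (idt C V) =
      bfl F U (brO N A V) \<cdot> blA N' (idt C U) (bfr F A V) \<cdot> bma N' U (fobj F A) V"

definition id_bimod_fctr ::
  "('n, 'p, 'k, 'o, 'm) bimodcat \<Rightarrow> ('n, 'p, 'n, 'p, 'o) bimod_fctr" where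
  "id_bimod_fctr N = fctr.extend (id_fctr N)
     (bimod_fctr.fields (\<lambda>U A. idt N (blO N U A)) (\<lambda>A U. idt N (brO N A U)))"

definition comp_bimod_fctr ::
  "('n3, 'p3, 'k, 'o, 'm) bimodcat \<Rightarrow> ('n2, 'p2, 'n3, 'p3, 'o) bimod_fctr
    \<Rightarrow> ('n, 'p, 'n2, 'p2, 'o) bimod_fctr \<Rightarrow> ('n, 'p, 'n3, 'p3, 'o) bimod_fctr" where
  "comp_bimod_fctr N3 G F = fctr.extend (comp_fctr G F)
     (bimod_fctr.fields
        (\<lambda>U A. farr G (bfl F U A) \<cdot>\<^bsub>N3\<^esub> bfl G U (fobj F A))
        (\<lambda>A U. farr G (bfr F A U) \<cdot>\<^bsub>N3\<^esub> bfr G (fobj F A) U))"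

locale bimodule_transformation = nat_trans N N' F G \<alpha>
  for C :: "('o, 'm, 'k) moncat"
    and N :: "('n, 'p, 'k, 'o, 'm) bimodcat" and N' :: "('n2, 'p2, 'k, 'o, 'm) bimodcat" (structure)
    and F :: "('n, 'p, 'n2, 'p2, 'o) bimod_fctr" and G :: "('n, 'p, 'n2, 'p2, 'o) bimod_fctr"
    and \<alpha> :: "'n \<Rightarrow> 'p2" +
  assumes transf_left: "U \<in> Obj C \<Longrightarrow> A \<in> Obj N \<Longrightarrow>
      \<alpha> (blO N U A) \<cdot> bfl F U A = bfl G U A \<cdot> blA N' (idt C U) (\<alpha> A)"
    and transf_right: "U \<in> Obj C \<Longrightarrow> A \<in> Obj N \<Longrightarrow>
      \<alpha> (brO N A U) \<cdot> bfr F A U = bfr G A U \<cdot> brA N' (\<alpha> A) (idt C U)"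

text \<open>The constraints enter where \<open>\<sigma>\<^sub>1 = id\<close> and
  \<open>\<sigma>\<^bsub>U \<otimes> V\<^esub> = (id\<^sub>U \<otimes> \<sigma>\<^sub>V) \<circ> (\<sigma>\<^sub>U \<otimes> id\<^sub>V)\<close> suppress them.\<close>

definition half_braiding ::
  "('o, 'm, 'k) moncat \<Rightarrow> ('n, 'p, 'k, 'o, 'm) bimodcat \<Rightarrow> 'n \<Rightarrow> ('o \<Rightarrow> 'p) \<Rightarrow> bool" where
  "half_braiding C N A \<sigma> \<longleftrightarrow>
     \<sigma> \<in> extensional (Obj C) \<and>
     (\<forall>U \<in> Obj C. \<sigma> U \<in> homset N (brO N A U) (blO N U A) \<and> iso_arrow N (\<sigma> U)) \<and>
     (\<forall>f \<in> Arr C. blA N f (idt N A) \<cdot>\<^bsub>N\<^esub> \<sigma> (Dom C f) = \<sigma> (Cod C f) \<cdot>\<^bsub>N\<^esub> brA N (idt N A) f) \<and>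
     blu N A \<cdot>\<^bsub>N\<^esub> \<sigma> (unt C) = bru N A \<and>
     (\<forall>U \<in> Obj C. \<forall>V \<in> Obj C.
        bla N U V A \<cdot>\<^bsub>N\<^esub> \<sigma> (tenO C U V) \<cdot>\<^bsub>N\<^esub> bra N A U V =
        blA N (idt C U) (\<sigma> V) \<cdot>\<^bsub>N\<^esub> bma N U A V \<cdot>\<^bsub>N\<^esub> brA N (\<sigma> U) (idt C V))"

definition center ::
  "('o, 'm, 'k) moncat \<Rightarrow> ('n, 'p, 'k, 'o, 'm) bimodcat
    \<Rightarrow> ('n \<times> ('o \<Rightarrow> 'p), ('n \<times> ('o \<Rightarrow> 'p)) \<times> ('n \<times> ('o \<Rightarrow> 'p)) \<times> 'p) category" where
  "center C N =
    (let Ob = {(A, \<sigma>). A \<in> Obj N \<and> half_braiding C N A \<sigma>} in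
     \<lparr>Obj = Ob,
      Arr = {((A, \<sigma>), (B, \<tau>), f). (A, \<sigma>) \<in> Ob \<and> (B, \<tau>) \<in> Ob \<and> f \<in> homset N A B \<and>
        (\<forall>U \<in> Obj C. blA N (idt C U) f \<cdot>\<^bsub>N\<^esub> \<sigma> U = \<tau> U \<cdot>\<^bsub>N\<^esub> brA N f (idt C U))},
      Dom = fst,
      Cod = fst \<circ> snd,
      idt = (\<lambda>(A, \<sigma>). ((A, \<sigma>), (A, \<sigma>), idt N A)),
      Comp = (\<lambda>(S', T', g) (S, T, f). (S, T', g \<cdot>\<^bsub>N\<^esub> f))\<rparr>)"

definition drinfeld_center where
  "drinfeld_center C = center C (regular_bimodule C)"

definition center_fobj ::
  "('o, 'm, 'k) moncat \<Rightarrow> ('n2, 'p2, 'k, 'o, 'm) bimodcat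
    \<Rightarrow> ('n, 'p, 'n2, 'p2, 'o) bimod_fctr \<Rightarrow> 'n \<times> ('o \<Rightarrow> 'p) \<Rightarrow> 'n2 \<times> ('o \<Rightarrow> 'p2)" where
  "center_fobj C N' F = (\<lambda>(A, \<sigma>).
     (fobj F A, \<lambda>U \<in> Obj C. inv_arrow N' (bfl F U A) \<cdot>\<^bsub>N'\<^esub> farr F (\<sigma> U) \<cdot>\<^bsub>N'\<^esub> bfr F A U))"

definition center_fctr where
  "center_fctr C N' F =
     \<lparr>fobj = center_fobj C N' F,
      farr = (\<lambda>(S, T, f). (center_fobj C N' F S, center_fobj C N' F T, farr F f))\<rparr>"


section \<open>Right exact endofunctors of a module category\<close>

text \<open>Functors and component families are extensional. A natural transformation is a triple
  (source, target, components).\<close>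

type_synonym ('n, 'p) endof = "('n, 'p, 'n, 'p) fctr"
type_synonym ('n, 'p) endot = "('n, 'p) endof \<times> ('n, 'p) endof \<times> ('n \<Rightarrow> 'p)"

definition components :: "('n, 'p) endot \<Rightarrow> 'n \<Rightarrow> 'p" where
  "components = snd \<circ> snd"

definition Rex :: "'k ring \<Rightarrow> ('n, 'p, 'k, 'z) lincat_scheme \<Rightarrow> (('n, 'p) endof, ('n, 'p) endot, 'k) lincat" where
  "Rex K M =
    (let Ob = {F. linear_functor K M M F \<and> right_exact M M F \<and>
                 fobj F \<in> extensional (Obj M) \<and> farr F \<in> extensional (Arr M)} in
     \<lparr>Obj = Ob,
      Arr = {(F, G, \<alpha>). F \<in> Ob \<and> G \<in> Ob \<and> nat_trans M M F G \<alpha> \<and> \<alpha> \<in> extensional (Obj M)},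
      Dom = fst,
      Cod = fst \<circ> snd,
      idt = (\<lambda>F. (F, F, \<lambda>A \<in> Obj M. idt M (fobj F A))),
      Comp = (\<lambda>(F', G', \<beta>) (F, G, \<alpha>). (F, G', \<lambda>A \<in> Obj M. \<beta> A \<cdot>\<^bsub>M\<^esub> \<alpha> A)),
      ladd = (\<lambda>(F, G, \<alpha>) (F', G', \<beta>). (F, G, \<lambda>A \<in> Obj M. ladd M (\<alpha> A) (\<beta> A))),
      lzero = (\<lambda>F G. (F, G, \<lambda>A \<in> Obj M. lzero M (fobj F A) (fobj G A))),
      lsmult = (\<lambda>a (F, G, \<alpha>). (F, G, \<lambda>A \<in> Obj M. lsmult M a (\<alpha> A)))\<rparr>)"

text \<open>\<open>(U \<rhd> F)(A) = U \<otimes> F(A)\<close> and \<open>(F \<lhd> U)(A) = F(U \<otimes> A)\<close>.\<close>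

definition rex_lO where
  "rex_lO C M U F =
     \<lparr>fobj = (\<lambda>A \<in> Obj M. actO M U (fobj F A)),
      farr = (\<lambda>g \<in> Arr M. actA M (idt C U) (farr F g))\<rparr>"

definition rex_rO where
  "rex_rO C M F U =
     \<lparr>fobj = (\<lambda>A \<in> Obj M. fobj F (actO M U A)),
      farr = (\<lambda>g \<in> Arr M. farr F (actA M (idt C U) g))\<rparr>"

definition rex_lA ::
  "('o, 'm, 'k) moncat \<Rightarrow> ('n, 'p, 'k, 'o, 'm) modcat \<Rightarrow> 'm \<Rightarrow> ('n, 'p) endot \<Rightarrow> ('n, 'p) endot" where
  "rex_lA C M f = (\<lambda>(F, G, \<alpha>).
     (rex_lO C M (Dom C f) F, rex_lO C M (Cod C f) G, \<lambda>A \<in> Obj M. actA M f (\<alpha> A)))"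

definition rex_rA ::
  "('o, 'm, 'k) moncat \<Rightarrow> ('n, 'p, 'k, 'o, 'm) modcat \<Rightarrow> ('n, 'p) endot \<Rightarrow> 'm \<Rightarrow> ('n, 'p) endot" where
  "rex_rA C M = (\<lambda>(F, G, \<alpha>) f.
     (rex_rO C M F (Dom C f), rex_rO C M G (Cod C f),
      \<lambda>A \<in> Obj M. \<alpha> (actO M (Cod C f) A) \<cdot>\<^bsub>M\<^esub> farr F (actA M f (idt M A))))"

text \<open>The middle constraint is an identity, as \<open>(U \<rhd> F) \<lhd> V\<close> and \<open>U \<rhd> (F \<lhd> V)\<close> coincide.\<close>

definition rex_bimodule ::
  "'k ring \<Rightarrow> ('o, 'm, 'k) moncat \<Rightarrow> ('n, 'p, 'k, 'o, 'm) modcat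
    \<Rightarrow> (('n, 'p) endof, ('n, 'p) endot, 'k, 'o, 'm) bimodcat" where
  "rex_bimodule K C M = lincat.extend (Rex K M)
     (bimodcat.fields (rex_lO C M) (rex_lA C M) (rex_rO C M) (rex_rA C M)
        (\<lambda>U V F. (rex_lO C M (tenO C U V) F, rex_lO C M U (rex_lO C M V F),
                   \<lambda>A \<in> Obj M. mas M U V (fobj F A)))
        (\<lambda>F. (rex_lO C M (unt C) F, F, \<lambda>A \<in> Obj M. mun M (fobj F A)))
        (\<lambda>F U V. (rex_rO C M (rex_rO C M F U) V, rex_rO C M F (tenO C U V),
                   \<lambda>A \<in> Obj M. farr F (inv_arrow M (mas M U V A))))
        (\<lambda>F. (rex_rO C M F (unt C), F, \<lambda>A \<in> Obj M. farr F (mun M A)))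
        (\<lambda>U F V. idt (Rex K M) (rex_lO C M U (rex_rO C M F V))))"

definition action_functor ::
  "('o, 'm, 'k) moncat \<Rightarrow> ('n, 'p, 'k, 'o, 'm) modcat
    \<Rightarrow> ('o, 'm, ('n, 'p) endof, ('n, 'p) endot, 'o) bimod_fctr" where
  "action_functor C M =
    (let \<rho> = (\<lambda>U. rex_lO C M U (id_fctr M)) in
     \<lparr>fobj = \<rho>,
      farr = (\<lambda>f. rex_lA C M f (id_fctr M, id_fctr M, \<lambda>A \<in> Obj M. idt M A)),
      bfl = (\<lambda>U V. (rex_lO C M U (\<rho> V), \<rho> (tenO C U V), \<lambda>A \<in> Obj M. inv_arrow M (mas M U V A))),
      bfr = (\<lambda>V U. (rex_rO C M (\<rho> V) U, \<rho> (tenO C V U), \<lambda>A \<in> Obj M. inv_arrow M (mas M V U A)))\<rparr>)"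

definition module_structure ::
  "('o, 'm, 'k) moncat \<Rightarrow> ('n, 'p, 'k, 'o, 'm) modcat \<Rightarrow> ('n, 'p) endof \<Rightarrow> ('o \<times> 'n \<Rightarrow> 'p) \<Rightarrow> bool" where
  "module_structure C M F s \<longleftrightarrow>
     s \<in> extensional (Obj C \<times> Obj M) \<and>
     (\<forall>U \<in> Obj C. \<forall>A \<in> Obj M.
        s (U, A) \<in> homset M (actO M U (fobj F A)) (fobj F (actO M U A)) \<and> iso_arrow M (s (U, A))) \<and>
     (\<forall>f \<in> Arr C. \<forall>g \<in> Arr M.
        s (Cod C f, Cod M g) \<cdot>\<^bsub>M\<^esub> actA M f (farr F g) = farr F (actA M f g) \<cdot>\<^bsub>M\<^esub> s (Dom C f, Dom M g)) \<and>
     (\<forall>U \<in> Obj C. \<forall>V \<in> Obj C. \<forall>A \<in> Obj M.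
        farr F (mas M U V A) \<cdot>\<^bsub>M\<^esub> s (tenO C U V, A) =
        s (U, actO M V A) \<cdot>\<^bsub>M\<^esub> actA M (idt C U) (s (V, A)) \<cdot>\<^bsub>M\<^esub> mas M U V (fobj F A)) \<and>
     (\<forall>A \<in> Obj M. farr F (mun M A) \<cdot>\<^bsub>M\<^esub> s (unt C, A) = mun M (fobj F A))"

definition Rex_module ::
  "'k ring \<Rightarrow> ('o, 'm, 'k) moncat \<Rightarrow> ('n, 'p, 'k, 'o, 'm) modcat
    \<Rightarrow> (('n, 'p) endof \<times> ('o \<times> 'n \<Rightarrow> 'p),
        (('n, 'p) endof \<times> ('o \<times> 'n \<Rightarrow> 'p)) \<times> (('n, 'p) endof \<times> ('o \<times> 'n \<Rightarrow> 'p)) \<times> ('n, 'p) endot) category" where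
  "Rex_module K C M =
    (let Ob = {(F, s). F \<in> Obj (Rex K M) \<and> module_structure C M F s} in
     \<lparr>Obj = Ob,
      Arr = {((F, s), (G, t), \<alpha>). (F, s) \<in> Ob \<and> (G, t) \<in> Ob \<and> \<alpha> \<in> homset (Rex K M) F G \<and>
        (\<forall>U \<in> Obj C. \<forall>A \<in> Obj M.
           components \<alpha> (actO M U A) \<cdot>\<^bsub>M\<^esub> s (U, A) = t (U, A) \<cdot>\<^bsub>M\<^esub> actA M (idt C U) (components \<alpha> A))},
      Dom = fst,
      Cod = fst \<circ> snd,
      idt = (\<lambda>(F, s). ((F, s), (F, s), idt (Rex K M) F)),
      Comp = (\<lambda>(S', T', \<beta>) (S, T, \<alpha>). (S, T', \<beta> \<cdot>\<^bsub>Rex K M\<^esub> \<alpha>))\<rparr>)"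

text \<open>The identification \<open>(F, \<sigma>) \<leftrightarrow> (F, s = \<sigma>\<^sup>-\<^sup>1)\<close> of the center of \<open>Rex K M\<close> with
  \<open>Rex_module K C M\<close>, in both directions.\<close>

definition center_to_module_obj ::
  "('o, 'm, 'k) moncat \<Rightarrow> ('n, 'p, 'k, 'o, 'm) modcat
    \<Rightarrow> ('n, 'p) endof \<times> ('o \<Rightarrow> ('n, 'p) endot) \<Rightarrow> ('n, 'p) endof \<times> ('o \<times> 'n \<Rightarrow> 'p)" where
  "center_to_module_obj C M = (\<lambda>(F, \<sigma>).
     (F, \<lambda>(U, A) \<in> Obj C \<times> Obj M. inv_arrow M (components (\<sigma> U) A)))"

definition center_to_module where
  "center_to_module C M =
     \<lparr>fobj = center_to_module_obj C M,
      farr = (\<lambda>(S, T, \<alpha>). (center_to_module_obj C M S, center_to_module_obj C M T, \<alpha>))\<rparr>"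

definition module_to_center_obj ::
  "('o, 'm, 'k) moncat \<Rightarrow> ('n, 'p, 'k, 'o, 'm) modcat
    \<Rightarrow> ('n, 'p) endof \<times> ('o \<times> 'n \<Rightarrow> 'p) \<Rightarrow> ('n, 'p) endof \<times> ('o \<Rightarrow> ('n, 'p) endot)" where
  "module_to_center_obj C M = (\<lambda>(F, s).
     (F, \<lambda>U \<in> Obj C. (rex_rO C M F U, rex_lO C M U F, \<lambda>A \<in> Obj M. inv_arrow M (s (U, A)))))"

definition module_to_center where
  "module_to_center C M =
     \<lparr>fobj = module_to_center_obj C M,
      farr = (\<lambda>(S, T, \<alpha>). (module_to_center_obj C M S, module_to_center_obj C M T, \<alpha>))\<rparr>"

end

theory Submission
  imports Defs
begin

text \<open>The center construction is 2-functorial in the bimodule category, and 2-functors preserve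
  adjunctions. Concretely: a bimodule functor \<open>F\<close> carries half-braidings to half-braidings, by
  conjugating \<open>F(\<sigma>\<^sub>U)\<close> with the two structure isomorphisms of \<open>F\<close> (\<open>half_braiding_image\<close>); the
  resulting functor \<open>Z(F)\<close> satisfies \<open>Z(G \<circ> F) = Z(G) \<circ> Z(F)\<close> on the nose (\<open>center_fobj_comp\<close>); and
  the components of a bimodule transformation are morphisms of the center
  (\<open>center_transformation\<close>). So if \<open>F\<close> is left adjoint to \<open>G\<close> and the unit and counit are bimodule
  transformations, then these same arrows are the unit and counit of an adjunction between \<open>Z(F)\<close>
  and \<open>Z(G)\<close>, and the triangle identities are inherited (\<open>center_adjunction\<close>).

  To use this for the action functor \<open>\<rho>\<close>, two things are checked about it and its target. The right
  exact endofunctors of \<open>M\<close> carry two actions of \<open>C\<close>, with constraints built from those of \<open>M\<close>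
  (\<open>rex_two_sided_action\<close>), and \<open>\<rho>\<close> is a bimodule functor
  (\<open>action_functor_bimodule_functor\<close>): its three associativity axioms are all the pentagon of \<open>M\<close>,
  its right unit axiom is the triangle, and its left unit axiom is the remaining triangle, which
  follows from the other coherence axioms by Kelly's argument (\<open>mun_act\<close>).

  Finally, written on components, a half-braiding on a right exact endofunctor \<open>F\<close> is a family
  \<open>F (U \<otimes> A) \<rightarrow> U \<otimes> F A\<close>, and its axioms are those of a module structure on \<open>F\<close> read for the inverse
  family. This makes the center isomorphic, not merely equivalent, to the category of module
  endofunctors (\<open>center_Rex_module_inverse_functors\<close>), and an adjunction can be composed with an
  isomorphism of categories (\<open>adjoint_pair_transport\<close>).\<close>

section \<open>Categories and functors\<close>

text \<open>The axioms of \<open>category\<close> mention intermediate objects that do not occur in the composites. Stated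
  through \<open>Arr\<close>, \<open>Dom\<close> and \<open>Cod\<close> they become conditional rewrite rules: the simplifier decides
  composability, brackets composites to the right and cancels inverses. An equation between composites
  is then used by bracketing the relevant factors together by hand.\<close>

lemma homset_iff: "f \<in> homset C A B \<longleftrightarrow> f \<in> Arr C \<and> Dom C f = A \<and> Cod C f = B"
  by (auto simp: homset_def)

lemma homsetI: "f \<in> Arr C \<Longrightarrow> f \<in> homset C (Dom C f) (Cod C f)"
  by (simp add: homset_iff)

context category
begin

declare Dom_closed [simp] Cod_closed [simp]

lemma arr_comp [simp]: "f \<in> Arr C \<Longrightarrow> g \<in> Arr C \<Longrightarrow> Dom C g = Cod C f \<Longrightarrow> g \<cdot> f \<in> Arr C"
  and dom_comp [simp]: "f \<in> Arr C \<Longrightarrow> g \<in> Arr C \<Longrightarrow> Dom C g = Cod C f \<Longrightarrow> Dom C (g \<cdot> f) = Dom C f"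
  and cod_comp [simp]: "f \<in> Arr C \<Longrightarrow> g \<in> Arr C \<Longrightarrow> Dom C g = Cod C f \<Longrightarrow> Cod C (g \<cdot> f) = Cod C g"
  using Comp_closed[of f "Dom C f" "Cod C f" g "Cod C g"] by (auto simp: homset_iff)

lemma assoc [simp]:
  "f \<in> Arr C \<Longrightarrow> g \<in> Arr C \<Longrightarrow> h \<in> Arr C \<Longrightarrow> Dom C g = Cod C f \<Longrightarrow> Dom C h = Cod C g
    \<Longrightarrow> (h \<cdot> g) \<cdot> f = h \<cdot> (g \<cdot> f)"
  using Comp_assoc[of f "Dom C f" "Cod C f" g "Cod C g" h "Cod C h"] by (auto simp: homset_iff)

lemma arr_idt [simp]: "A \<in> Obj C \<Longrightarrow> idt C A \<in> Arr C"
  and dom_idt [simp]: "A \<in> Obj C \<Longrightarrow> Dom C (idt C A) = A"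
  and cod_idt [simp]: "A \<in> Obj C \<Longrightarrow> Cod C (idt C A) = A"
  using idt_closed[of A] by (auto simp: homset_iff)

lemma idt_comp [simp]: "f \<in> Arr C \<Longrightarrow> Cod C f = B \<Longrightarrow> idt C B \<cdot> f = f"
  and comp_idt [simp]: "f \<in> Arr C \<Longrightarrow> Dom C f = A \<Longrightarrow> f \<cdot> idt C A = f"
  using Comp_idt_left[of f A B] Comp_idt_left[of f "Dom C f" B] Comp_idt_right[of f A "Cod C f"]
  by (auto simp: homset_iff)

lemma inverse_arrows_unique:
  assumes "inverse_arrows C f g" "inverse_arrows C f h"
  shows "g = h"
proof -
  have "g = g \<cdot> (f \<cdot> h)" using assms by (auto simp: inverse_arrows_def homset_iff)
  also have "\<dots> = (g \<cdot> f) \<cdot> h" using assms by (subst assoc) (auto simp: inverse_arrows_def homset_iff)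
  also have "\<dots> = h" using assms by (auto simp: inverse_arrows_def homset_iff)
  finally show ?thesis .
qed

lemma inv_arrow_eqI: "inverse_arrows C f g \<Longrightarrow> inv_arrow C f = g"
  unfolding inv_arrow_def by (blast intro: the_equality inverse_arrows_unique)

lemma inverse_arrows_inv: "iso_arrow C f \<Longrightarrow> inverse_arrows C f (inv_arrow C f)"
  using inv_arrow_eqI unfolding iso_arrow_def by blast

lemma inverse_arrows_sym: "inverse_arrows C f g \<Longrightarrow> inverse_arrows C g f"
  by (auto simp: inverse_arrows_def homset_iff)

lemma iso_arrow_arr: "iso_arrow C f \<Longrightarrow> f \<in> Arr C"
  by (auto simp: iso_arrow_def inverse_arrows_def)

lemma inv_arr [simp]: "iso_arrow C f \<Longrightarrow> inv_arrow C f \<in> Arr C"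
  and dom_inv [simp]: "iso_arrow C f \<Longrightarrow> Dom C (inv_arrow C f) = Cod C f"
  and cod_inv [simp]: "iso_arrow C f \<Longrightarrow> Cod C (inv_arrow C f) = Dom C f"
  and inv_comp [simp]: "iso_arrow C f \<Longrightarrow> inv_arrow C f \<cdot> f = idt C (Dom C f)"
  and comp_inv [simp]: "iso_arrow C f \<Longrightarrow> f \<cdot> inv_arrow C f = idt C (Cod C f)"
  using inverse_arrows_inv[of f] by (auto simp: inverse_arrows_def homset_iff)

lemma inv_comp_cancel [simp]:
  assumes "iso_arrow C f" "g \<in> Arr C" "Cod C g = Dom C f"
  shows "inv_arrow C f \<cdot> (f \<cdot> g) = g"
proof -
  have "inv_arrow C f \<cdot> (f \<cdot> g) = (inv_arrow C f \<cdot> f) \<cdot> g"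
    using assms iso_arrow_arr by (subst assoc) auto
  then show ?thesis using assms by (simp del: assoc)
qed

lemma comp_inv_cancel [simp]:
  assumes "iso_arrow C f" "g \<in> Arr C" "Cod C g = Cod C f"
  shows "f \<cdot> (inv_arrow C f \<cdot> g) = g"
proof -
  have "f \<cdot> (inv_arrow C f \<cdot> g) = (f \<cdot> inv_arrow C f) \<cdot> g"
    using assms iso_arrow_arr by (subst assoc) auto
  then show ?thesis using assms by (simp del: assoc)
qed

lemma iso_inv [simp]: "iso_arrow C f \<Longrightarrow> iso_arrow C (inv_arrow C f)"
  using inverse_arrows_inv inverse_arrows_sym unfolding iso_arrow_def by blast

lemma inv_inv [simp]: "iso_arrow C f \<Longrightarrow> inv_arrow C (inv_arrow C f) = f"
  using inverse_arrows_inv inverse_arrows_sym inv_arrow_eqI by blast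

lemma inverse_arrows_comp:
  assumes "iso_arrow C f" "iso_arrow C g" "Dom C g = Cod C f"
  shows "inverse_arrows C (g \<cdot> f) (inv_arrow C f \<cdot> inv_arrow C g)"
  using assms iso_arrow_arr by (auto simp: inverse_arrows_def homset_iff)

lemma iso_comp [simp]:
  "iso_arrow C f \<Longrightarrow> iso_arrow C g \<Longrightarrow> Dom C g = Cod C f \<Longrightarrow> iso_arrow C (g \<cdot> f)"
  and inv_of_comp:
  "iso_arrow C f \<Longrightarrow> iso_arrow C g \<Longrightarrow> Dom C g = Cod C f
    \<Longrightarrow> inv_arrow C (g \<cdot> f) = inv_arrow C f \<cdot> inv_arrow C g"
  using inverse_arrows_comp inv_arrow_eqI unfolding iso_arrow_def by blast+

lemma iso_cancel_left:
  assumes "iso_arrow C f" "g \<in> Arr C" "h \<in> Arr C" "Cod C g = Dom C f" "Cod C h = Dom C f"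
    and "f \<cdot> g = f \<cdot> h"
  shows "g = h"
  using inv_comp_cancel[OF assms(1,2,4)] inv_comp_cancel[OF assms(1,3,5)] unfolding assms(6) by (rule trans[OF sym])

lemma iso_cancel_right:
  assumes iso: "iso_arrow C f" and gh: "g \<in> Arr C" "h \<in> Arr C" "Dom C g = Cod C f" "Dom C h = Cod C f"
    and eq: "g \<cdot> f = h \<cdot> f"
  shows "g = h"
proof -
  have "(g \<cdot> f) \<cdot> inv_arrow C f = g" "(h \<cdot> f) \<cdot> inv_arrow C f = h"
    using iso gh iso_arrow_arr[OF iso] by auto
  then show ?thesis unfolding eq by (rule trans[OF sym])
qed

text \<open>Inverting the vertical sides of a commutative square. Naturality and coherence of inverse
  constraints are instances.\<close>

lemma inv_square:
  assumes "iso_arrow C t" "iso_arrow C t'" "f \<in> Arr C" "g \<in> Arr C"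
    and "Dom C f = Cod C t" "Cod C f = Cod C t'" "Dom C g = Dom C t" "Cod C g = Dom C t'"
    and eq: "f \<cdot> t = t' \<cdot> g"
  shows "inv_arrow C t' \<cdot> f = g \<cdot> inv_arrow C t"
proof -
  have "inv_arrow C t' \<cdot> f = inv_arrow C t' \<cdot> (f \<cdot> t) \<cdot> inv_arrow C t"
    using assms(1-8) iso_arrow_arr[of t] iso_arrow_arr[of t'] by simp
  also have "\<dots> = g \<cdot> inv_arrow C t"
    unfolding eq using assms(1-8) iso_arrow_arr[of t] iso_arrow_arr[of t'] by simp
  finally show ?thesis .
qed

lemma iso_idt [simp]: "A \<in> Obj C \<Longrightarrow> iso_arrow C (idt C A)"
  and inv_idt [simp]: "A \<in> Obj C \<Longrightarrow> inv_arrow C (idt C A) = idt C A"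
proof -
  assume "A \<in> Obj C"
  then have "inverse_arrows C (idt C A) (idt C A)" by (simp add: inverse_arrows_def homset_iff)
  then show "iso_arrow C (idt C A)" "inv_arrow C (idt C A) = idt C A"
    using inv_arrow_eqI by (auto simp: iso_arrow_def)
qed

end

context cat_functor
begin

declare fobj_closed [simp] farr_idt [simp]

lemma farr_arr [simp]: "f \<in> Arr C \<Longrightarrow> farr F f \<in> Arr D"
  and dom_farr [simp]: "f \<in> Arr C \<Longrightarrow> Dom D (farr F f) = fobj F (Dom C f)"
  and cod_farr [simp]: "f \<in> Arr C \<Longrightarrow> Cod D (farr F f) = fobj F (Cod C f)"
  using farr_closed[OF homsetI] by (auto simp: homset_iff)

lemma farr_comp: "f \<in> Arr C \<Longrightarrow> g \<in> Arr C \<Longrightarrow> Dom C g = Cod C f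
    \<Longrightarrow> farr F (g \<cdot>\<^bsub>C\<^esub> f) = farr F g \<cdot>\<^bsub>D\<^esub> farr F f"
  using farr_Comp[of f "Dom C f" "Cod C f" g "Cod C g"] by (auto simp: homset_iff)

lemma farr_inverse_arrows:
  assumes "iso_arrow C f"
  shows "inverse_arrows D (farr F f) (farr F (inv_arrow C f))"
proof -
  have "f \<in> Arr C" using assms by (rule C.iso_arrow_arr)
  then show ?thesis
    using assms by (auto simp: inverse_arrows_def homset_iff farr_comp[symmetric])
qed

lemma farr_iso [simp]: "iso_arrow C f \<Longrightarrow> iso_arrow D (farr F f)"
  and inv_farr: "iso_arrow C f \<Longrightarrow> inv_arrow D (farr F f) = farr F (inv_arrow C f)"
  using farr_inverse_arrows D.inv_arrow_eqI unfolding iso_arrow_def by blast+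

end

lemma id_fctr_simps [simp]:
  "A \<in> Obj C \<Longrightarrow> fobj (id_fctr C) A = A" "f \<in> Arr C \<Longrightarrow> farr (id_fctr C) f = f"
  by (simp_all add: id_fctr_def)

lemma comp_fctr_simps [simp]:
  "fobj (comp_fctr G F) A = fobj G (fobj F A)" "farr (comp_fctr G F) f = farr G (farr F f)"
  by (simp_all add: comp_fctr_def)

lemma cat_functor_id: "category C \<Longrightarrow> cat_functor C C (id_fctr C)"
  by (auto intro!: cat_functor.intro cat_functor_axioms.intro
      simp: homset_iff category.dom_comp category.arr_comp category.cod_comp
        category.Dom_closed category.Cod_closed category.arr_idt category.dom_idt category.cod_idt)

lemma cat_functor_comp:
  assumes "cat_functor C D F" "cat_functor D E G"
  shows "cat_functor C E (comp_fctr G F)"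
proof -
  interpret F: cat_functor C D F by fact
  interpret G: cat_functor D E G by fact
  show ?thesis
    by unfold_locales (auto simp: homset_iff F.farr_comp G.farr_comp)
qed

lemma bifunctor_obj: "bifunctor C D E tO tA \<Longrightarrow> U \<in> Obj C \<Longrightarrow> V \<in> Obj D \<Longrightarrow> tO U V \<in> Obj E"
  and bifunctor_idt: "bifunctor C D E tO tA \<Longrightarrow> U \<in> Obj C \<Longrightarrow> V \<in> Obj D
    \<Longrightarrow> tA (idt C U) (idt D V) = idt E (tO U V)"
  and bifunctor_arr: "bifunctor C D E tO tA \<Longrightarrow> f \<in> Arr C \<Longrightarrow> g \<in> Arr D \<Longrightarrow> tA f g \<in> Arr E"
  and bifunctor_dom: "bifunctor C D E tO tA \<Longrightarrow> f \<in> Arr C \<Longrightarrow> g \<in> Arr D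
    \<Longrightarrow> Dom E (tA f g) = tO (Dom C f) (Dom D g)"
  and bifunctor_cod: "bifunctor C D E tO tA \<Longrightarrow> f \<in> Arr C \<Longrightarrow> g \<in> Arr D
    \<Longrightarrow> Cod E (tA f g) = tO (Cod C f) (Cod D g)"
  and bifunctor_comp: "bifunctor C D E tO tA \<Longrightarrow> f \<in> Arr C \<Longrightarrow> f' \<in> Arr C \<Longrightarrow> g \<in> Arr D \<Longrightarrow> g' \<in> Arr D
    \<Longrightarrow> Dom C f' = Cod C f \<Longrightarrow> Dom D g' = Cod D g
    \<Longrightarrow> tA f' g' \<cdot>\<^bsub>E\<^esub> tA f g = tA (f' \<cdot>\<^bsub>C\<^esub> f) (g' \<cdot>\<^bsub>D\<^esub> g)"
  unfolding bifunctor_def homset_iff by metis+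

lemma bifunctor_comp_assoc:
  assumes "bifunctor C D E tO tA" "category E"
    and "f \<in> Arr C" "f' \<in> Arr C" "g \<in> Arr D" "g' \<in> Arr D"
    and "Dom C f' = Cod C f" "Dom D g' = Cod D g"
    and "h \<in> Arr E" "Cod E h = tO (Dom C f) (Dom D g)"
  shows "tA f' g' \<cdot>\<^bsub>E\<^esub> (tA f g \<cdot>\<^bsub>E\<^esub> h) = tA (f' \<cdot>\<^bsub>C\<^esub> f) (g' \<cdot>\<^bsub>D\<^esub> g) \<cdot>\<^bsub>E\<^esub> h"
proof -
  interpret category E by fact
  note b = bifunctor_arr[OF assms(1)] bifunctor_dom[OF assms(1)] bifunctor_cod[OF assms(1)]
  show ?thesis
    using assms b by (subst assoc[symmetric]) (auto simp: bifunctor_comp[OF assms(1)] simp del: assoc)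
qed

lemma bifunctor_iso:
  assumes "bifunctor C D E tO tA" "category C" "category D" "category E"
    and f: "iso_arrow C f" and g: "iso_arrow D g"
  shows "iso_arrow E (tA f g)"
    and "inv_arrow E (tA f g) = tA (inv_arrow C f) (inv_arrow D g)"
proof -
  interpret C: category C by fact
  interpret D: category D by fact
  interpret E: category E by fact
  note b = bifunctor_arr[OF assms(1)] bifunctor_dom[OF assms(1)] bifunctor_cod[OF assms(1)]
    bifunctor_comp[OF assms(1)] bifunctor_idt[OF assms(1)]
  have "inverse_arrows E (tA f g) (tA (inv_arrow C f) (inv_arrow D g))"
    using f g C.iso_arrow_arr[OF f] D.iso_arrow_arr[OF g]
    by (auto simp: inverse_arrows_def homset_iff b)
  then show "iso_arrow E (tA f g)" "inv_arrow E (tA f g) = tA (inv_arrow C f) (inv_arrow D g)"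
    using E.inv_arrow_eqI by (auto simp: iso_arrow_def)
qed

section \<open>The center of a bimodule category\<close>

text \<open>Bifunctorial left and right actions with constraints of the right type: with these, both sides
  of each half-braiding equation are composable and the center is a category.\<close>

locale two_sided_action = C: monoidal_category C + N: category N
  for C :: "('o, 'm, 'k) moncat" and N :: "('n, 'p, 'k, 'o, 'm) bimodcat" (structure) +
  assumes left_bifunctor: "bifunctor C N N (blO N) (blA N)"
    and right_bifunctor: "bifunctor N C N (brO N) (brA N)"
    and bla_closed: "U \<in> Obj C \<Longrightarrow> V \<in> Obj C \<Longrightarrow> A \<in> Obj N \<Longrightarrow>
      bla N U V A \<in> homset N (blO N (tenO C U V) A) (blO N U (blO N V A))"
    and blu_closed: "A \<in> Obj N \<Longrightarrow> blu N A \<in> homset N (blO N (unt C) A) A"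
    and bra_closed: "A \<in> Obj N \<Longrightarrow> U \<in> Obj C \<Longrightarrow> V \<in> Obj C \<Longrightarrow>
      bra N A U V \<in> homset N (brO N (brO N A U) V) (brO N A (tenO C U V))"
    and bru_closed: "A \<in> Obj N \<Longrightarrow> bru N A \<in> homset N (brO N A (unt C)) A"
    and bma_closed: "U \<in> Obj C \<Longrightarrow> V \<in> Obj C \<Longrightarrow> A \<in> Obj N \<Longrightarrow>
      bma N U A V \<in> homset N (brO N (blO N U A) V) (blO N U (brO N A V))"
begin

lemmas ten_obj [simp] = bifunctor_obj[OF C.ten_bifunctor]
  and unt_obj [simp] = C.unt_closed

lemmas bl_simps [simp] = bifunctor_obj[OF left_bifunctor] bifunctor_idt[OF left_bifunctor]
    bifunctor_arr[OF left_bifunctor] bifunctor_dom[OF left_bifunctor] bifunctor_cod[OF left_bifunctor]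
  and bl_comp = bifunctor_comp[OF left_bifunctor]
    bifunctor_comp_assoc[OF left_bifunctor N.category_axioms]
  and bl_iso = bifunctor_iso[OF left_bifunctor C.category_axioms N.category_axioms N.category_axioms]

lemmas br_simps [simp] = bifunctor_obj[OF right_bifunctor] bifunctor_idt[OF right_bifunctor]
    bifunctor_arr[OF right_bifunctor] bifunctor_dom[OF right_bifunctor] bifunctor_cod[OF right_bifunctor]
  and br_comp = bifunctor_comp[OF right_bifunctor]
    bifunctor_comp_assoc[OF right_bifunctor N.category_axioms]

lemmas constraint_simps [simp] =
  bla_closed[unfolded homset_iff, THEN conjunct1]
  bla_closed[unfolded homset_iff, THEN conjunct2, THEN conjunct1]
  bla_closed[unfolded homset_iff, THEN conjunct2, THEN conjunct2]
  blu_closed[unfolded homset_iff, THEN conjunct1]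
  blu_closed[unfolded homset_iff, THEN conjunct2, THEN conjunct1]
  blu_closed[unfolded homset_iff, THEN conjunct2, THEN conjunct2]
  bra_closed[unfolded homset_iff, THEN conjunct1]
  bra_closed[unfolded homset_iff, THEN conjunct2, THEN conjunct1]
  bra_closed[unfolded homset_iff, THEN conjunct2, THEN conjunct2]
  bru_closed[unfolded homset_iff, THEN conjunct1]
  bru_closed[unfolded homset_iff, THEN conjunct2, THEN conjunct1]
  bru_closed[unfolded homset_iff, THEN conjunct2, THEN conjunct2]
  bma_closed[unfolded homset_iff, THEN conjunct1]
  bma_closed[unfolded homset_iff, THEN conjunct2, THEN conjunct1]
  bma_closed[unfolded homset_iff, THEN conjunct2, THEN conjunct2]

end

lemma center_simps:
  "(A, \<sigma>) \<in> Obj (center C N) \<longleftrightarrow> A \<in> Obj N \<and> half_braiding C N A \<sigma>"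
  "(S, T, f) \<in> Arr (center C N) \<longleftrightarrow>
     S \<in> Obj (center C N) \<and> T \<in> Obj (center C N) \<and> f \<in> homset N (fst S) (fst T) \<and>
     (\<forall>U \<in> Obj C. blA N (idt C U) f \<cdot>\<^bsub>N\<^esub> snd S U = snd T U \<cdot>\<^bsub>N\<^esub> brA N f (idt C U))"
  "Dom (center C N) (S, T, f) = S"
  "Cod (center C N) (S, T, f) = T"
  "idt (center C N) S = (S, S, idt N (fst S))"
  "(T', T'', g) \<cdot>\<^bsub>center C N\<^esub> (S, T, f) = (S, T'', g \<cdot>\<^bsub>N\<^esub> f)"
  by (auto simp: center_def Let_def split: prod.splits)

lemma half_braidingD:
  assumes "half_braiding C N A \<sigma>"
  shows "U \<in> Obj C \<Longrightarrow> \<sigma> U \<in> Arr N" "U \<in> Obj C \<Longrightarrow> Dom N (\<sigma> U) = brO N A U"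
    "U \<in> Obj C \<Longrightarrow> Cod N (\<sigma> U) = blO N U A" "U \<in> Obj C \<Longrightarrow> iso_arrow N (\<sigma> U)"
  using assms by (auto simp: half_braiding_def homset_iff)

context two_sided_action
begin

lemma center_category: "category (center C N)"
proof
  fix f assume "f \<in> Arr (center C N)"
  then show "Dom (center C N) f \<in> Obj (center C N)" "Cod (center C N) f \<in> Obj (center C N)"
    by (cases f; auto simp: center_simps)+
next
  fix S assume S: "S \<in> Obj (center C N)"
  obtain A \<sigma> where [simp]: "S = (A, \<sigma>)" by fastforce
  show "idt (center C N) S \<in> homset (center C N) S S"
    using S half_braidingD[of C N A \<sigma>] by (auto simp: center_simps homset_iff)
next
  fix f g S T R
  assume "f \<in> homset (center C N) S T" "g \<in> homset (center C N) T R"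
  then obtain f' g' where fg [simp]: "f = (S, T, f')" "g = (T, R, g')"
    and arr: "(S, T, f') \<in> Arr (center C N)" "(T, R, g') \<in> Arr (center C N)"
    by (cases f; cases g) (auto simp: center_simps homset_iff)
  obtain A \<sigma> B \<tau> E \<nu> where [simp]: "S = (A, \<sigma>)" "T = (B, \<tau>)" "R = (E, \<nu>)" by (metis surj_pair)
  have [simp]: "f' \<in> Arr N" "Dom N f' = A" "Cod N f' = B" "g' \<in> Arr N" "Dom N g' = B" "Cod N g' = E"
    and f': "\<And>U. U \<in> Obj C \<Longrightarrow> blA N (idt C U) f' \<cdot> \<sigma> U = \<tau> U \<cdot> brA N f' (idt C U)"
    and g': "\<And>U. U \<in> Obj C \<Longrightarrow> blA N (idt C U) g' \<cdot> \<tau> U = \<nu> U \<cdot> brA N g' (idt C U)"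
    and obj [simp]: "A \<in> Obj N" "B \<in> Obj N" "E \<in> Obj N"
    and hb: "half_braiding C N A \<sigma>" "half_braiding C N B \<tau>" "half_braiding C N E \<nu>"
    using arr by (auto simp: center_simps homset_iff)
  note [simp] = half_braidingD[OF hb(1)] half_braidingD[OF hb(2)] half_braidingD[OF hb(3)]
  have "blA N (idt C U) (g' \<cdot> f') \<cdot> \<sigma> U = \<nu> U \<cdot> brA N (g' \<cdot> f') (idt C U)" if [simp]: "U \<in> Obj C" for U
  proof -
    have "blA N (idt C U) (g' \<cdot> f') \<cdot> \<sigma> U = blA N (idt C U) g' \<cdot> blA N (idt C U) f' \<cdot> \<sigma> U"
      by (simp add: bl_comp)
    also have "\<dots> = (blA N (idt C U) g' \<cdot> \<tau> U) \<cdot> brA N f' (idt C U)"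
      by (simp add: f')
    also have "\<dots> = \<nu> U \<cdot> brA N (g' \<cdot> f') (idt C U)"
      unfolding g'[OF that] by (simp add: br_comp)
    finally show ?thesis .
  qed
  then show "g \<cdot>\<^bsub>center C N\<^esub> f \<in> homset (center C N) S R"
    using arr by (simp add: center_simps homset_iff)
qed (auto simp: center_simps homset_iff)

end

locale bimodule_functor_between = N: two_sided_action C N + N': two_sided_action C N'
    + bimodule_functor K C N N' F
  for K :: "'k ring" and C :: "('o, 'm, 'k) moncat"
    and N :: "('n, 'p, 'k, 'o, 'm) bimodcat" and N' :: "('n2, 'p2, 'k, 'o, 'm) bimodcat" (structure)
    and F :: "('n, 'p, 'n2, 'p2, 'o) bimod_fctr"
begin

lemmas bf_simps [simp] =
  bfl_closed[unfolded homset_iff, THEN conjunct1, THEN conjunct1]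
  bfl_closed[unfolded homset_iff, THEN conjunct1, THEN conjunct2, THEN conjunct1]
  bfl_closed[unfolded homset_iff, THEN conjunct1, THEN conjunct2, THEN conjunct2]
  bfl_closed[THEN conjunct2]
  bfr_closed[unfolded homset_iff, THEN conjunct1, THEN conjunct1]
  bfr_closed[unfolded homset_iff, THEN conjunct1, THEN conjunct2, THEN conjunct1]
  bfr_closed[unfolded homset_iff, THEN conjunct1, THEN conjunct2, THEN conjunct2]
  bfr_closed[THEN conjunct2]

text \<open>Each axiom for the conjugated family follows in the same way: the axioms of \<open>F\<close> absorb the inverse
  of \<open>bfl\<close> and move the other structure isomorphisms to the outside, and what is left inside is the
  image under \<open>F\<close> of the same axiom for \<open>\<sigma>\<close>.\<close>

lemma half_braiding_image:
  assumes A [simp]: "A \<in> Obj N" and hb: "half_braiding C N A \<sigma>"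
  shows "half_braiding C N' (fobj F A)
    (\<lambda>U \<in> Obj C. inv_arrow N' (bfl F U A) \<cdot> farr F (\<sigma> U) \<cdot> bfr F A U)"
proof -
  let ?\<sigma> = "\<lambda>U. inv_arrow N' (bfl F U A) \<cdot> farr F (\<sigma> U) \<cdot> bfr F A U"
  note [simp] = half_braidingD[OF hb]
  have nat: "blA N f (idt N A) \<cdot>\<^bsub>N\<^esub> \<sigma> (Dom C f) = \<sigma> (Cod C f) \<cdot>\<^bsub>N\<^esub> brA N (idt N A) f"
    if "f \<in> Arr C" for f
    using hb that by (auto simp: half_braiding_def)
  have unit: "blu N A \<cdot>\<^bsub>N\<^esub> \<sigma> (unt C) = bru N A"
    using hb by (auto simp: half_braiding_def)
  have hex: "bla N U V A \<cdot>\<^bsub>N\<^esub> \<sigma> (tenO C U V) \<cdot>\<^bsub>N\<^esub> bra N A U V =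
        blA N (idt C U) (\<sigma> V) \<cdot>\<^bsub>N\<^esub> bma N U A V \<cdot>\<^bsub>N\<^esub> brA N (\<sigma> U) (idt C V)"
    if "U \<in> Obj C" "V \<in> Obj C" for U V
    using hb that by (auto simp: half_braiding_def)
  have naturality: "blA N' f (idt N' (fobj F A)) \<cdot> ?\<sigma> U = ?\<sigma> V \<cdot> brA N' (idt N' (fobj F A)) f"
    if f [simp]: "f \<in> Arr C" and U [simp]: "U = Dom C f" and V [simp]: "V = Cod C f" for f U V
  proof (rule N'.N.iso_cancel_left[of "bfl F V A"])
    have bl_nat: "bfl F V A \<cdot> blA N' f (idt N' (fobj F A)) = farr F (blA N f (idt N A)) \<cdot> bfl F U A"
      using bfl_natural[OF homsetI[OF f] homsetI, of "idt N A"] by simp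
    have "bfl F V A \<cdot> (blA N' f (idt N' (fobj F A)) \<cdot> ?\<sigma> U) =
      (bfl F V A \<cdot> blA N' f (idt N' (fobj F A))) \<cdot> ?\<sigma> U" by simp
    also have "\<dots> = farr F (blA N f (idt N A)) \<cdot> farr F (\<sigma> U) \<cdot> bfr F A U"
      unfolding bl_nat by simp
    also have "\<dots> = farr F (blA N f (idt N A) \<cdot>\<^bsub>N\<^esub> \<sigma> U) \<cdot> bfr F A U"
      by (simp add: farr_comp)
    also have "\<dots> = farr F (\<sigma> V) \<cdot> farr F (brA N (idt N A) f) \<cdot> bfr F A U"
      by (simp add: nat farr_comp)
    also have "\<dots> = farr F (\<sigma> V) \<cdot> bfr F A V \<cdot> brA N' (idt N' (fobj F A)) f"
      using bfr_natural[OF homsetI[OF f] homsetI, of "idt N A"] by simp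
    finally show "bfl F V A \<cdot> (blA N' f (idt N' (fobj F A)) \<cdot> ?\<sigma> U) =
      bfl F V A \<cdot> (?\<sigma> V \<cdot> brA N' (idt N' (fobj F A)) f)" by simp
  qed simp_all
  have unit_law: "blu N' (fobj F A) \<cdot> ?\<sigma> (unt C) = bru N' (fobj F A)"
  proof -
    have "blu N' (fobj F A) \<cdot> ?\<sigma> (unt C) = farr F (blu N A \<cdot>\<^bsub>N\<^esub> \<sigma> (unt C)) \<cdot> bfr F A (unt C)"
      by (simp add: bfl_unit[symmetric] farr_comp)
    then show ?thesis by (simp add: unit bfr_unit)
  qed
  have hexagon: "bla N' U V (fobj F A) \<cdot> ?\<sigma> (tenO C U V) \<cdot> bra N' (fobj F A) U V =
        blA N' (idt C U) (?\<sigma> V) \<cdot> bma N' U (fobj F A) V \<cdot> brA N' (?\<sigma> U) (idt C V)" (is "?l = ?r")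
    if U [simp]: "U \<in> Obj C" and V [simp]: "V \<in> Obj C" for U V
  proof (rule N'.N.iso_cancel_left[of "bfl F U (blO N V A) \<cdot> blA N' (idt C U) (bfl F V A)"])
    \<comment> \<open>Composing with this isomorphism from \<open>bfl_assoc\<close> removes the inverses both of \<open>bfl F (U \<otimes> V) A\<close> and of
      \<open>bfl F V A\<close>. Then \<open>bfl_assoc\<close> and \<open>bfr_assoc\<close> expose \<open>F\<close> of the hexagon for \<open>\<sigma>\<close>, and \<open>bf_middle\<close>
      brings the two halves of its right side back together.\<close>
    let ?rest = "bfr F (brO N A U) V \<cdot> brA N' (bfr F A U) (idt C V)"
    let ?m = "bma N' U (fobj F A) V \<cdot> brA N' (?\<sigma> U) (idt C V)"
    have "(bfl F U (blO N V A) \<cdot> blA N' (idt C U) (bfl F V A)) \<cdot> ?l =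
        (bfl F U (blO N V A) \<cdot> blA N' (idt C U) (bfl F V A) \<cdot> bla N' U V (fobj F A))
          \<cdot> ?\<sigma> (tenO C U V) \<cdot> bra N' (fobj F A) U V"
      by simp
    also have "\<dots> = farr F (bla N U V A) \<cdot> farr F (\<sigma> (tenO C U V))
          \<cdot> (bfr F A (tenO C U V) \<cdot> bra N' (fobj F A) U V)"
      by (simp add: bfl_assoc[symmetric])
    also have "\<dots> = farr F (bla N U V A \<cdot>\<^bsub>N\<^esub> \<sigma> (tenO C U V) \<cdot>\<^bsub>N\<^esub> bra N A U V) \<cdot> ?rest"
      by (simp add: bfr_assoc[symmetric] farr_comp)
    also have "\<dots> = farr F (blA N (idt C U) (\<sigma> V)) \<cdot> farr F (bma N U A V)
          \<cdot> (farr F (brA N (\<sigma> U) (idt C V)) \<cdot> bfr F (brO N A U) V) \<cdot> brA N' (bfr F A U) (idt C V)"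
      by (simp add: hex farr_comp)
    also have "\<dots> = farr F (blA N (idt C U) (\<sigma> V)) \<cdot> farr F (bma N U A V)
          \<cdot> bfr F (blO N U A) V \<cdot> brA N' (farr F (\<sigma> U) \<cdot> bfr F A U) (idt C V)"
      using bfr_natural[OF homsetI homsetI, of "idt C V" "\<sigma> U", symmetric] by (simp add: N'.br_comp)
    also have "\<dots> = farr F (blA N (idt C U) (\<sigma> V))
          \<cdot> (farr F (bma N U A V) \<cdot> bfr F (blO N U A) V \<cdot> brA N' (bfl F U A) (idt C V))
          \<cdot> brA N' (?\<sigma> U) (idt C V)"
      by (simp add: N'.br_comp)
    also have "\<dots> = (farr F (blA N (idt C U) (\<sigma> V)) \<cdot> bfl F U (brO N A V))
          \<cdot> blA N' (idt C U) (bfr F A V) \<cdot> ?m"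
      by (simp add: bf_middle)
    also have "\<dots> = bfl F U (blO N V A) \<cdot> blA N' (idt C U) (farr F (\<sigma> V) \<cdot> bfr F A V) \<cdot> ?m"
      using bfl_natural[OF homsetI homsetI, of "idt C U" "\<sigma> V", symmetric] by (simp add: N'.bl_comp)
    also have "\<dots> = (bfl F U (blO N V A) \<cdot> blA N' (idt C U) (bfl F V A)) \<cdot> ?r"
      by (simp add: N'.bl_comp)
    finally show "(bfl F U (blO N V A) \<cdot> blA N' (idt C U) (bfl F V A)) \<cdot> ?l =
      (bfl F U (blO N V A) \<cdot> blA N' (idt C U) (bfl F V A)) \<cdot> ?r" .
  qed (simp_all add: N'.bl_iso)
  show ?thesis
    unfolding half_braiding_def using naturality unit_law hexagon
    by (auto simp: homset_iff intro!: N'.N.iso_comp)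
qed

end

lemma center_fobj_simps [simp]:
  "fst (center_fobj C N' F S) = fobj F (fst S)"
  "U \<in> Obj C \<Longrightarrow> snd (center_fobj C N' F S) U =
     inv_arrow N' (bfl F U (fst S)) \<cdot>\<^bsub>N'\<^esub> farr F (snd S U) \<cdot>\<^bsub>N'\<^esub> bfr F (fst S) U"
  by (simp_all add: center_fobj_def split: prod.splits)

lemma center_fctr_simps [simp]:
  "fobj (center_fctr C N' F) S = center_fobj C N' F S"
  "farr (center_fctr C N' F) (S, T, f) = (center_fobj C N' F S, center_fobj C N' F T, farr F f)"
  by (simp_all add: center_fctr_def)

lemma center_objD:
  assumes "S \<in> Obj (center C N)"
  shows "fst S \<in> Obj N" "half_braiding C N (fst S) (snd S)"
  using assms by (cases S; simp add: center_simps)+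

lemma center_homset:
  "f \<in> homset (center C N) S T \<longleftrightarrow> (\<exists>f'. f = (S, T, f') \<and> (S, T, f') \<in> Arr (center C N))"
  by (cases f) (auto simp: homset_iff center_simps)

context bimodule_functor_between
begin

lemma center_fobj_closed:
  "S \<in> Obj (center C N) \<Longrightarrow> center_fobj C N' F S \<in> Obj (center C N')"
  by (cases S) (auto simp: center_simps center_fobj_def half_braiding_image)

lemma center_farr_closed:
  assumes f: "(S, T, f) \<in> Arr (center C N)"
  shows "(center_fobj C N' F S, center_fobj C N' F T, farr F f) \<in> Arr (center C N')"
proof -
  let ?A = "fst S" and ?B = "fst T"
  have S: "S \<in> Obj (center C N)" and T: "T \<in> Obj (center C N)"
    and [simp]: "f \<in> Arr N" "Dom N f = ?A" "Cod N f = ?B"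
    and comm: "\<And>U. U \<in> Obj C \<Longrightarrow> blA N (idt C U) f \<cdot>\<^bsub>N\<^esub> snd S U = snd T U \<cdot>\<^bsub>N\<^esub> brA N f (idt C U)"
    using f by (auto simp: center_simps homset_iff)
  note [simp] = center_objD(1)[OF S] center_objD(1)[OF T]
    half_braidingD[OF center_objD(2)[OF S]] half_braidingD[OF center_objD(2)[OF T]]
  have "blA N' (idt C U) (farr F f) \<cdot> inv_arrow N' (bfl F U ?A) \<cdot> farr F (snd S U) \<cdot> bfr F ?A U =
      (inv_arrow N' (bfl F U ?B) \<cdot> farr F (snd T U) \<cdot> bfr F ?B U) \<cdot> brA N' (farr F f) (idt C U)"
    (is "?l = ?r") if U [simp]: "U \<in> Obj C" for U
  proof (rule N'.N.iso_cancel_left[of "bfl F U ?B"])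
    have "bfl F U ?B \<cdot> ?l = (bfl F U ?B \<cdot> blA N' (idt C U) (farr F f))
        \<cdot> inv_arrow N' (bfl F U ?A) \<cdot> farr F (snd S U) \<cdot> bfr F ?A U" by simp
    also have "\<dots> = farr F (blA N (idt C U) f \<cdot>\<^bsub>N\<^esub> snd S U) \<cdot> bfr F ?A U"
      using bfl_natural[OF homsetI homsetI, of "idt C U" f] by (simp add: farr_comp)
    also have "\<dots> = farr F (snd T U) \<cdot> farr F (brA N f (idt C U)) \<cdot> bfr F ?A U"
      by (simp add: comm farr_comp)
    also have "\<dots> = bfl F U ?B \<cdot> ?r"
      using bfr_natural[OF homsetI homsetI, of "idt C U" f] by simp
    finally show "bfl F U ?B \<cdot> ?l = bfl F U ?B \<cdot> ?r" .
  qed simp_all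
  then show ?thesis
    using S T by (simp add: center_simps homset_iff center_fobj_closed)
qed

lemma center_functor: "cat_functor (center C N) (center C N') (center_fctr C N' F)"
proof -
  interpret Z: category "center C N" by (rule N.center_category)
  interpret Z': category "center C N'" by (rule N'.center_category)
  show ?thesis
  proof
    fix f g S T R
    assume "f \<in> homset (center C N) S T" "g \<in> homset (center C N) T R"
    then obtain f' g' where "f = (S, T, f')" "(S, T, f') \<in> Arr (center C N)"
      "g = (T, R, g')" "(T, R, g') \<in> Arr (center C N)"
      unfolding center_homset by blast
    then show "farr (center_fctr C N' F) (g \<cdot>\<^bsub>center C N\<^esub> f) =
        farr (center_fctr C N' F) g \<cdot>\<^bsub>center C N'\<^esub> farr (center_fctr C N' F) f"
      by (auto simp: center_simps homset_iff intro!: farr_comp)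
  qed (auto simp: center_homset center_fobj_closed center_farr_closed center_simps(5)
      dest: center_objD)
qed

end

text \<open>The part of a bimodule functor that enters the formula for its action on half-braidings. Singling
  it out lets \<open>center_transformation\<close> apply to identity and composite functors.\<close>

definition structure_isos ::
  "('o, 'm, 'k) moncat \<Rightarrow> ('n, 'p, 'k, 'o, 'm) bimodcat \<Rightarrow> ('n2, 'p2, 'k, 'o, 'm) bimodcat
    \<Rightarrow> ('n, 'p, 'n2, 'p2, 'o) bimod_fctr \<Rightarrow> bool" where
  "structure_isos C N N' F \<longleftrightarrow> (\<forall>U \<in> Obj C. \<forall>A \<in> Obj N.
     bfl F U A \<in> homset N' (blO N' U (fobj F A)) (fobj F (blO N U A)) \<and> iso_arrow N' (bfl F U A) \<and>
     bfr F A U \<in> homset N' (brO N' (fobj F A) U) (fobj F (brO N A U)) \<and> iso_arrow N' (bfr F A U))"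

lemma structure_isosD:
  assumes "structure_isos C N N' F" "U \<in> Obj C" "A \<in> Obj N"
  shows "bfl F U A \<in> Arr N'" "Dom N' (bfl F U A) = blO N' U (fobj F A)"
    "Cod N' (bfl F U A) = fobj F (blO N U A)" "iso_arrow N' (bfl F U A)"
    "bfr F A U \<in> Arr N'" "Dom N' (bfr F A U) = brO N' (fobj F A) U"
    "Cod N' (bfr F A U) = fobj F (brO N A U)" "iso_arrow N' (bfr F A U)"
  using assms by (auto simp: structure_isos_def homset_iff)

lemma id_bimod_fctr_simps [simp]:
  "fobj (id_bimod_fctr N) = fobj (id_fctr N)" "farr (id_bimod_fctr N) = farr (id_fctr N)"
  "bfl (id_bimod_fctr N) U A = idt N (blO N U A)" "bfr (id_bimod_fctr N) A U = idt N (brO N A U)"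
  by (simp_all add: id_bimod_fctr_def fctr.defs bimod_fctr.defs)

lemma comp_bimod_fctr_simps [simp]:
  "fobj (comp_bimod_fctr N3 G F) A = fobj G (fobj F A)"
  "farr (comp_bimod_fctr N3 G F) f = farr G (farr F f)"
  "bfl (comp_bimod_fctr N3 G F) U A = farr G (bfl F U A) \<cdot>\<^bsub>N3\<^esub> bfl G U (fobj F A)"
  "bfr (comp_bimod_fctr N3 G F) A U = farr G (bfr F A U) \<cdot>\<^bsub>N3\<^esub> bfr G (fobj F A) U"
  by (simp_all add: comp_bimod_fctr_def fctr.defs bimod_fctr.defs)

lemma (in bimodule_functor_between) structure_isos: "structure_isos C N N' F"
  by (auto simp: structure_isos_def homset_iff)

lemma (in two_sided_action) structure_isos_id: "structure_isos C N N (id_bimod_fctr N)"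
  by (auto simp: structure_isos_def homset_iff)

lemma (in two_sided_action) center_fobj_id:
  assumes "S \<in> Obj (center C N)"
  shows "center_fobj C N (id_bimod_fctr N) S = S"
proof (rule prod_eqI)
  note S = center_objD[OF assms]
  note [simp] = S(1) half_braidingD[OF S(2)]
  show "snd (center_fobj C N (id_bimod_fctr N) S) = snd S"
  proof (rule extensionalityI[of _ "Obj C"])
    show "snd (center_fobj C N (id_bimod_fctr N) S) \<in> extensional (Obj C)"
      by (simp add: center_fobj_def split: prod.splits)
    show "snd S \<in> extensional (Obj C)" using S(2) by (simp add: half_braiding_def)
  qed simp
qed (use center_objD[OF assms] in simp)

lemma structure_isos_comp:
  assumes "bimodule_functor_between K C N1 N2 F" "bimodule_functor_between K C N2 N3 G"
  shows "structure_isos C N1 N3 (comp_bimod_fctr N3 G F)"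
proof -
  interpret F: bimodule_functor_between K C N1 N2 F by fact
  interpret G: bimodule_functor_between K C N2 N3 G by fact
  show ?thesis by (auto simp: structure_isos_def homset_iff)
qed

text \<open>The structure isomorphisms of a composite are \<open>G(bfl F) \<circ> bfl G\<close> and \<open>G(bfr F) \<circ> bfr G\<close>, so
  conjugating with them is conjugating twice.\<close>

lemma center_fobj_comp:
  assumes "bimodule_functor_between K C N1 N2 F" "bimodule_functor_between K C N2 N3 G"
    and S: "S \<in> Obj (center C N1)"
  shows "center_fobj C N3 (comp_bimod_fctr N3 G F) S = center_fobj C N3 G (center_fobj C N2 F S)"
proof (rule prod_eqI)
  interpret F: bimodule_functor_between K C N1 N2 F by fact
  interpret G: bimodule_functor_between K C N2 N3 G by fact
  note [simp] = center_objD(1)[OF S] half_braidingD[OF center_objD(2)[OF S]]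
  show "snd (center_fobj C N3 (comp_bimod_fctr N3 G F) S) = snd (center_fobj C N3 G (center_fobj C N2 F S))"
  proof (rule extensionalityI[of _ "Obj C"])
    show "snd (center_fobj C N3 (comp_bimod_fctr N3 G F) S) \<in> extensional (Obj C)"
      "snd (center_fobj C N3 G (center_fobj C N2 F S)) \<in> extensional (Obj C)"
      by (simp_all add: center_fobj_def split: prod.splits)
    show "snd (center_fobj C N3 (comp_bimod_fctr N3 G F) S) U = snd (center_fobj C N3 G (center_fobj C N2 F S)) U"
      if "U \<in> Obj C" for U
      using that by (simp add: G.farr_comp G.inv_farr G.N'.N.inv_of_comp)
  qed
qed simp

text \<open>The square for \<open>\<alpha>\<close> and the new half-braidings is pasted from three: compatibility of \<open>\<alpha>\<close> with
  the left action, naturality of \<open>\<alpha>\<close> at \<open>\<sigma>\<^sub>U\<close>, and compatibility with the right action.\<close>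

lemma center_transformation:
  assumes "two_sided_action C N" "two_sided_action C N'"
    and "bimodule_transformation C N N' F G \<alpha>"
    and F: "structure_isos C N N' F" and G: "structure_isos C N N' G"
    and S: "S \<in> Obj (center C N)"
    and FS: "center_fobj C N' F S \<in> Obj (center C N')" and GS: "center_fobj C N' G S \<in> Obj (center C N')"
  shows "(center_fobj C N' F S, center_fobj C N' G S, \<alpha> (fst S)) \<in> Arr (center C N')"
proof -
  interpret N: two_sided_action C N by fact
  interpret N': two_sided_action C N' by fact
  interpret bimodule_transformation C N N' F G \<alpha> by fact
  let ?A = "fst S"
  note [simp] = center_objD(1)[OF S] half_braidingD[OF center_objD(2)[OF S]]
    structure_isosD[OF F] structure_isosD[OF G]
  have [simp]: "\<alpha> A \<in> Arr N'" "Dom N' (\<alpha> A) = fobj F A" "Cod N' (\<alpha> A) = fobj G A" if "A \<in> Obj N" for A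
    using component_closed[OF that] by (auto simp: homset_iff)
  have "blA N' (idt C U) (\<alpha> ?A) \<cdot>\<^bsub>N'\<^esub> inv_arrow N' (bfl F U ?A) \<cdot>\<^bsub>N'\<^esub> farr F (snd S U) \<cdot>\<^bsub>N'\<^esub> bfr F ?A U =
      (inv_arrow N' (bfl G U ?A) \<cdot>\<^bsub>N'\<^esub> farr G (snd S U) \<cdot>\<^bsub>N'\<^esub> bfr G ?A U) \<cdot>\<^bsub>N'\<^esub> brA N' (\<alpha> ?A) (idt C U)"
    (is "?l = ?r") if U [simp]: "U \<in> Obj C" for U
  proof (rule N'.N.iso_cancel_left[of "bfl G U ?A"])
    have "bfl G U ?A \<cdot>\<^bsub>N'\<^esub> ?l = (bfl G U ?A \<cdot>\<^bsub>N'\<^esub> blA N' (idt C U) (\<alpha> ?A))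
        \<cdot>\<^bsub>N'\<^esub> inv_arrow N' (bfl F U ?A) \<cdot>\<^bsub>N'\<^esub> farr F (snd S U) \<cdot>\<^bsub>N'\<^esub> bfr F ?A U" by simp
    also have "\<dots> = (\<alpha> (blO N U ?A) \<cdot>\<^bsub>N'\<^esub> farr F (snd S U)) \<cdot>\<^bsub>N'\<^esub> bfr F ?A U"
      unfolding transf_left[OF U center_objD(1)[OF S], symmetric] by simp
    also have "\<dots> = farr G (snd S U) \<cdot>\<^bsub>N'\<^esub> \<alpha> (brO N ?A U) \<cdot>\<^bsub>N'\<^esub> bfr F ?A U"
      using naturality[OF homsetI, of "snd S U", symmetric] by simp
    also have "\<dots> = bfl G U ?A \<cdot>\<^bsub>N'\<^esub> ?r"
      by (simp add: transf_right)
    finally show "bfl G U ?A \<cdot>\<^bsub>N'\<^esub> ?l = bfl G U ?A \<cdot>\<^bsub>N'\<^esub> ?r" .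
  qed simp_all
  then show ?thesis
    using FS GS by (simp add: center_simps homset_iff)
qed

text \<open>The given unit and counit are arrows of the centers because the composites \<open>Z(G) \<circ> Z(F)\<close> and
  \<open>Z(F) \<circ> Z(G)\<close> agree with the functors that the composite bimodule functors induce. Composition in a
  center is composition of underlying arrows, so every equation is already known.\<close>

theorem center_adjunction:
  assumes F: "bimodule_functor_between K C N N' F" and G: "bimodule_functor_between K C N' N G"
    and adj: "adjunction N N' F G \<eta> \<epsilon>"
    and \<eta>: "bimodule_transformation C N N (id_bimod_fctr N) (comp_bimod_fctr N G F) \<eta>"
    and \<epsilon>: "bimodule_transformation C N' N' (comp_bimod_fctr N' F G) (id_bimod_fctr N') \<epsilon>"
  shows "adjoint_pair (center C N) (center C N') (center_fctr C N' F) (center_fctr C N G)"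
proof -
  interpret F: bimodule_functor_between K C N N' F by fact
  interpret G: bimodule_functor_between K C N' N G by fact
  interpret ZF: cat_functor "center C N" "center C N'" "center_fctr C N' F" by (rule F.center_functor)
  interpret ZG: cat_functor "center C N'" "center C N" "center_fctr C N G" by (rule G.center_functor)
  let ?GF = "\<lambda>S. center_fobj C N G (center_fobj C N' F S)"
  let ?FG = "\<lambda>T. center_fobj C N' F (center_fobj C N G T)"
  let ?\<eta> = "\<lambda>S. (S, ?GF S, \<eta> (fst S))"
  let ?\<epsilon> = "\<lambda>T. (?FG T, T, \<epsilon> (fst T))"
  have triangles: "\<And>A. A \<in> Obj N \<Longrightarrow> \<epsilon> (fobj F A) \<cdot>\<^bsub>N'\<^esub> farr F (\<eta> A) = idt N' (fobj F A)"
    "\<And>B. B \<in> Obj N' \<Longrightarrow> farr G (\<epsilon> B) \<cdot>\<^bsub>N\<^esub> \<eta> (fobj G B) = idt N (fobj G B)"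
    and nat\<eta>: "nat_trans N N (id_fctr N) (comp_fctr G F) \<eta>"
    and nat\<epsilon>: "nat_trans N' N' (comp_fctr F G) (id_fctr N') \<epsilon>"
    using adj by (auto simp: adjunction_def)
  have \<eta>_closed: "?\<eta> S \<in> Arr (center C N)" if S: "S \<in> Obj (center C N)" for S
  proof -
    have "(center_fobj C N (id_bimod_fctr N) S, center_fobj C N (comp_bimod_fctr N G F) S, \<eta> (fst S))
        \<in> Arr (center C N)"
      using S F.N.two_sided_action_axioms \<eta> F.N.structure_isos_id structure_isos_comp[OF F G]
      by (intro center_transformation)
        (simp_all add: F.N.center_fobj_id center_fobj_comp[OF F G] F.center_fobj_closed G.center_fobj_closed)
    then show ?thesis using S by (simp add: F.N.center_fobj_id center_fobj_comp[OF F G])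
  qed
  have \<epsilon>_closed: "?\<epsilon> T \<in> Arr (center C N')" if T: "T \<in> Obj (center C N')" for T
  proof -
    have "(center_fobj C N' (comp_bimod_fctr N' F G) T, center_fobj C N' (id_bimod_fctr N') T, \<epsilon> (fst T))
        \<in> Arr (center C N')"
      using T F.N'.two_sided_action_axioms \<epsilon> F.N'.structure_isos_id structure_isos_comp[OF G F]
      by (intro center_transformation)
        (simp_all add: F.N'.center_fobj_id center_fobj_comp[OF G F] F.center_fobj_closed G.center_fobj_closed)
    then show ?thesis using T by (simp add: F.N'.center_fobj_id center_fobj_comp[OF G F])
  qed
  have "nat_trans (center C N) (center C N) (id_fctr (center C N))
      (comp_fctr (center_fctr C N G) (center_fctr C N' F)) ?\<eta>"
  proof (intro nat_trans.intro nat_trans_axioms.intro)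
    show "cat_functor (center C N) (center C N) (id_fctr (center C N))"
      by (rule cat_functor_id[OF F.N.center_category])
    show "cat_functor (center C N) (center C N) (comp_fctr (center_fctr C N G) (center_fctr C N' F))"
      by (rule cat_functor_comp[OF ZF.cat_functor_axioms ZG.cat_functor_axioms])
  next
    fix S assume "S \<in> Obj (center C N)"
    then show "?\<eta> S \<in> homset (center C N) (fobj (id_fctr (center C N)) S)
        (fobj (comp_fctr (center_fctr C N G) (center_fctr C N' F)) S)"
      by (simp add: center_homset \<eta>_closed)
  next
    fix f S T assume "f \<in> homset (center C N) S T"
    then obtain f' where [simp]: "f = (S, T, f')" and f: "(S, T, f') \<in> Arr (center C N)"
      by (auto simp: center_homset)
    then have "f' \<in> homset N (fst S) (fst T)" by (simp add: center_simps)
    from nat_trans.naturality[OF nat\<eta> this] f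
    show "farr (comp_fctr (center_fctr C N G) (center_fctr C N' F)) f \<cdot>\<^bsub>center C N\<^esub> ?\<eta> S =
        ?\<eta> T \<cdot>\<^bsub>center C N\<^esub> farr (id_fctr (center C N)) f"
      by (auto simp: center_simps(3-6)) (simp add: center_simps homset_iff)
  qed
  moreover have "nat_trans (center C N') (center C N') (comp_fctr (center_fctr C N' F) (center_fctr C N G))
      (id_fctr (center C N')) ?\<epsilon>"
  proof (intro nat_trans.intro nat_trans_axioms.intro)
    show "cat_functor (center C N') (center C N') (id_fctr (center C N'))"
      by (rule cat_functor_id[OF F.N'.center_category])
    show "cat_functor (center C N') (center C N') (comp_fctr (center_fctr C N' F) (center_fctr C N G))"
      by (rule cat_functor_comp[OF ZG.cat_functor_axioms ZF.cat_functor_axioms])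
  next
    fix S assume "S \<in> Obj (center C N')"
    then show "?\<epsilon> S \<in> homset (center C N') (fobj (comp_fctr (center_fctr C N' F) (center_fctr C N G)) S)
        (fobj (id_fctr (center C N')) S)"
      by (simp add: center_homset \<epsilon>_closed)
  next
    fix f S T assume "f \<in> homset (center C N') S T"
    then obtain f' where [simp]: "f = (S, T, f')" and f: "(S, T, f') \<in> Arr (center C N')"
      by (auto simp: center_homset)
    then have "f' \<in> homset N' (fst S) (fst T)" by (simp add: center_simps)
    from nat_trans.naturality[OF nat\<epsilon> this] f
    show "farr (id_fctr (center C N')) f \<cdot>\<^bsub>center C N'\<^esub> ?\<epsilon> S =
        ?\<epsilon> T \<cdot>\<^bsub>center C N'\<^esub> farr (comp_fctr (center_fctr C N' F) (center_fctr C N G)) f"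
      by (auto simp: center_simps(3-6)) (simp add: center_simps homset_iff)
  qed
  ultimately have "adjunction (center C N) (center C N') (center_fctr C N' F) (center_fctr C N G) ?\<eta> ?\<epsilon>"
    using ZF.cat_functor_axioms ZG.cat_functor_axioms
    by (simp add: adjunction_def center_simps(5,6) triangles center_objD)
  then show ?thesis unfolding adjoint_pair_def by blast
qed

text \<open>\<open>J\<close> cancels \<open>I\<close> on the nose, so the unit can be kept and the counit is moved along \<open>I\<close>.\<close>

lemma adjoint_pair_transport:
  assumes "adjoint_pair C D F G" "inverse_functors D E I J"
  shows "adjoint_pair C E (comp_fctr I F) (comp_fctr G J)"
proof -
  interpret IJ: cat_functor D E I using assms by (simp add: inverse_functors_def)
  interpret J: cat_functor E D J using assms by (simp add: inverse_functors_def)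
  have inv [simp]: "\<And>A. A \<in> Obj D \<Longrightarrow> fobj J (fobj I A) = A" "\<And>f. f \<in> Arr D \<Longrightarrow> farr J (farr I f) = f"
    "\<And>B. B \<in> Obj E \<Longrightarrow> fobj I (fobj J B) = B" "\<And>g. g \<in> Arr E \<Longrightarrow> farr I (farr J g) = g"
    using assms by (auto simp: inverse_functors_def)
  obtain \<eta> \<epsilon> where adj: "adjunction C D F G \<eta> \<epsilon>" using assms by (auto simp: adjoint_pair_def)
  interpret F: cat_functor C D F using adj by (simp add: adjunction_def)
  interpret G: cat_functor D C G using adj by (simp add: adjunction_def)
  interpret \<eta>: nat_trans C C "id_fctr C" "comp_fctr G F" \<eta> using adj by (simp add: adjunction_def)
  interpret \<epsilon>: nat_trans D D "comp_fctr F G" "id_fctr D" \<epsilon> using adj by (simp add: adjunction_def)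
  let ?F = "comp_fctr I F" and ?G = "comp_fctr G J" and ?\<epsilon> = "\<lambda>B. farr I (\<epsilon> (fobj J B))"
  have F: "cat_functor C E ?F" and G: "cat_functor E C ?G"
    by (rule cat_functor_comp F.cat_functor_axioms G.cat_functor_axioms IJ.cat_functor_axioms
        J.cat_functor_axioms)+
  have \<eta>_arr [simp]: "\<eta> A \<in> Arr C" "Dom C (\<eta> A) = A" "Cod C (\<eta> A) = fobj G (fobj F A)"
    if "A \<in> Obj C" for A
    using \<eta>.component_closed[OF that] that by (auto simp: homset_iff)
  have \<epsilon>_arr [simp]: "\<epsilon> B \<in> Arr D" "Dom D (\<epsilon> B) = fobj F (fobj G B)" "Cod D (\<epsilon> B) = B"
    if "B \<in> Obj D" for B
    using \<epsilon>.component_closed[OF that] that by (auto simp: homset_iff)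
  have "nat_trans C C (id_fctr C) (comp_fctr ?G ?F) \<eta>"
  proof (intro nat_trans.intro nat_trans_axioms.intro)
    show "cat_functor C C (comp_fctr ?G ?F)" by (rule cat_functor_comp[OF F G])
    fix f A B assume "f \<in> homset C A B"
    with \<eta>.naturality[OF this] show "farr (comp_fctr ?G ?F) f \<cdot>\<^bsub>C\<^esub> \<eta> A = \<eta> B \<cdot>\<^bsub>C\<^esub> farr (id_fctr C) f"
      by (auto simp: homset_iff)
  qed (auto simp: homset_iff intro: cat_functor_id F.C.category_axioms)
  moreover have "nat_trans E E (comp_fctr ?F ?G) (id_fctr E) ?\<epsilon>"
  proof (intro nat_trans.intro nat_trans_axioms.intro)
    show "cat_functor E E (comp_fctr ?F ?G)" by (rule cat_functor_comp[OF G F])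
    fix f A B assume "f \<in> homset E A B"
    then have f [simp]: "f \<in> Arr E" "Dom E f = A" "Cod E f = B" by (auto simp: homset_iff)
    have [simp]: "A \<in> Obj E" "B \<in> Obj E"
      using IJ.D.Dom_closed[OF f(1)] IJ.D.Cod_closed[OF f(1)] by simp_all
    have "farr J f \<cdot>\<^bsub>D\<^esub> \<epsilon> (fobj J A) = \<epsilon> (fobj J B) \<cdot>\<^bsub>D\<^esub> farr F (farr G (farr J f))"
      using \<epsilon>.naturality[OF homsetI, of "farr J f"] by simp
    then have "farr I (farr J f \<cdot>\<^bsub>D\<^esub> \<epsilon> (fobj J A)) = farr I (\<epsilon> (fobj J B) \<cdot>\<^bsub>D\<^esub> farr F (farr G (farr J f)))"
      by simp
    then show "farr (id_fctr E) f \<cdot>\<^bsub>E\<^esub> ?\<epsilon> A = ?\<epsilon> B \<cdot>\<^bsub>E\<^esub> farr (comp_fctr ?F ?G) f"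
      by (simp add: IJ.farr_comp)
  qed (auto simp: homset_iff intro: cat_functor_id IJ.D.category_axioms)
  moreover have "?\<epsilon> (fobj ?F A) \<cdot>\<^bsub>E\<^esub> farr ?F (\<eta> A) = idt E (fobj ?F A)" if "A \<in> Obj C" for A
    using adj that by (simp add: adjunction_def IJ.farr_comp[symmetric])
  moreover have "farr ?G (?\<epsilon> B) \<cdot>\<^bsub>C\<^esub> \<eta> (fobj ?G B) = idt C (fobj ?G B)" if "B \<in> Obj E" for B
    using adj that by (simp add: adjunction_def)
  ultimately show ?thesis
    using F G unfolding adjoint_pair_def adjunction_def by blast
qed

section \<open>Right exact endofunctors as a bimodule category\<close>

lemma Rex_simps [simp]:
  "Dom (Rex K M) (F, G, \<alpha>) = F" "Cod (Rex K M) (F, G, \<alpha>) = G"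
  "(F', G', \<beta>) \<cdot>\<^bsub>Rex K M\<^esub> (F, G, \<alpha>) = (F, G', \<lambda>A \<in> Obj M. \<beta> A \<cdot>\<^bsub>M\<^esub> \<alpha> A)"
  "idt (Rex K M) F = (F, F, \<lambda>A \<in> Obj M. idt M (fobj F A))"
  by (simp_all add: Rex_def Let_def)

lemma Rex_obj_iff: "F \<in> Obj (Rex K M) \<longleftrightarrow> linear_functor K M M F \<and> right_exact M M F \<and>
    fobj F \<in> extensional (Obj M) \<and> farr F \<in> extensional (Arr M)"
  by (simp add: Rex_def Let_def)

lemma Rex_obj_functor: "F \<in> Obj (Rex K M) \<Longrightarrow> cat_functor M M F"
  by (simp add: Rex_obj_iff linear_functor_def)

lemma Rex_functor_simps:
  assumes "F \<in> Obj (Rex K M)"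
  shows "A \<in> Obj M \<Longrightarrow> fobj F A \<in> Obj M" "A \<in> Obj M \<Longrightarrow> farr F (idt M A) = idt M (fobj F A)"
    "f \<in> Arr M \<Longrightarrow> farr F f \<in> Arr M" "f \<in> Arr M \<Longrightarrow> Dom M (farr F f) = fobj F (Dom M f)"
    "f \<in> Arr M \<Longrightarrow> Cod M (farr F f) = fobj F (Cod M f)" "iso_arrow M f \<Longrightarrow> iso_arrow M (farr F f)"
proof -
  interpret cat_functor M M F by (rule Rex_obj_functor[OF assms])
  show "A \<in> Obj M \<Longrightarrow> fobj F A \<in> Obj M" "A \<in> Obj M \<Longrightarrow> farr F (idt M A) = idt M (fobj F A)"
    "f \<in> Arr M \<Longrightarrow> farr F f \<in> Arr M" "f \<in> Arr M \<Longrightarrow> Dom M (farr F f) = fobj F (Dom M f)"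
    "f \<in> Arr M \<Longrightarrow> Cod M (farr F f) = fobj F (Cod M f)" "iso_arrow M f \<Longrightarrow> iso_arrow M (farr F f)"
    by simp_all
qed

lemma Rex_functor_comp:
  "F \<in> Obj (Rex K M) \<Longrightarrow> f \<in> Arr M \<Longrightarrow> g \<in> Arr M \<Longrightarrow> Dom M g = Cod M f
    \<Longrightarrow> farr F (g \<cdot>\<^bsub>M\<^esub> f) = farr F g \<cdot>\<^bsub>M\<^esub> farr F f"
  by (rule cat_functor.farr_comp[OF Rex_obj_functor])

lemma Rex_arr_iff:
  "(F, G, \<alpha>) \<in> Arr (Rex K M) \<longleftrightarrow> F \<in> Obj (Rex K M) \<and> G \<in> Obj (Rex K M) \<and> \<alpha> \<in> extensional (Obj M) \<and>
     (\<forall>A \<in> Obj M. \<alpha> A \<in> Arr M \<and> Dom M (\<alpha> A) = fobj F A \<and> Cod M (\<alpha> A) = fobj G A) \<and>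
     (\<forall>f \<in> Arr M. farr G f \<cdot>\<^bsub>M\<^esub> \<alpha> (Dom M f) = \<alpha> (Cod M f) \<cdot>\<^bsub>M\<^esub> farr F f)" (is "?l \<longleftrightarrow> ?r")
proof
  assume ?l
  then have "nat_trans M M F G \<alpha>" and "F \<in> Obj (Rex K M)" "G \<in> Obj (Rex K M)" "\<alpha> \<in> extensional (Obj M)"
    by (auto simp: Rex_def Let_def)
  then show ?r
    using nat_trans.component_closed[of M M F G \<alpha>] nat_trans.naturality[OF _ homsetI, of M M F G \<alpha>]
    by (auto simp: homset_iff)
next
  assume ?r
  then have "nat_trans M M F G \<alpha>"
    by (intro nat_trans.intro nat_trans_axioms.intro) (auto simp: Rex_obj_functor homset_iff)
  with \<open>?r\<close> show ?l by (auto simp: Rex_def Let_def)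
qed

lemma Rex_homset_iff:
  "a \<in> homset (Rex K M) F G \<longleftrightarrow> (\<exists>\<alpha>. a = (F, G, \<alpha>) \<and> (F, G, \<alpha>) \<in> Arr (Rex K M))"
  by (cases a) (auto simp: homset_iff)

lemma Rex_arr_obj: "(F, G, \<alpha>) \<in> Arr (Rex K M) \<Longrightarrow> F \<in> Obj (Rex K M)"
  "(F, G, \<alpha>) \<in> Arr (Rex K M) \<Longrightarrow> G \<in> Obj (Rex K M)"
  by (auto simp: Rex_arr_iff)

lemma Rex_category:
  fixes M :: "('n, 'p, 'k, 'z) lincat_scheme" (structure)
  assumes "category M"
  shows "category (Rex K M)"
proof -
  interpret category M by fact
  note [simp] = Rex_functor_simps[where K = K and M = M]
  show ?thesis
  proof
    fix F assume "F \<in> Obj (Rex K M)"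
    then show "idt (Rex K M) F \<in> homset (Rex K M) F F"
      by (auto simp: Rex_homset_iff Rex_arr_iff)
  next
    fix f g F G H assume "f \<in> homset (Rex K M) F G" "g \<in> homset (Rex K M) G H"
    then obtain \<alpha> \<beta> where [simp]: "f = (F, G, \<alpha>)" "g = (G, H, \<beta>)"
      and \<alpha>: "(F, G, \<alpha>) \<in> Arr (Rex K M)" and \<beta>: "(G, H, \<beta>) \<in> Arr (Rex K M)"
      by (auto simp: Rex_homset_iff)
    have "farr H h \<cdot> (\<beta> (Dom M h) \<cdot> \<alpha> (Dom M h)) = (\<beta> (Cod M h) \<cdot> \<alpha> (Cod M h)) \<cdot> farr F h"
      if [simp]: "h \<in> Arr M" for h
    proof -
      note [simp] = \<alpha>[unfolded Rex_arr_iff, THEN conjunct1] \<beta>[unfolded Rex_arr_iff, THEN conjunct1]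
        \<beta>[unfolded Rex_arr_iff, THEN conjunct2, THEN conjunct1]
      have [simp]: "\<And>A. A \<in> Obj M \<Longrightarrow> \<alpha> A \<in> Arr M \<and> Dom M (\<alpha> A) = fobj F A \<and> Cod M (\<alpha> A) = fobj G A"
        "\<And>A. A \<in> Obj M \<Longrightarrow> \<beta> A \<in> Arr M \<and> Dom M (\<beta> A) = fobj G A \<and> Cod M (\<beta> A) = fobj H A"
        using \<alpha> \<beta> by (auto simp: Rex_arr_iff)
      have "farr H h \<cdot> (\<beta> (Dom M h) \<cdot> \<alpha> (Dom M h)) = (farr H h \<cdot> \<beta> (Dom M h)) \<cdot> \<alpha> (Dom M h)" by simp
      also have "\<dots> = (\<beta> (Cod M h) \<cdot> farr G h) \<cdot> \<alpha> (Dom M h)"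
        using \<beta> that by (simp add: Rex_arr_iff del: assoc)
      also have "\<dots> = \<beta> (Cod M h) \<cdot> (farr G h \<cdot> \<alpha> (Dom M h))" by simp
      also have "\<dots> = (\<beta> (Cod M h) \<cdot> \<alpha> (Cod M h)) \<cdot> farr F h"
        using \<alpha> that by (simp add: Rex_arr_iff)
      finally show ?thesis .
    qed
    with \<alpha> \<beta> show "g \<cdot>\<^bsub>Rex K M\<^esub> f \<in> homset (Rex K M) F H"
      by (simp add: Rex_homset_iff) (auto simp: Rex_arr_iff)
  next
    fix f F G assume "f \<in> homset (Rex K M) F G"
    then obtain \<alpha> where [simp]: "f = (F, G, \<alpha>)" and \<alpha>: "(F, G, \<alpha>) \<in> Arr (Rex K M)"
      by (auto simp: Rex_homset_iff)
    show "idt (Rex K M) G \<cdot>\<^bsub>Rex K M\<^esub> f = f" "f \<cdot>\<^bsub>Rex K M\<^esub> idt (Rex K M) F = f"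
      using \<alpha> by (auto simp: Rex_arr_iff intro!: extensionalityI[of _ "Obj M"])
  next
    fix f g h F G H I
    assume "f \<in> homset (Rex K M) F G" "g \<in> homset (Rex K M) G H" "h \<in> homset (Rex K M) H I"
    then show "(h \<cdot>\<^bsub>Rex K M\<^esub> g) \<cdot>\<^bsub>Rex K M\<^esub> f = h \<cdot>\<^bsub>Rex K M\<^esub> g \<cdot>\<^bsub>Rex K M\<^esub> f"
      by (auto simp: Rex_homset_iff Rex_arr_iff cong: restrict_cong)
  qed (auto simp: Rex_arr_iff)
qed

text \<open>Inverting the naturality squares shows that the pointwise inverses are natural.\<close>

lemma Rex_inverse_arrows:
  fixes M :: "('n, 'p, 'k, 'z) lincat_scheme" (structure)
  assumes "category M" and \<alpha>: "(F, G, \<alpha>) \<in> Arr (Rex K M)" and iso: "\<And>A. A \<in> Obj M \<Longrightarrow> iso_arrow M (\<alpha> A)"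
  shows "inverse_arrows (Rex K M) (F, G, \<alpha>) (G, F, \<lambda>A \<in> Obj M. inv_arrow M (\<alpha> A))"
proof -
  interpret category M by fact
  note [simp] = Rex_functor_simps[where K = K and M = M] Rex_arr_obj[OF \<alpha>] iso
  have [simp]: "\<And>A. A \<in> Obj M \<Longrightarrow> \<alpha> A \<in> Arr M \<and> Dom M (\<alpha> A) = fobj F A \<and> Cod M (\<alpha> A) = fobj G A"
    using \<alpha> by (auto simp: Rex_arr_iff)
  have "farr F h \<cdot> inv_arrow M (\<alpha> (Dom M h)) = inv_arrow M (\<alpha> (Cod M h)) \<cdot> farr G h"
    if "h \<in> Arr M" for h
    using inv_square[of "\<alpha> (Dom M h)" "\<alpha> (Cod M h)" "farr G h" "farr F h"] \<alpha> that by (simp add: Rex_arr_iff)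
  then have "(G, F, \<lambda>A \<in> Obj M. inv_arrow M (\<alpha> A)) \<in> Arr (Rex K M)"
    by (auto simp: Rex_arr_iff)
  then show ?thesis
    using \<alpha> by (auto simp: inverse_arrows_def homset_iff cong: restrict_cong)
qed

lemma Rex_iso_iff:
  assumes "category M"
  shows "iso_arrow (Rex K M) (F, G, \<alpha>) \<longleftrightarrow>
    (F, G, \<alpha>) \<in> Arr (Rex K M) \<and> (\<forall>A \<in> Obj M. iso_arrow M (\<alpha> A))" (is "?l \<longleftrightarrow> ?r")
proof
  assume ?l
  \<comment> \<open>An inverse is itself a triple with source \<open>G\<close> and target \<open>F\<close>, and it can be read off at each object.\<close>
  then obtain \<beta> where \<beta>: "inverse_arrows (Rex K M) (F, G, \<alpha>) (G, F, \<beta>)"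
    by (auto simp: iso_arrow_def inverse_arrows_def homset_iff)
  have "inverse_arrows M (\<alpha> A) (\<beta> A)" if "A \<in> Obj M" for A
  proof -
    have "(\<lambda>A \<in> Obj M. \<beta> A \<cdot>\<^bsub>M\<^esub> \<alpha> A) A = (\<lambda>A \<in> Obj M. idt M (fobj F A)) A"
      "(\<lambda>A \<in> Obj M. \<alpha> A \<cdot>\<^bsub>M\<^esub> \<beta> A) A = (\<lambda>A \<in> Obj M. idt M (fobj G A)) A"
      using \<beta> unfolding inverse_arrows_def by (simp_all only: Rex_simps prod.inject)
    then show ?thesis
      using \<beta> that by (auto simp: inverse_arrows_def homset_iff Rex_arr_iff)
  qed
  then have "\<forall>A \<in> Obj M. iso_arrow M (\<alpha> A)" unfolding iso_arrow_def by blast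
  with \<beta> show ?r by (simp add: inverse_arrows_def)
next
  assume ?r
  then show ?l using Rex_inverse_arrows[OF assms] unfolding iso_arrow_def by blast
qed

lemma rex_bimodule_simps [simp]:
  "Obj (rex_bimodule K C M) = Obj (Rex K M)" "Arr (rex_bimodule K C M) = Arr (Rex K M)"
  "Dom (rex_bimodule K C M) = Dom (Rex K M)" "Cod (rex_bimodule K C M) = Cod (Rex K M)"
  "idt (rex_bimodule K C M) = idt (Rex K M)" "Comp (rex_bimodule K C M) = Comp (Rex K M)"
  "ladd (rex_bimodule K C M) = ladd (Rex K M)" "lzero (rex_bimodule K C M) = lzero (Rex K M)"
  "lsmult (rex_bimodule K C M) = lsmult (Rex K M)"
  "blO (rex_bimodule K C M) = rex_lO C M" "blA (rex_bimodule K C M) = rex_lA C M"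
  "brO (rex_bimodule K C M) = rex_rO C M" "brA (rex_bimodule K C M) = rex_rA C M"
  "bla (rex_bimodule K C M) U V F = (rex_lO C M (tenO C U V) F, rex_lO C M U (rex_lO C M V F),
                   \<lambda>A \<in> Obj M. mas M U V (fobj F A))"
  "blu (rex_bimodule K C M) F = (rex_lO C M (unt C) F, F, \<lambda>A \<in> Obj M. mun M (fobj F A))"
  "bra (rex_bimodule K C M) F U V = (rex_rO C M (rex_rO C M F U) V, rex_rO C M F (tenO C U V),
                   \<lambda>A \<in> Obj M. farr F (inv_arrow M (mas M U V A)))"
  "bru (rex_bimodule K C M) F = (rex_rO C M F (unt C), F, \<lambda>A \<in> Obj M. farr F (mun M A))"
  "bma (rex_bimodule K C M) U F V = idt (Rex K M) (rex_lO C M U (rex_rO C M F V))"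
  by (simp_all add: rex_bimodule_def lincat.defs bimodcat.defs)

lemma rex_bimodule_homset [simp]:
  "homset (rex_bimodule K C M) = homset (Rex K M)"
  "iso_arrow (rex_bimodule K C M) = iso_arrow (Rex K M)"
  by (auto simp: homset_def iso_arrow_def inverse_arrows_def fun_eq_iff)

lemma rex_O_simps [simp]:
  "A \<in> Obj M \<Longrightarrow> fobj (rex_lO C M U F) A = actO M U (fobj F A)"
  "g \<in> Arr M \<Longrightarrow> farr (rex_lO C M U F) g = actA M (idt C U) (farr F g)"
  "A \<in> Obj M \<Longrightarrow> fobj (rex_rO C M F U) A = fobj F (actO M U A)"
  "g \<in> Arr M \<Longrightarrow> farr (rex_rO C M F U) g = farr F (actA M (idt C U) g)"
  by (simp_all add: rex_lO_def rex_rO_def)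

lemma rex_A_simps [simp]:
  "rex_lA C M f (F, G, \<alpha>) = (rex_lO C M (Dom C f) F, rex_lO C M (Cod C f) G, \<lambda>A \<in> Obj M. actA M f (\<alpha> A))"
  "rex_rA C M (F, G, \<alpha>) f = (rex_rO C M F (Dom C f), rex_rO C M G (Cod C f),
      \<lambda>A \<in> Obj M. \<alpha> (actO M (Cod C f) A) \<cdot>\<^bsub>M\<^esub> farr F (actA M f (idt M A)))"
  by (simp_all add: rex_lA_def rex_rA_def)

context left_module_category
begin

lemmas ten_simps [simp] = bifunctor_obj[OF C.ten_bifunctor] bifunctor_idt[OF C.ten_bifunctor]
    bifunctor_arr[OF C.ten_bifunctor] bifunctor_dom[OF C.ten_bifunctor] bifunctor_cod[OF C.ten_bifunctor]

lemmas act_simps [simp] = bifunctor_obj[OF act_bifunctor] bifunctor_idt[OF act_bifunctor]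
    bifunctor_arr[OF act_bifunctor] bifunctor_dom[OF act_bifunctor] bifunctor_cod[OF act_bifunctor]
  and act_comp = bifunctor_comp[OF act_bifunctor] bifunctor_comp_assoc[OF act_bifunctor M.category_axioms]
  and act_iso = bifunctor_iso[OF act_bifunctor C.category_axioms M.category_axioms M.category_axioms]

lemmas constraint_simps [simp] = C.unt_closed
  mas_closed[unfolded homset_iff, THEN conjunct1, THEN conjunct1]
  mas_closed[unfolded homset_iff, THEN conjunct1, THEN conjunct2, THEN conjunct1]
  mas_closed[unfolded homset_iff, THEN conjunct1, THEN conjunct2, THEN conjunct2]
  mas_closed[THEN conjunct2]
  mun_closed[unfolded homset_iff, THEN conjunct1, THEN conjunct1]
  mun_closed[unfolded homset_iff, THEN conjunct1, THEN conjunct2, THEN conjunct1]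
  mun_closed[unfolded homset_iff, THEN conjunct1, THEN conjunct2, THEN conjunct2]
  mun_closed[THEN conjunct2]
  C.asc_closed[unfolded homset_iff, THEN conjunct1, THEN conjunct1]
  C.asc_closed[unfolded homset_iff, THEN conjunct1, THEN conjunct2, THEN conjunct1]
  C.asc_closed[unfolded homset_iff, THEN conjunct1, THEN conjunct2, THEN conjunct2]
  C.asc_closed[THEN conjunct2]
  C.lun_closed[unfolded homset_iff, THEN conjunct1, THEN conjunct1]
  C.lun_closed[unfolded homset_iff, THEN conjunct1, THEN conjunct2, THEN conjunct1]
  C.lun_closed[unfolded homset_iff, THEN conjunct1, THEN conjunct2, THEN conjunct2]
  C.lun_closed[THEN conjunct2]
  C.run_closed[unfolded homset_iff, THEN conjunct1, THEN conjunct1]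
  C.run_closed[unfolded homset_iff, THEN conjunct1, THEN conjunct2, THEN conjunct1]
  C.run_closed[unfolded homset_iff, THEN conjunct1, THEN conjunct2, THEN conjunct2]
  C.run_closed[THEN conjunct2]

text \<open>The pentagon, read for the inverse associativity constraints: the coherence behind all three
  associativity axioms of the action functor.\<close>

lemma mas_pentagon_inv:
  assumes [simp]: "U \<in> Obj C" "V \<in> Obj C" "W \<in> Obj C" "A \<in> Obj M"
  shows "actA M (asc C U V W) (idt M A) \<cdot> inv_arrow M (mas M (tenO C U V) W A)
      \<cdot> inv_arrow M (mas M U V (actO M W A)) =
    inv_arrow M (mas M U (tenO C V W) A) \<cdot> actA M (idt C U) (inv_arrow M (mas M V W A))"
proof (rule M.iso_cancel_left[of "mas M U (tenO C V W) A"])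
  let ?m = "mas M U V (actO M W A) \<cdot> mas M (tenO C U V) W A"
  show "mas M U (tenO C V W) A \<cdot> (actA M (asc C U V W) (idt M A) \<cdot> inv_arrow M (mas M (tenO C U V) W A)
      \<cdot> inv_arrow M (mas M U V (actO M W A))) =
    mas M U (tenO C V W) A \<cdot> (inv_arrow M (mas M U (tenO C V W) A) \<cdot> actA M (idt C U) (inv_arrow M (mas M V W A)))"
    (is "?l = ?r")
  proof (rule M.iso_cancel_right[of ?m])
    have "?r \<cdot> ?m = actA M (idt C U) (inv_arrow M (mas M V W A)) \<cdot> ?m" by simp
    also have "\<dots> = mas M U (tenO C V W) A \<cdot> actA M (asc C U V W) (idt M A)"
      by (simp add: mas_pentagon act_comp)
    also have "\<dots> = ?l \<cdot> ?m" by simp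
    finally show "?l \<cdot> ?m = ?r \<cdot> ?m" by simp
  qed simp_all
qed simp_all

text \<open>Kelly's redundancy of the left unit axiom. Acting by \<open>1\<close> is faithful because \<open>mun\<close> is a
  natural isomorphism; after acting by \<open>1\<close>, the claim follows from the pentagon and the two triangles.\<close>

lemma mun_act:
  assumes U [simp]: "U \<in> Obj C" and A [simp]: "A \<in> Obj M"
  shows "mun M (actO M U A) \<cdot> mas M (unt C) U A = actA M (lun C U) (idt M A)" (is "?f = ?g")
proof -
  let ?I = "unt C"
  have f [simp]: "?f \<in> Arr M" "Dom M ?f = actO M (tenO C ?I U) A" "Cod M ?f = actO M U A"
    and g [simp]: "?g \<in> Arr M" "Dom M ?g = actO M (tenO C ?I U) A" "Cod M ?g = actO M U A"
    by simp_all
  \<comment> \<open>The part of the pentagon for \<open>1, 1, U, A\<close> that comes before \<open>id \<otimes> mas\<close>.\<close>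
  let ?e = "mas M ?I (tenO C ?I U) A \<cdot> actA M (asc C ?I ?I U) (idt M A)"
  have "actA M (idt C ?I) ?f = actA M (idt C ?I) ?g"
  proof (rule M.iso_cancel_right[of ?e])
    have "actA M (idt C ?I) ?f \<cdot> ?e = actA M (idt C ?I) (mun M (actO M U A))
        \<cdot> (actA M (idt C ?I) (mas M ?I U A) \<cdot> mas M ?I (tenO C ?I U) A \<cdot> actA M (asc C ?I ?I U) (idt M A))"
      by (simp add: act_comp)
    also have "\<dots> = (actA M (idt C ?I) (mun M (actO M U A)) \<cdot> mas M ?I ?I (actO M U A)) \<cdot> mas M (tenO C ?I ?I) U A"
      by (simp add: mas_pentagon[symmetric])
    also have "\<dots> = actA M (run C ?I) (actA M (idt C U) (idt M A)) \<cdot> mas M (tenO C ?I ?I) U A"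
      unfolding mun_triangle[OF C.unt_closed act_simps(1)[OF U A]] by simp
    also have "\<dots> = mas M ?I U A \<cdot> actA M (tenA C (run C ?I) (idt C U)) (idt M A)"
      using mas_natural[OF homsetI homsetI homsetI, of "run C ?I" "idt C U" "idt M A"] by simp
    also have "\<dots> = mas M ?I U A \<cdot> actA M (tenA C (idt C ?I) (lun C U)) (idt M A)
        \<cdot> actA M (asc C ?I ?I U) (idt M A)"
      by (simp add: C.triangle[symmetric] act_comp)
    also have "\<dots> = (mas M ?I U A \<cdot> actA M (tenA C (idt C ?I) (lun C U)) (idt M A))
        \<cdot> actA M (asc C ?I ?I U) (idt M A)"
      by simp
    also have "\<dots> = (actA M (idt C ?I) ?g \<cdot> mas M ?I (tenO C ?I U) A) \<cdot> actA M (asc C ?I ?I U) (idt M A)"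
      using mas_natural[OF homsetI homsetI homsetI, of "idt C ?I" "lun C U" "idt M A"] by simp
    also have "\<dots> = actA M (idt C ?I) ?g \<cdot> ?e" by simp
    finally show "actA M (idt C ?I) ?f \<cdot> ?e = actA M (idt C ?I) ?g \<cdot> ?e" .
  qed (simp_all add: act_iso)
  then have "?f \<cdot> mun M (actO M (tenO C ?I U) A) = ?g \<cdot> mun M (actO M (tenO C ?I U) A)"
    using mun_natural[OF homsetI[OF f(1)]] mun_natural[OF homsetI[OF g(1)]] unfolding f g by simp
  then show ?thesis
    by (rule M.iso_cancel_right[rotated -1]) simp_all
qed

end

lemma (in linear_category) ladd_closed:
  assumes "f \<in> homset C A B" "g \<in> homset C A B"
  shows "ladd C f g \<in> homset C A B"
proof -
  have "A \<in> Obj C" "B \<in> Obj C" using assms Dom_closed Cod_closed by (auto simp: homset_iff)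
  then interpret module K "hom_module C A B" by (rule hom_vector_space)
  show ?thesis using M.a_closed[of f g] assms by (simp add: hom_module_def)
qed

lemma (in linear_category) lsmult_closed:
  assumes "a \<in> carrier K" "f \<in> homset C A B"
  shows "lsmult C a f \<in> homset C A B"
proof -
  have "A \<in> Obj C" "B \<in> Obj C" using assms Dom_closed Cod_closed by (auto simp: homset_iff)
  then interpret module K "hom_module C A B" by (rule hom_vector_space)
  show ?thesis using smult_closed[of a f] assms by (simp add: hom_module_def)
qed

lemma linear_functor_comp:
  assumes "linear_functor K C D F" "linear_functor K D E G"
  shows "linear_functor K C E (comp_fctr G F)"
proof -
  interpret F: linear_functor K C D F by fact
  interpret G: linear_functor K D E G by fact
  show ?thesis
    by (intro linear_functor.intro linear_functor_axioms.intro cat_functor_comp[of C D F E G])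
      (auto simp: F.farr_ladd F.farr_lsmult
        intro!: F.cat_functor_axioms G.cat_functor_axioms G.farr_ladd G.farr_lsmult F.farr_closed)
qed

text \<open>An object of \<open>Rex K M\<close> is a right exact linear endofunctor restricted to \<open>M\<close>, since functors
  that differ only outside \<open>M\<close> are to be identified.\<close>

lemma Rex_restrict:
  assumes "linear_category K M" "linear_functor K M M G" "right_exact M M G"
  shows "\<lparr>fobj = restrict (fobj G) (Obj M), farr = restrict (farr G) (Arr M)\<rparr> \<in> Obj (Rex K M)"
proof -
  interpret M: linear_category K M by fact
  interpret G: linear_functor K M M G by fact
  have "linear_functor K M M \<lparr>fobj = restrict (fobj G) (Obj M), farr = restrict (farr G) (Arr M)\<rparr>"
  proof
    fix f g A B
    assume fg: "f \<in> homset M A B" "g \<in> homset M A B"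
    show "farr \<lparr>fobj = restrict (fobj G) (Obj M), farr = restrict (farr G) (Arr M)\<rparr> (ladd M f g) =
      ladd M (farr \<lparr>fobj = restrict (fobj G) (Obj M), farr = restrict (farr G) (Arr M)\<rparr> f)
        (farr \<lparr>fobj = restrict (fobj G) (Obj M), farr = restrict (farr G) (Arr M)\<rparr> g)"
      using G.farr_ladd[OF fg] M.ladd_closed[OF fg] fg by (auto simp: homset_iff)
  next
    fix a f A B
    assume af: "a \<in> carrier K" "f \<in> homset M A B"
    show "farr \<lparr>fobj = restrict (fobj G) (Obj M), farr = restrict (farr G) (Arr M)\<rparr> (lsmult M a f) =
      lsmult M a (farr \<lparr>fobj = restrict (fobj G) (Obj M), farr = restrict (farr G) (Arr M)\<rparr> f)"
      using G.farr_lsmult[OF af] M.lsmult_closed[OF af] af by (auto simp: homset_iff)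
  qed (auto simp: homset_iff G.farr_comp)
  moreover have "right_exact M M \<lparr>fobj = restrict (fobj G) (Obj M), farr = restrict (farr G) (Arr M)\<rparr>"
    using assms(3) by (auto simp: right_exact_def) (simp_all add: is_cokernel_def)
  ultimately show ?thesis by (simp add: Rex_obj_iff)
qed

lemma Rex_ops [simp]:
  "ladd (Rex K M) (F, G, \<alpha>) (F', G', \<beta>) = (F, G, \<lambda>A \<in> Obj M. ladd M (\<alpha> A) (\<beta> A))"
  "lsmult (Rex K M) a (F, G, \<alpha>) = (F, G, \<lambda>A \<in> Obj M. lsmult M a (\<alpha> A))"
  by (simp_all add: Rex_def Let_def)

lemma Rex_arrD:
  assumes "(F, G, \<alpha>) \<in> Arr (Rex K M)"
  shows "F \<in> Obj (Rex K M)" "G \<in> Obj (Rex K M)"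
    "A \<in> Obj M \<Longrightarrow> \<alpha> A \<in> Arr M" "A \<in> Obj M \<Longrightarrow> Dom M (\<alpha> A) = fobj F A"
    "A \<in> Obj M \<Longrightarrow> Cod M (\<alpha> A) = fobj G A"
    "f \<in> Arr M \<Longrightarrow> farr G f \<cdot>\<^bsub>M\<^esub> \<alpha> (Dom M f) = \<alpha> (Cod M f) \<cdot>\<^bsub>M\<^esub> farr F f"
    "\<alpha> \<in> extensional (Obj M)"
  using assms by (auto simp: Rex_arr_iff)

lemma Rex_arrI:
  assumes "F \<in> Obj (Rex K M)" "G \<in> Obj (Rex K M)" "\<alpha> \<in> extensional (Obj M)"
    "\<And>A. A \<in> Obj M \<Longrightarrow> \<alpha> A \<in> Arr M" "\<And>A. A \<in> Obj M \<Longrightarrow> Dom M (\<alpha> A) = fobj F A"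
    "\<And>A. A \<in> Obj M \<Longrightarrow> Cod M (\<alpha> A) = fobj G A"
    "\<And>f. f \<in> Arr M \<Longrightarrow> farr G f \<cdot>\<^bsub>M\<^esub> \<alpha> (Dom M f) = \<alpha> (Cod M f) \<cdot>\<^bsub>M\<^esub> farr F f"
  shows "(F, G, \<alpha>) \<in> Arr (Rex K M)"
  using assms by (auto simp: Rex_arr_iff)

lemma (in left_module_category) mas_inv_natural:
  assumes [simp]: "f \<in> Arr C" "g \<in> Arr C" "h \<in> Arr M"
  shows "actA M (tenA C f g) h \<cdot> inv_arrow M (mas M (Dom C f) (Dom C g) (Dom M h)) =
    inv_arrow M (mas M (Cod C f) (Cod C g) (Cod M h)) \<cdot> actA M f (actA M g h)"
proof -
  have "mas M (Cod C f) (Cod C g) (Cod M h) \<cdot> actA M (tenA C f g) h =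
      actA M f (actA M g h) \<cdot> mas M (Dom C f) (Dom C g) (Dom M h)"
    by (rule mas_natural[OF assms[THEN homsetI]])
  then show ?thesis
    using M.inv_square[of "mas M (Dom C f) (Dom C g) (Dom M h)" "mas M (Cod C f) (Cod C g) (Cod M h)"
        "actA M f (actA M g h)" "actA M (tenA C f g) h"] by simp
qed

context finite_module_category
begin

lemma linear_M: "linear_category K M"
  using finite_abelian by (simp add: finite_abelian_def)

lemma act_fctr:
  "U \<in> Obj C \<Longrightarrow> linear_functor K M M (fix_left C (actO M) (actA M) U)"
  "U \<in> Obj C \<Longrightarrow> right_exact M M (fix_left C (actO M) (actA M) U)"
  using act_linear act_right_exact
  by (auto simp: linear_in_each_variable_def right_exact_in_each_variable_def)

lemma right_exact_comp: "right_exact M M F \<Longrightarrow> right_exact M M G \<Longrightarrow> right_exact M M (comp_fctr F G)"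
  by (simp add: right_exact_def)

lemma rex_lO_closed:
  assumes "U \<in> Obj C" "F \<in> Obj (Rex K M)"
  shows "rex_lO C M U F \<in> Obj (Rex K M)"
proof -
  let ?G = "comp_fctr (fix_left C (actO M) (actA M) U) F"
  have "rex_lO C M U F = \<lparr>fobj = restrict (fobj ?G) (Obj M), farr = restrict (farr ?G) (Arr M)\<rparr>"
    by (simp add: rex_lO_def fix_left_def comp_fctr_def restrict_def fun_eq_iff)
  moreover have "linear_functor K M M ?G" "right_exact M M ?G"
    using assms by (auto intro!: linear_functor_comp right_exact_comp act_fctr simp: Rex_obj_iff)
  ultimately show ?thesis using Rex_restrict[OF linear_M] by simp
qed

lemma rex_rO_closed:
  assumes "U \<in> Obj C" "F \<in> Obj (Rex K M)"
  shows "rex_rO C M F U \<in> Obj (Rex K M)"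
proof -
  let ?G = "comp_fctr F (fix_left C (actO M) (actA M) U)"
  have "rex_rO C M F U = \<lparr>fobj = restrict (fobj ?G) (Obj M), farr = restrict (farr ?G) (Arr M)\<rparr>"
    by (simp add: rex_rO_def fix_left_def comp_fctr_def restrict_def fun_eq_iff)
  moreover have "linear_functor K M M ?G" "right_exact M M ?G"
    using assms by (auto intro!: linear_functor_comp right_exact_comp act_fctr simp: Rex_obj_iff)
  ultimately show ?thesis using Rex_restrict[OF linear_M] by simp
qed

lemma id_fctr_closed: "id_fctr M \<in> Obj (Rex K M)"
proof -
  interpret L: linear_category K M by (rule linear_M)
  have "linear_functor K M M (id_fctr M)"
    using L.ladd_closed L.lsmult_closed
    by (intro linear_functor.intro linear_functor_axioms.intro cat_functor_id[OF M.category_axioms])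
      (fastforce simp: homset_iff)+
  moreover have "right_exact M M (id_fctr M)"
    by (auto simp: right_exact_def id_fctr_def) (simp_all add: is_cokernel_def)
  ultimately show ?thesis by (simp add: Rex_obj_iff id_fctr_def)
qed

text \<open>The two actions commute strictly, which is why the middle constraint is an identity.\<close>

lemma rex_rO_lO: "F \<in> Obj (Rex K M) \<Longrightarrow> U \<in> Obj C \<Longrightarrow> V \<in> Obj C \<Longrightarrow>
    rex_rO C M (rex_lO C M U F) V = rex_lO C M U (rex_rO C M F V)"
  by (auto simp: rex_rO_def rex_lO_def restrict_def fun_eq_iff)

lemma rex_lA_closed:
  assumes [simp]: "f \<in> Arr C" and \<alpha>: "(F, G, \<alpha>) \<in> Arr (Rex K M)"
  shows "rex_lA C M f (F, G, \<alpha>) \<in> Arr (Rex K M)"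
proof -
  note [simp] = Rex_arrD[OF \<alpha>] Rex_functor_simps[OF Rex_arrD(1)[OF \<alpha>]] Rex_functor_simps[OF Rex_arrD(2)[OF \<alpha>]]
  show ?thesis
    by (auto simp: act_comp rex_lO_closed intro!: Rex_arrI)
qed

text \<open>In the formula for \<open>rex_rA\<close>, \<open>f\<close> is applied under \<open>F\<close> before \<open>\<alpha>\<close>. Naturality of \<open>\<alpha>\<close> says that
  the other order gives the same arrow; this interchange is what makes the result natural, and what
  makes the right action functorial below.\<close>

lemma rex_rA_closed:
  assumes f [simp]: "f \<in> Arr C" and \<alpha>: "(F, G, \<alpha>) \<in> Arr (Rex K M)"
  shows "rex_rA C M (F, G, \<alpha>) f \<in> Arr (Rex K M)"
proof -
  note [simp] = Rex_arrD[OF \<alpha>] Rex_functor_simps[OF Rex_arrD(1)[OF \<alpha>]] Rex_functor_simps[OF Rex_arrD(2)[OF \<alpha>]]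
  have "farr G (actA M (idt C (Cod C f)) g) \<cdot>\<^bsub>M\<^esub> \<alpha> (actO M (Cod C f) (Dom M g)) \<cdot>\<^bsub>M\<^esub> farr F (actA M f (idt M (Dom M g)))
     = (\<alpha> (actO M (Cod C f) (Cod M g)) \<cdot>\<^bsub>M\<^esub> farr F (actA M f (idt M (Cod M g)))) \<cdot>\<^bsub>M\<^esub> farr F (actA M (idt C (Dom C f)) g)"
    if [simp]: "g \<in> Arr M" for g
  proof -
    have "farr G (actA M (idt C (Cod C f)) g) \<cdot>\<^bsub>M\<^esub> \<alpha> (actO M (Cod C f) (Dom M g)) \<cdot>\<^bsub>M\<^esub> farr F (actA M f (idt M (Dom M g))) =
        (farr G (actA M (idt C (Cod C f)) g) \<cdot>\<^bsub>M\<^esub> \<alpha> (actO M (Cod C f) (Dom M g))) \<cdot>\<^bsub>M\<^esub> farr F (actA M f (idt M (Dom M g)))"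
      by simp
    also have "\<dots> = (\<alpha> (actO M (Cod C f) (Cod M g)) \<cdot>\<^bsub>M\<^esub> farr F (actA M (idt C (Cod C f)) g)) \<cdot>\<^bsub>M\<^esub> farr F (actA M f (idt M (Dom M g)))"
      using Rex_arrD(6)[OF \<alpha>, of "actA M (idt C (Cod C f)) g"] by (simp del: M.assoc)
    also have "\<dots> = (\<alpha> (actO M (Cod C f) (Cod M g)) \<cdot>\<^bsub>M\<^esub> farr F (actA M f (idt M (Cod M g)))) \<cdot>\<^bsub>M\<^esub> farr F (actA M (idt C (Dom C f)) g)"
      by (simp add: act_comp Rex_functor_comp[OF Rex_arrD(1)[OF \<alpha>], symmetric])
    finally show ?thesis .
  qed
  then show ?thesis
    by (auto simp: rex_rO_closed intro!: Rex_arrI)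
qed

lemma rex_two_sided_action: "two_sided_action C (rex_bimodule K C M)"
proof -
  have cat: "category (rex_bimodule K C M)"
    using Rex_category[OF M.category_axioms, of K]
    by (simp add: category_def homset_def)
  have left: "bifunctor C (rex_bimodule K C M) (rex_bimodule K C M) (rex_lO C M) (rex_lA C M)"
    unfolding bifunctor_def
  proof (intro conjI ballI impI)
    fix U F assume [simp]: "U \<in> Obj C" and "F \<in> Obj (rex_bimodule K C M)"
    then have F: "F \<in> Obj (Rex K M)" by simp
    show "rex_lO C M U F \<in> Obj (rex_bimodule K C M)" using F by (simp add: rex_lO_closed)
    show "rex_lA C M (idt C U) (idt (rex_bimodule K C M) F) = idt (rex_bimodule K C M) (rex_lO C M U F)"
      by (simp add: Rex_functor_simps[OF F] cong: restrict_cong)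
  next
    fix f a assume f: "f \<in> Arr C" "a \<in> Arr (rex_bimodule K C M)"
    obtain F G \<alpha> where [simp]: "a = (F, G, \<alpha>)" by (cases a)
    show "rex_lA C M f a \<in> homset (rex_bimodule K C M) (rex_lO C M (Dom C f) (Dom (rex_bimodule K C M) a))
        (rex_lO C M (Cod C f) (Cod (rex_bimodule K C M) a))"
      using rex_lA_closed[of f F G \<alpha>] f by (simp add: homset_iff)
  next
    fix f f' a b
    assume [simp]: "f \<in> Arr C" "f' \<in> Arr C" and ab: "a \<in> Arr (rex_bimodule K C M)" "b \<in> Arr (rex_bimodule K C M)"
      and dom: "Dom C f' = Cod C f \<and> Dom (rex_bimodule K C M) b = Cod (rex_bimodule K C M) a"
    obtain F G \<alpha> H \<beta> where [simp]: "a = (F, G, \<alpha>)" "b = (G, H, \<beta>)" using dom by (cases a; cases b) auto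
    note [simp] = Rex_arrD(3-5)[of F G \<alpha> K M] Rex_arrD(3-5)[of G H \<beta> K M]
    show "rex_lA C M (f' \<cdot>\<^bsub>C\<^esub> f) (b \<cdot>\<^bsub>rex_bimodule K C M\<^esub> a) =
        rex_lA C M f' b \<cdot>\<^bsub>rex_bimodule K C M\<^esub> rex_lA C M f a"
      using ab dom by (simp add: act_comp cong: restrict_cong)
  qed
  have right: "bifunctor (rex_bimodule K C M) C (rex_bimodule K C M) (rex_rO C M) (rex_rA C M)"
    unfolding bifunctor_def
  proof (intro conjI ballI impI)
    fix U F assume [simp]: "U \<in> Obj C" and "F \<in> Obj (rex_bimodule K C M)"
    then have F: "F \<in> Obj (Rex K M)" by simp
    show "rex_rO C M F U \<in> Obj (rex_bimodule K C M)" using F by (simp add: rex_rO_closed)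
    show "rex_rA C M (idt (rex_bimodule K C M) F) (idt C U) = idt (rex_bimodule K C M) (rex_rO C M F U)"
      by (simp add: Rex_functor_simps[OF F] cong: restrict_cong)
  next
    fix f a assume f: "f \<in> Arr C" "a \<in> Arr (rex_bimodule K C M)"
    obtain F G \<alpha> where [simp]: "a = (F, G, \<alpha>)" by (cases a)
    show "rex_rA C M a f \<in> homset (rex_bimodule K C M) (rex_rO C M (Dom (rex_bimodule K C M) a) (Dom C f))
        (rex_rO C M (Cod (rex_bimodule K C M) a) (Cod C f))"
      using rex_rA_closed[of f F G \<alpha>] f by (simp add: homset_iff)
  next
    fix a b f f'
    assume [simp]: "f \<in> Arr C" "f' \<in> Arr C" and ab: "a \<in> Arr (rex_bimodule K C M)" "b \<in> Arr (rex_bimodule K C M)"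
      and dom: "Dom (rex_bimodule K C M) b = Cod (rex_bimodule K C M) a \<and> Dom C f' = Cod C f"
    obtain F G \<alpha> H \<beta> where [simp]: "a = (F, G, \<alpha>)" "b = (G, H, \<beta>)" using dom by (cases a; cases b) auto
    have \<alpha>: "(F, G, \<alpha>) \<in> Arr (Rex K M)" and \<beta>: "(G, H, \<beta>) \<in> Arr (Rex K M)" using ab by auto
    note [simp] = Rex_arrD(1-5)[OF \<alpha>] Rex_arrD(1-5)[OF \<beta>]
      Rex_functor_simps[OF Rex_arrD(1)[OF \<alpha>]] Rex_functor_simps[OF Rex_arrD(1)[OF \<beta>]]
    have "(\<beta> (actO M (Cod C f') A) \<cdot>\<^bsub>M\<^esub> \<alpha> (actO M (Cod C f') A)) \<cdot>\<^bsub>M\<^esub> farr F (actA M (f' \<cdot>\<^bsub>C\<^esub> f) (idt M A)) =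
        (\<beta> (actO M (Cod C f') A) \<cdot>\<^bsub>M\<^esub> farr G (actA M f' (idt M A))) \<cdot>\<^bsub>M\<^esub> \<alpha> (actO M (Cod C f) A) \<cdot>\<^bsub>M\<^esub> farr F (actA M f (idt M A))"
      if [simp]: "A \<in> Obj M" for A
    proof -
      have "farr F (actA M (f' \<cdot>\<^bsub>C\<^esub> f) (idt M A)) = farr F (actA M f' (idt M A)) \<cdot>\<^bsub>M\<^esub> farr F (actA M f (idt M A))"
        using dom by (simp add: Rex_functor_comp[OF Rex_arrD(1)[OF \<alpha>], symmetric] act_comp)
      then have "(\<beta> (actO M (Cod C f') A) \<cdot>\<^bsub>M\<^esub> \<alpha> (actO M (Cod C f') A)) \<cdot>\<^bsub>M\<^esub> farr F (actA M (f' \<cdot>\<^bsub>C\<^esub> f) (idt M A)) =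
          \<beta> (actO M (Cod C f') A) \<cdot>\<^bsub>M\<^esub> (\<alpha> (actO M (Cod C f') A) \<cdot>\<^bsub>M\<^esub> farr F (actA M f' (idt M A))) \<cdot>\<^bsub>M\<^esub> farr F (actA M f (idt M A))"
        using dom by simp
      also have "\<dots> = \<beta> (actO M (Cod C f') A) \<cdot>\<^bsub>M\<^esub> (farr G (actA M f' (idt M A)) \<cdot>\<^bsub>M\<^esub> \<alpha> (actO M (Cod C f) A)) \<cdot>\<^bsub>M\<^esub> farr F (actA M f (idt M A))"
        using Rex_arrD(6)[OF \<alpha>, of "actA M f' (idt M A)"] dom by simp
      also have "\<dots> = (\<beta> (actO M (Cod C f') A) \<cdot>\<^bsub>M\<^esub> farr G (actA M f' (idt M A))) \<cdot>\<^bsub>M\<^esub> \<alpha> (actO M (Cod C f) A) \<cdot>\<^bsub>M\<^esub> farr F (actA M f (idt M A))"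
        using dom by simp
      finally show ?thesis .
    qed
    then show "rex_rA C M (b \<cdot>\<^bsub>rex_bimodule K C M\<^esub> a) (f' \<cdot>\<^bsub>C\<^esub> f) =
        rex_rA C M b f' \<cdot>\<^bsub>rex_bimodule K C M\<^esub> rex_rA C M a f"
      using dom by (simp del: M.assoc cong: restrict_cong)
  qed
  show ?thesis
  proof (intro two_sided_action.intro two_sided_action_axioms.intro)
    fix F U V assume UV [simp]: "U \<in> Obj C" "V \<in> Obj C" and "F \<in> Obj (rex_bimodule K C M)"
    then have F [simp]: "F \<in> Obj (Rex K M)" by simp
    note [simp] = Rex_functor_simps[OF F] rex_lO_closed rex_rO_closed
    have "actA M (idt C U) (actA M (idt C V) (farr F f)) \<cdot>\<^bsub>M\<^esub> mas M U V (fobj F (Dom M f)) =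
        mas M U V (fobj F (Cod M f)) \<cdot>\<^bsub>M\<^esub> actA M (idt C (tenO C U V)) (farr F f)"
      if "f \<in> Arr M" for f
      using mas_natural[OF homsetI homsetI homsetI, of "idt C U" "idt C V" "farr F f"] that by simp
    then show "bla (rex_bimodule K C M) U V F \<in> homset (rex_bimodule K C M)
        (blO (rex_bimodule K C M) (tenO C U V) F) (blO (rex_bimodule K C M) U (blO (rex_bimodule K C M) V F))"
      by (auto simp: Rex_homset_iff intro!: Rex_arrI)
    have "farr F (actA M (idt C (tenO C U V)) f) \<cdot>\<^bsub>M\<^esub> farr F (inv_arrow M (mas M U V (Dom M f))) =
        farr F (inv_arrow M (mas M U V (Cod M f))) \<cdot>\<^bsub>M\<^esub> farr F (actA M (idt C U) (actA M (idt C V) f))"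
      if [simp]: "f \<in> Arr M" for f
      using mas_inv_natural[of "idt C U" "idt C V" f]
      by (simp add: Rex_functor_comp[OF F, symmetric])
    then show "bra (rex_bimodule K C M) F U V \<in> homset (rex_bimodule K C M)
        (brO (rex_bimodule K C M) (brO (rex_bimodule K C M) F U) V) (brO (rex_bimodule K C M) F (tenO C U V))"
      by (auto simp: Rex_homset_iff intro!: Rex_arrI)
    show "bma (rex_bimodule K C M) U F V \<in> homset (rex_bimodule K C M)
        (brO (rex_bimodule K C M) (blO (rex_bimodule K C M) U F) V) (blO (rex_bimodule K C M) U (brO (rex_bimodule K C M) F V))"
      using category.idt_closed[OF cat, of "rex_lO C M U (rex_rO C M F V)"] by (simp add: rex_rO_lO)
  next
    fix F assume "F \<in> Obj (rex_bimodule K C M)"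
    then have F [simp]: "F \<in> Obj (Rex K M)" by simp
    note [simp] = Rex_functor_simps[OF F] rex_lO_closed rex_rO_closed
    have "farr F f \<cdot>\<^bsub>M\<^esub> mun M (fobj F (Dom M f)) =
        mun M (fobj F (Cod M f)) \<cdot>\<^bsub>M\<^esub> actA M (idt C (unt C)) (farr F f)" if "f \<in> Arr M" for f
      using mun_natural[OF homsetI, of "farr F f"] that by simp
    then show "blu (rex_bimodule K C M) F \<in> homset (rex_bimodule K C M) (blO (rex_bimodule K C M) (unt C) F) F"
      by (auto simp: Rex_homset_iff intro!: Rex_arrI)
    show "bru (rex_bimodule K C M) F \<in> homset (rex_bimodule K C M) (brO (rex_bimodule K C M) F (unt C)) F"
      using mun_natural[OF homsetI]
      by (auto simp: Rex_homset_iff Rex_functor_comp[OF F, symmetric] intro!: Rex_arrI)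
  qed (use left right cat C.monoidal_category_axioms in simp_all)
qed

end

section \<open>The action functor is a bimodule functor\<close>

lemma regular_bimodule_simps [simp]:
  "Obj (regular_bimodule C) = Obj C" "Arr (regular_bimodule C) = Arr C"
  "Dom (regular_bimodule C) = Dom C" "Cod (regular_bimodule C) = Cod C"
  "idt (regular_bimodule C) = idt C" "Comp (regular_bimodule C) = Comp C"
  "ladd (regular_bimodule C) = ladd C" "lzero (regular_bimodule C) = lzero C"
  "lsmult (regular_bimodule C) = lsmult C"
  "blO (regular_bimodule C) = tenO C" "blA (regular_bimodule C) = tenA C"
  "brO (regular_bimodule C) = tenO C" "brA (regular_bimodule C) = tenA C"
  "bla (regular_bimodule C) = asc C" "blu (regular_bimodule C) = lun C"
  "bra (regular_bimodule C) = asc C" "bru (regular_bimodule C) = run C" "bma (regular_bimodule C) = asc C"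
  by (simp_all add: regular_bimodule_def lincat.defs bimodcat.defs)

lemma regular_bimodule_homset [simp]: "homset (regular_bimodule C) = homset C"
  by (simp add: homset_def fun_eq_iff)

lemma (in monoidal_category) regular_two_sided_action: "two_sided_action C (regular_bimodule C)"
proof (intro two_sided_action.intro two_sided_action_axioms.intro)
  show "category (regular_bimodule C)"
    using category_axioms by (simp add: category_def homset_def)
  show "bifunctor C (regular_bimodule C) (regular_bimodule C) (blO (regular_bimodule C)) (blA (regular_bimodule C))"
    "bifunctor (regular_bimodule C) C (regular_bimodule C) (brO (regular_bimodule C)) (brA (regular_bimodule C))"
    using ten_bifunctor by (simp_all add: bifunctor_def)
qed (use monoidal_category_axioms asc_closed lun_closed run_closed in simp_all)

lemma action_functor_simps [simp]:
  "fobj (action_functor C M) U = rex_lO C M U (id_fctr M)"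
  "farr (action_functor C M) f = (rex_lO C M (Dom C f) (id_fctr M), rex_lO C M (Cod C f) (id_fctr M),
     \<lambda>A \<in> Obj M. actA M f (idt M A))"
  "bfl (action_functor C M) U V = (rex_lO C M U (rex_lO C M V (id_fctr M)), rex_lO C M (tenO C U V) (id_fctr M),
     \<lambda>A \<in> Obj M. inv_arrow M (mas M U V A))"
  "bfr (action_functor C M) V U = (rex_rO C M (rex_lO C M V (id_fctr M)) U, rex_lO C M (tenO C V U) (id_fctr M),
     \<lambda>A \<in> Obj M. inv_arrow M (mas M V U A))"
  by (simp_all add: action_functor_def Let_def cong: restrict_cong)

context finite_module_category
begin

text \<open>Every axiom is checked at an object \<open>P\<close> of \<open>M\<close>. There both structure isomorphisms of the action
  functor are the inverse associativity constraint, since \<open>(U \<rhd> \<rho> V) P\<close> and \<open>(\<rho> U \<lhd> V) P\<close> are both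
  \<open>U \<otimes> (V \<otimes> P)\<close>.\<close>

lemma action_functor_bimodule_functor:
  assumes "linear_category K C"
  shows "bimodule_functor K C (regular_bimodule C) (rex_bimodule K C M) (action_functor C M)"
proof -
  interpret LC: linear_category K C by fact
  interpret Reg: two_sided_action C "regular_bimodule C" by (rule C.regular_two_sided_action)
  interpret Rex: two_sided_action C "rex_bimodule K C M" by (rule rex_two_sided_action)
  let ?I = "id_fctr M"
  note [simp] = id_fctr_closed rex_lO_closed rex_rO_closed
  have arr: "farr (action_functor C M) f \<in> Arr (Rex K M)" if [simp]: "f \<in> Arr C" for f
    by (auto simp: act_comp intro!: Rex_arrI)
  have act_ladd: "actA M (ladd C f g) (idt M P) = ladd M (actA M f (idt M P)) (actA M g (idt M P))"
    if "f \<in> homset C U V" "g \<in> homset C U V" "P \<in> Obj M" for f g U V P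
    using act_linear that linear_functor.farr_ladd[of K C M "fix_right M (actO M) (actA M) P" f U V g]
    by (auto simp: linear_in_each_variable_def fix_right_def)
  have act_lsmult: "actA M (lsmult C a f) (idt M P) = lsmult M a (actA M f (idt M P))"
    if "a \<in> carrier K" "f \<in> homset C U V" "P \<in> Obj M" for a f U V P
    using act_linear that linear_functor.farr_lsmult[of K C M "fix_right M (actO M) (actA M) P" a f U V]
    by (auto simp: linear_in_each_variable_def fix_right_def)
  have lin: "linear_functor K (regular_bimodule C) (rex_bimodule K C M) (action_functor C M)"
  proof
    fix f U V assume "f \<in> homset (regular_bimodule C) U V"
    then show "farr (action_functor C M) f \<in> homset (rex_bimodule K C M)
        (fobj (action_functor C M) U) (fobj (action_functor C M) V)"
      using arr[of f] by (auto simp: homset_iff)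
  next
    fix f g U V W assume "f \<in> homset (regular_bimodule C) U V" "g \<in> homset (regular_bimodule C) V W"
    then show "farr (action_functor C M) (g \<cdot>\<^bsub>regular_bimodule C\<^esub> f) =
        farr (action_functor C M) g \<cdot>\<^bsub>rex_bimodule K C M\<^esub> farr (action_functor C M) f"
      by (auto simp: homset_iff act_comp cong: restrict_cong)
  next
    fix f g U V assume fg: "f \<in> homset (regular_bimodule C) U V" "g \<in> homset (regular_bimodule C) U V"
    then have *: "f \<in> homset C U V" "g \<in> homset C U V" by simp_all
    show "farr (action_functor C M) (ladd (regular_bimodule C) f g) =
        ladd (rex_bimodule K C M) (farr (action_functor C M) f) (farr (action_functor C M) g)"
      using LC.ladd_closed[OF *] * by (auto simp: act_ladd[OF *] homset_iff cong: restrict_cong)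
  next
    fix a f U V assume a: "a \<in> carrier K" and f: "f \<in> homset (regular_bimodule C) U V"
    then have *: "f \<in> homset C U V" by simp
    show "farr (action_functor C M) (lsmult (regular_bimodule C) a f) =
        lsmult (rex_bimodule K C M) a (farr (action_functor C M) f)"
      using LC.lsmult_closed[OF a *] * by (auto simp: act_lsmult[OF a *] homset_iff cong: restrict_cong)
  qed (auto cong: restrict_cong)
  have bfl: "bfl (action_functor C M) U V \<in> Arr (Rex K M)" if [simp]: "U \<in> Obj C" "V \<in> Obj C" for U V
    using mas_inv_natural[of "idt C U" "idt C V"] by (auto intro!: Rex_arrI)
  have rO_id: "rex_rO C M (rex_lO C M U ?I) V = rex_lO C M U (rex_lO C M V ?I)"
    if [simp]: "U \<in> Obj C" "V \<in> Obj C" for U V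
    by (auto simp: rex_rO_def rex_lO_def restrict_def fun_eq_iff id_fctr_def)
  have iso: "iso_arrow (Rex K M) (bfl (action_functor C M) U V)"
    if [simp]: "U \<in> Obj C" "V \<in> Obj C" for U V
    using bfl[OF that] by (simp add: Rex_iso_iff[OF M.category_axioms])
  show ?thesis
  proof (intro bimodule_functor.intro bimodule_functor_axioms.intro)
    fix U A assume UA: "U \<in> Obj C" "A \<in> Obj (regular_bimodule C)"
    then show "bfl (action_functor C M) U A \<in> homset (rex_bimodule K C M)
       (blO (rex_bimodule K C M) U (fobj (action_functor C M) A))
       (fobj (action_functor C M) (blO (regular_bimodule C) U A)) \<and>
      iso_arrow (rex_bimodule K C M) (bfl (action_functor C M) U A)"
      using bfl[of U A] iso[of U A] by (simp add: homset_iff)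
    have "bfr (action_functor C M) A U \<in> Arr (Rex K M)" "iso_arrow (Rex K M) (bfr (action_functor C M) A U)"
      using UA bfl[of A U] iso[of A U] by (simp_all add: rO_id)
    then show "bfr (action_functor C M) A U \<in> homset (rex_bimodule K C M)
       (brO (rex_bimodule K C M) (fobj (action_functor C M) A) U)
       (fobj (action_functor C M) (brO (regular_bimodule C) A U)) \<and>
      iso_arrow (rex_bimodule K C M) (bfr (action_functor C M) A U)"
      by (simp add: homset_iff)
  next
    fix f g U V A B assume f: "f \<in> homset C U V" and g: "g \<in> homset (regular_bimodule C) A B"
    then have [simp]: "f \<in> Arr C" "Dom C f = U" "Cod C f = V" "g \<in> Arr C" "Dom C g = A" "Cod C g = B"
      by (auto simp: homset_iff)
    have [simp]: "U \<in> Obj C" "V \<in> Obj C" "A \<in> Obj C" "B \<in> Obj C"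
      using C.Dom_closed[of f] C.Cod_closed[of f] C.Dom_closed[of g] C.Cod_closed[of g] by simp_all
    have inv_nat: "actA M (tenA C f g) (idt M P) \<cdot>\<^bsub>M\<^esub> inv_arrow M (mas M U A P) =
        inv_arrow M (mas M V B P) \<cdot>\<^bsub>M\<^esub> actA M f (actA M g (idt M P))"
      "actA M (tenA C g f) (idt M P) \<cdot>\<^bsub>M\<^esub> inv_arrow M (mas M A U P) =
        inv_arrow M (mas M B V P) \<cdot>\<^bsub>M\<^esub> actA M g (actA M f (idt M P))"
      if "P \<in> Obj M" for P
      using mas_inv_natural[of f g "idt M P"] mas_inv_natural[of g f "idt M P"] that by simp_all
    show "bfl (action_functor C M) V B \<cdot>\<^bsub>rex_bimodule K C M\<^esub> blA (rex_bimodule K C M) f (farr (action_functor C M) g) =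
      farr (action_functor C M) (blA (regular_bimodule C) f g) \<cdot>\<^bsub>rex_bimodule K C M\<^esub> bfl (action_functor C M) U A"
      by (simp add: inv_nat cong: restrict_cong)
    show "bfr (action_functor C M) B V \<cdot>\<^bsub>rex_bimodule K C M\<^esub> brA (rex_bimodule K C M) (farr (action_functor C M) g) f =
      farr (action_functor C M) (brA (regular_bimodule C) g f) \<cdot>\<^bsub>rex_bimodule K C M\<^esub> bfr (action_functor C M) A U"
      by (simp add: inv_nat act_comp cong: restrict_cong)
  next
    fix U V A assume [simp]: "U \<in> Obj C" "V \<in> Obj C" and "A \<in> Obj (regular_bimodule C)"
    then have [simp]: "A \<in> Obj C" by simp
    show "farr (action_functor C M) (bla (regular_bimodule C) U V A) \<cdot>\<^bsub>rex_bimodule K C M\<^esub>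
       bfl (action_functor C M) (tenO C U V) A =
       bfl (action_functor C M) U (blO (regular_bimodule C) V A) \<cdot>\<^bsub>rex_bimodule K C M\<^esub>
       blA (rex_bimodule K C M) (idt C U) (bfl (action_functor C M) V A) \<cdot>\<^bsub>rex_bimodule K C M\<^esub>
       bla (rex_bimodule K C M) U V (fobj (action_functor C M) A)"
    proof -
      have "actA M (asc C U V A) (idt M P) \<cdot>\<^bsub>M\<^esub> inv_arrow M (mas M (tenO C U V) A P) =
          inv_arrow M (mas M U (tenO C V A) P) \<cdot>\<^bsub>M\<^esub> actA M (idt C U) (inv_arrow M (mas M V A P))
            \<cdot>\<^bsub>M\<^esub> mas M U V (actO M A P)" if [simp]: "P \<in> Obj M" for P
        by (rule M.iso_cancel_right[of "inv_arrow M (mas M U V (actO M A P))"])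
          (simp_all add: mas_pentagon_inv)
      then show ?thesis by (simp cong: restrict_cong)
    qed
    show "farr (action_functor C M) (bra (regular_bimodule C) A U V) \<cdot>\<^bsub>rex_bimodule K C M\<^esub>
       bfr (action_functor C M) (brO (regular_bimodule C) A U) V \<cdot>\<^bsub>rex_bimodule K C M\<^esub>
       brA (rex_bimodule K C M) (bfr (action_functor C M) A U) (idt C V) =
       bfr (action_functor C M) A (tenO C U V) \<cdot>\<^bsub>rex_bimodule K C M\<^esub>
       bra (rex_bimodule K C M) (fobj (action_functor C M) A) U V"
      using mas_pentagon_inv[of A U V] by (simp cong: restrict_cong)
    show "farr (action_functor C M) (bma (regular_bimodule C) U A V) \<cdot>\<^bsub>rex_bimodule K C M\<^esub>
       bfr (action_functor C M) (blO (regular_bimodule C) U A) V \<cdot>\<^bsub>rex_bimodule K C M\<^esub>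
       brA (rex_bimodule K C M) (bfl (action_functor C M) U A) (idt C V) =
       bfl (action_functor C M) U (brO (regular_bimodule C) A V) \<cdot>\<^bsub>rex_bimodule K C M\<^esub>
       blA (rex_bimodule K C M) (idt C U) (bfr (action_functor C M) A V) \<cdot>\<^bsub>rex_bimodule K C M\<^esub>
       bma (rex_bimodule K C M) U (fobj (action_functor C M) A) V"
      using mas_pentagon_inv[of U A V] by (simp add: rex_rO_lO cong: restrict_cong)
  next
    fix A assume "A \<in> Obj (regular_bimodule C)"
    then have [simp]: "A \<in> Obj C" by simp
    have "actA M (lun C A) (idt M P) \<cdot>\<^bsub>M\<^esub> inv_arrow M (mas M (unt C) A P) = mun M (actO M A P)"
      if [simp]: "P \<in> Obj M" for P
      by (simp add: mun_act[symmetric])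
    then show "farr (action_functor C M) (blu (regular_bimodule C) A) \<cdot>\<^bsub>rex_bimodule K C M\<^esub>
       bfl (action_functor C M) (unt C) A = blu (rex_bimodule K C M) (fobj (action_functor C M) A)"
      by (simp cong: restrict_cong)
    have "actA M (run C A) (idt M P) \<cdot>\<^bsub>M\<^esub> inv_arrow M (mas M A (unt C) P) = actA M (idt C A) (mun M P)"
      if [simp]: "P \<in> Obj M" for P
      by (simp add: mun_triangle[symmetric])
    then show "farr (action_functor C M) (bru (regular_bimodule C) A) \<cdot>\<^bsub>rex_bimodule K C M\<^esub>
       bfr (action_functor C M) A (unt C) = bru (rex_bimodule K C M) (fobj (action_functor C M) A)"
      by (simp cong: restrict_cong)
  qed (rule lin)
qed

end

section \<open>The center of the right exact endofunctors\<close>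

text \<open>What a half-braiding on \<open>F\<close> amounts to on components: a family
  \<open>t\<^sub>U\<^sub>,\<^sub>A : F (U \<otimes> A) \<rightarrow> U \<otimes> F A\<close> whose inverse is a module structure on \<open>F\<close>.\<close>

definition inverse_module_structure ::
  "('o, 'm, 'k) moncat \<Rightarrow> ('n, 'p, 'k, 'o, 'm) modcat \<Rightarrow> ('n, 'p) endof \<Rightarrow> ('o \<Rightarrow> 'n \<Rightarrow> 'p) \<Rightarrow> bool" where
  "inverse_module_structure C M F t \<longleftrightarrow>
     (\<forall>U \<in> Obj C. \<forall>A \<in> Obj M. iso_arrow M (t U A) \<and>
        t U A \<in> homset M (fobj F (actO M U A)) (actO M U (fobj F A))) \<and>
     (\<forall>f \<in> Arr C. \<forall>g \<in> Arr M.
        actA M f (farr F g) \<cdot>\<^bsub>M\<^esub> t (Dom C f) (Dom M g) = t (Cod C f) (Cod M g) \<cdot>\<^bsub>M\<^esub> farr F (actA M f g)) \<and>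
     (\<forall>U \<in> Obj C. \<forall>V \<in> Obj C. \<forall>A \<in> Obj M.
        mas M U V (fobj F A) \<cdot>\<^bsub>M\<^esub> t (tenO C U V) A =
        (actA M (idt C U) (t V A) \<cdot>\<^bsub>M\<^esub> t U (actO M V A)) \<cdot>\<^bsub>M\<^esub> farr F (mas M U V A)) \<and>
     (\<forall>A \<in> Obj M. mun M (fobj F A) \<cdot>\<^bsub>M\<^esub> t (unt C) A = farr F (mun M A))"

lemma inverse_module_structureD:
  assumes "inverse_module_structure C M F t"
  shows "U \<in> Obj C \<Longrightarrow> A \<in> Obj M \<Longrightarrow> t U A \<in> Arr M"
    "U \<in> Obj C \<Longrightarrow> A \<in> Obj M \<Longrightarrow> Dom M (t U A) = fobj F (actO M U A)"
    "U \<in> Obj C \<Longrightarrow> A \<in> Obj M \<Longrightarrow> Cod M (t U A) = actO M U (fobj F A)"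
    "U \<in> Obj C \<Longrightarrow> A \<in> Obj M \<Longrightarrow> iso_arrow M (t U A)"
    "f \<in> Arr C \<Longrightarrow> g \<in> Arr M \<Longrightarrow>
      actA M f (farr F g) \<cdot>\<^bsub>M\<^esub> t (Dom C f) (Dom M g) = t (Cod C f) (Cod M g) \<cdot>\<^bsub>M\<^esub> farr F (actA M f g)"
    "U \<in> Obj C \<Longrightarrow> V \<in> Obj C \<Longrightarrow> A \<in> Obj M \<Longrightarrow> mas M U V (fobj F A) \<cdot>\<^bsub>M\<^esub> t (tenO C U V) A =
        (actA M (idt C U) (t V A) \<cdot>\<^bsub>M\<^esub> t U (actO M V A)) \<cdot>\<^bsub>M\<^esub> farr F (mas M U V A)"
    "A \<in> Obj M \<Longrightarrow> mun M (fobj F A) \<cdot>\<^bsub>M\<^esub> t (unt C) A = farr F (mun M A)"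
  using assms by (auto simp: inverse_module_structure_def homset_iff)

lemma module_structureD:
  assumes "module_structure C M F s"
  shows "U \<in> Obj C \<Longrightarrow> A \<in> Obj M \<Longrightarrow> s (U, A) \<in> Arr M"
    "U \<in> Obj C \<Longrightarrow> A \<in> Obj M \<Longrightarrow> Dom M (s (U, A)) = actO M U (fobj F A)"
    "U \<in> Obj C \<Longrightarrow> A \<in> Obj M \<Longrightarrow> Cod M (s (U, A)) = fobj F (actO M U A)"
    "U \<in> Obj C \<Longrightarrow> A \<in> Obj M \<Longrightarrow> iso_arrow M (s (U, A))"
    "f \<in> Arr C \<Longrightarrow> g \<in> Arr M \<Longrightarrow>
      s (Cod C f, Cod M g) \<cdot>\<^bsub>M\<^esub> actA M f (farr F g) = farr F (actA M f g) \<cdot>\<^bsub>M\<^esub> s (Dom C f, Dom M g)"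
    "U \<in> Obj C \<Longrightarrow> V \<in> Obj C \<Longrightarrow> A \<in> Obj M \<Longrightarrow> farr F (mas M U V A) \<cdot>\<^bsub>M\<^esub> s (tenO C U V, A) =
        s (U, actO M V A) \<cdot>\<^bsub>M\<^esub> actA M (idt C U) (s (V, A)) \<cdot>\<^bsub>M\<^esub> mas M U V (fobj F A)"
    "A \<in> Obj M \<Longrightarrow> farr F (mun M A) \<cdot>\<^bsub>M\<^esub> s (unt C, A) = mun M (fobj F A)"
    "s \<in> extensional (Obj C \<times> Obj M)"
  using assms by (auto simp: module_structure_def homset_iff)

lemma restrict_eq_iff: "restrict f S = restrict g S \<longleftrightarrow> (\<forall>x \<in> S. f x = g x)"
  by (metis restrict_apply' restrict_ext)

context finite_module_category
begin

text \<open>A half-braiding is natural in two senses: each \<open>\<sigma>\<^sub>U\<close> is an arrow of \<open>Rex K M\<close>, so natural in \<open>A\<close>,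
  and \<open>\<sigma>\<close> is natural in \<open>U\<close>. Together these are joint naturality in the pair \<open>(U, A)\<close>, as for a
  bifunctor. The hexagons agree after moving \<open>F\<close> of the associativity constraint to the other side.\<close>

lemma half_braiding_Rex_iff:
  assumes F: "F \<in> Obj (Rex K M)" and \<sigma>: "\<sigma> \<in> extensional (Obj C)"
    and \<sigma>_eq: "\<And>U. U \<in> Obj C \<Longrightarrow> \<sigma> U = (rex_rO C M F U, rex_lO C M U F, t U)"
    and t: "\<And>U. U \<in> Obj C \<Longrightarrow> t U \<in> extensional (Obj M)"
  shows "half_braiding C (rex_bimodule K C M) F \<sigma> \<longleftrightarrow> inverse_module_structure C M F t"
    (is "?hb \<longleftrightarrow> ?im")
proof -
  note [simp] = Rex_functor_simps[OF F] rex_lO_closed[OF _ F] rex_rO_closed[OF _ F] \<sigma>_eq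
  have arr: "(rex_rO C M F U, rex_lO C M U F, t U) \<in> Arr (Rex K M) \<longleftrightarrow>
      (\<forall>A \<in> Obj M. t U A \<in> homset M (fobj F (actO M U A)) (actO M U (fobj F A))) \<and>
      (\<forall>g \<in> Arr M. actA M (idt C U) (farr F g) \<cdot>\<^bsub>M\<^esub> t U (Dom M g) = t U (Cod M g) \<cdot>\<^bsub>M\<^esub> farr F (actA M (idt C U) g))"
    if "U \<in> Obj C" for U
    using that t by (auto simp: Rex_arr_iff homset_iff)
  show ?thesis
  \<comment> \<open>Both sides force components that are isomorphisms of the right type; only then do the remaining
    equations make sense.\<close>
  proof (cases "\<forall>U \<in> Obj C. \<forall>A \<in> Obj M. iso_arrow M (t U A) \<and>
        t U A \<in> homset M (fobj F (actO M U A)) (actO M U (fobj F A))")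
    case False
    have "\<not> ?hb"
    proof
      assume hb: ?hb
      have "iso_arrow (Rex K M) (rex_rO C M F U, rex_lO C M U F, t U)" if "U \<in> Obj C" for U
        using hb that by (auto simp: half_braiding_def)
      then show False using False arr by (auto simp: Rex_iso_iff[OF M.category_axioms])
    qed
    then show ?thesis using False by (auto simp: inverse_module_structure_def)
  next
    case True
    then have [simp]: "t U A \<in> Arr M" "Dom M (t U A) = fobj F (actO M U A)"
      "Cod M (t U A) = actO M U (fobj F A)" "iso_arrow M (t U A)" if "U \<in> Obj C" "A \<in> Obj M" for U A
      using that by (auto simp: homset_iff)
    let ?nat_left = "\<forall>f \<in> Arr C. \<forall>A \<in> Obj M.
      actA M f (idt M (fobj F A)) \<cdot>\<^bsub>M\<^esub> t (Dom C f) A = t (Cod C f) A \<cdot>\<^bsub>M\<^esub> farr F (actA M f (idt M A))"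
    let ?nat_right = "\<forall>U \<in> Obj C. \<forall>g \<in> Arr M.
      actA M (idt C U) (farr F g) \<cdot>\<^bsub>M\<^esub> t U (Dom M g) = t U (Cod M g) \<cdot>\<^bsub>M\<^esub> farr F (actA M (idt C U) g)"
    let ?nat = "\<forall>f \<in> Arr C. \<forall>g \<in> Arr M.
        actA M f (farr F g) \<cdot>\<^bsub>M\<^esub> t (Dom C f) (Dom M g) = t (Cod C f) (Cod M g) \<cdot>\<^bsub>M\<^esub> farr F (actA M f g)"
    let ?hex = "\<forall>U \<in> Obj C. \<forall>V \<in> Obj C. \<forall>A \<in> Obj M.
        mas M U V (fobj F A) \<cdot>\<^bsub>M\<^esub> t (tenO C U V) A \<cdot>\<^bsub>M\<^esub> farr F (inv_arrow M (mas M U V A)) =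
        actA M (idt C U) (t V A) \<cdot>\<^bsub>M\<^esub> t U (actO M V A)"
    let ?unit = "\<forall>A \<in> Obj M. mun M (fobj F A) \<cdot>\<^bsub>M\<^esub> t (unt C) A = farr F (mun M A)"
    have hb: "?hb \<longleftrightarrow> (?nat_right \<and> ?nat_left) \<and> ?unit \<and> ?hex"
      using True \<sigma> unfolding half_braiding_def
      by (simp add: Rex_iso_iff[OF M.category_axioms] homset_iff arr restrict_eq_iff ball_conj_distrib)
    have nat: "?nat_right \<and> ?nat_left \<longleftrightarrow> ?nat"
    proof (intro iffI conjI ballI)
      assume nat: ?nat
      show "actA M (idt C U) (farr F g) \<cdot>\<^bsub>M\<^esub> t U (Dom M g) = t U (Cod M g) \<cdot>\<^bsub>M\<^esub> farr F (actA M (idt C U) g)"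
        if "U \<in> Obj C" "g \<in> Arr M" for U g
        using nat[rule_format, of "idt C U" g] that by simp
      show "actA M f (idt M (fobj F A)) \<cdot>\<^bsub>M\<^esub> t (Dom C f) A = t (Cod C f) A \<cdot>\<^bsub>M\<^esub> farr F (actA M f (idt M A))"
        if "f \<in> Arr C" "A \<in> Obj M" for f A
        using nat[rule_format, of f "idt M A"] that by simp
    next
      fix f g assume nat: "?nat_right \<and> ?nat_left" and [simp]: "f \<in> Arr C" "g \<in> Arr M"
      have nr: "actA M (idt C U) (farr F g) \<cdot>\<^bsub>M\<^esub> t U (Dom M g) = t U (Cod M g) \<cdot>\<^bsub>M\<^esub> farr F (actA M (idt C U) g)"
        if "U \<in> Obj C" for U
        using nat[THEN conjunct1, rule_format, OF that \<open>g \<in> Arr M\<close>] .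
      have nl: "actA M f (idt M (fobj F A)) \<cdot>\<^bsub>M\<^esub> t (Dom C f) A = t (Cod C f) A \<cdot>\<^bsub>M\<^esub> farr F (actA M f (idt M A))"
        if "A \<in> Obj M" for A
        using nat[THEN conjunct2, rule_format, OF \<open>f \<in> Arr C\<close> that] .
      have "actA M f (farr F g) \<cdot>\<^bsub>M\<^esub> t (Dom C f) (Dom M g) =
          actA M f (idt M (fobj F (Cod M g))) \<cdot>\<^bsub>M\<^esub> actA M (idt C (Dom C f)) (farr F g) \<cdot>\<^bsub>M\<^esub> t (Dom C f) (Dom M g)"
        by (simp add: act_comp)
      also have "\<dots> = (actA M f (idt M (fobj F (Cod M g))) \<cdot>\<^bsub>M\<^esub> t (Dom C f) (Cod M g))
          \<cdot>\<^bsub>M\<^esub> farr F (actA M (idt C (Dom C f)) g)"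
        using nr[of "Dom C f"] by simp
      also have "\<dots> = (t (Cod C f) (Cod M g) \<cdot>\<^bsub>M\<^esub> farr F (actA M f (idt M (Cod M g))))
          \<cdot>\<^bsub>M\<^esub> farr F (actA M (idt C (Dom C f)) g)"
        using nl[of "Cod M g"] by (simp del: M.assoc)
      also have "\<dots> = t (Cod C f) (Cod M g) \<cdot>\<^bsub>M\<^esub> farr F (actA M f g)"
        by (simp add: Rex_functor_comp[OF F, symmetric] act_comp)
      finally show "actA M f (farr F g) \<cdot>\<^bsub>M\<^esub> t (Dom C f) (Dom M g) =
          t (Cod C f) (Cod M g) \<cdot>\<^bsub>M\<^esub> farr F (actA M f g)" .
    qed
    have hex: "?hex \<longleftrightarrow> (\<forall>U \<in> Obj C. \<forall>V \<in> Obj C. \<forall>A \<in> Obj M.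
        mas M U V (fobj F A) \<cdot>\<^bsub>M\<^esub> t (tenO C U V) A =
        (actA M (idt C U) (t V A) \<cdot>\<^bsub>M\<^esub> t U (actO M V A)) \<cdot>\<^bsub>M\<^esub> farr F (mas M U V A))"
    proof (intro ball_cong refl)
      fix U V A assume [simp]: "U \<in> Obj C" "V \<in> Obj C" "A \<in> Obj M"
      have [simp]: "farr F (inv_arrow M (mas M U V A)) = inv_arrow M (farr F (mas M U V A))"
        using cat_functor.inv_farr[OF Rex_obj_functor[OF F], of "mas M U V A"] by simp
      let ?p = "mas M U V (fobj F A) \<cdot>\<^bsub>M\<^esub> t (tenO C U V) A"
        and ?q = "actA M (idt C U) (t V A) \<cdot>\<^bsub>M\<^esub> t U (actO M V A)"
      have "(?p \<cdot>\<^bsub>M\<^esub> inv_arrow M (farr F (mas M U V A)) = ?q) \<longleftrightarrow> ?p = ?q \<cdot>\<^bsub>M\<^esub> farr F (mas M U V A)"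
      proof
        assume "?p \<cdot>\<^bsub>M\<^esub> inv_arrow M (farr F (mas M U V A)) = ?q"
        then have "?q \<cdot>\<^bsub>M\<^esub> farr F (mas M U V A) =
            (?p \<cdot>\<^bsub>M\<^esub> inv_arrow M (farr F (mas M U V A))) \<cdot>\<^bsub>M\<^esub> farr F (mas M U V A)" by (rule arg_cong[OF sym])
        then show "?p = ?q \<cdot>\<^bsub>M\<^esub> farr F (mas M U V A)" by simp
      next
        assume *: "?p = ?q \<cdot>\<^bsub>M\<^esub> farr F (mas M U V A)"
        show "?p \<cdot>\<^bsub>M\<^esub> inv_arrow M (farr F (mas M U V A)) = ?q" unfolding * by simp
      qed
      then show "(mas M U V (fobj F A) \<cdot>\<^bsub>M\<^esub> t (tenO C U V) A \<cdot>\<^bsub>M\<^esub> farr F (inv_arrow M (mas M U V A)) = ?q) \<longleftrightarrow>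
          ?p = ?q \<cdot>\<^bsub>M\<^esub> farr F (mas M U V A)"
        by simp
    qed
    show ?thesis
      unfolding hb nat hex inverse_module_structure_def using True by blast
  qed
qed

text \<open>Passing to the inverse family, in both directions: naturality is an inverse square, and so is the
  associativity axiom once its two-step side is treated as a single isomorphism \<open>w\<close>.\<close>

lemma module_structure_inverse:
  assumes F: "F \<in> Obj (Rex K M)" and s: "module_structure C M F s"
  shows "inverse_module_structure C M F (\<lambda>U A. inv_arrow M (s (U, A)))"
  unfolding inverse_module_structure_def
proof (intro conjI ballI)
  note [simp] = Rex_functor_simps[OF F] module_structureD(1-4)[OF s]
  fix U V A assume [simp]: "U \<in> Obj C" "V \<in> Obj C" "A \<in> Obj M"
  let ?w = "s (U, actO M V A) \<cdot>\<^bsub>M\<^esub> actA M (idt C U) (s (V, A))"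
  have w: "inv_arrow M ?w = actA M (idt C U) (inv_arrow M (s (V, A))) \<cdot>\<^bsub>M\<^esub> inv_arrow M (s (U, actO M V A))"
    by (simp add: M.inv_of_comp act_iso)
  have "inv_arrow M ?w \<cdot>\<^bsub>M\<^esub> farr F (mas M U V A) = mas M U V (fobj F A) \<cdot>\<^bsub>M\<^esub> inv_arrow M (s (tenO C U V, A))"
    by (rule M.inv_square) (simp_all add: act_iso module_structureD(6)[OF s])
  then show "mas M U V (fobj F A) \<cdot>\<^bsub>M\<^esub> inv_arrow M (s (tenO C U V, A)) =
      (actA M (idt C U) (inv_arrow M (s (V, A))) \<cdot>\<^bsub>M\<^esub> inv_arrow M (s (U, actO M V A))) \<cdot>\<^bsub>M\<^esub> farr F (mas M U V A)"
    unfolding w by simp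
next
  note [simp] = Rex_functor_simps[OF F] module_structureD(1-4)[OF s]
  fix f g assume "f \<in> Arr C" "g \<in> Arr M"
  then show "actA M f (farr F g) \<cdot>\<^bsub>M\<^esub> inv_arrow M (s (Dom C f, Dom M g)) =
      inv_arrow M (s (Cod C f, Cod M g)) \<cdot>\<^bsub>M\<^esub> farr F (actA M f g)"
    by (intro M.inv_square[symmetric]) (simp_all add: module_structureD(5)[OF s])
next
  note [simp] = Rex_functor_simps[OF F] module_structureD(1-4)[OF s]
  fix A assume [simp]: "A \<in> Obj M"
  show "mun M (fobj F A) \<cdot>\<^bsub>M\<^esub> inv_arrow M (s (unt C, A)) = farr F (mun M A)"
    unfolding module_structureD(7)[OF s \<open>A \<in> Obj M\<close>, symmetric] by simp
next
  fix U A assume "U \<in> Obj C" "A \<in> Obj M"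
  note [simp] = module_structureD(1-4)[OF s this]
  show "iso_arrow M (inv_arrow M (s (U, A)))"
    "inv_arrow M (s (U, A)) \<in> homset M (fobj F (actO M U A)) (actO M U (fobj F A))"
    by (simp_all add: homset_iff)
qed

lemma inverse_module_structure_inverse:
  assumes F: "F \<in> Obj (Rex K M)" and t: "inverse_module_structure C M F t"
  shows "module_structure C M F (\<lambda>(U, A) \<in> Obj C \<times> Obj M. inv_arrow M (t U A))"
  unfolding module_structure_def
proof (intro conjI ballI)
  note [simp] = Rex_functor_simps[OF F] inverse_module_structureD(1-4)[OF t]
  fix U V A assume [simp]: "U \<in> Obj C" "V \<in> Obj C" "A \<in> Obj M"
  let ?w = "actA M (idt C U) (t V A) \<cdot>\<^bsub>M\<^esub> t U (actO M V A)"
  have w: "inv_arrow M ?w = inv_arrow M (t U (actO M V A)) \<cdot>\<^bsub>M\<^esub> actA M (idt C U) (inv_arrow M (t V A))"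
    by (simp add: M.inv_of_comp act_iso)
  have "inv_arrow M ?w \<cdot>\<^bsub>M\<^esub> mas M U V (fobj F A) = farr F (mas M U V A) \<cdot>\<^bsub>M\<^esub> inv_arrow M (t (tenO C U V) A)"
    by (rule M.inv_square) (simp_all add: act_iso inverse_module_structureD(6)[OF t])
  then show "farr F (mas M U V A) \<cdot>\<^bsub>M\<^esub> (\<lambda>(U, A) \<in> Obj C \<times> Obj M. inv_arrow M (t U A)) (tenO C U V, A) =
      (\<lambda>(U, A) \<in> Obj C \<times> Obj M. inv_arrow M (t U A)) (U, actO M V A) \<cdot>\<^bsub>M\<^esub>
      actA M (idt C U) ((\<lambda>(U, A) \<in> Obj C \<times> Obj M. inv_arrow M (t U A)) (V, A)) \<cdot>\<^bsub>M\<^esub> mas M U V (fobj F A)"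
    unfolding w by simp
next
  note [simp] = Rex_functor_simps[OF F] inverse_module_structureD(1-4)[OF t]
  fix f g assume [simp]: "f \<in> Arr C" "g \<in> Arr M"
  have "inv_arrow M (t (Cod C f) (Cod M g)) \<cdot>\<^bsub>M\<^esub> actA M f (farr F g) =
      farr F (actA M f g) \<cdot>\<^bsub>M\<^esub> inv_arrow M (t (Dom C f) (Dom M g))"
    by (intro M.inv_square) (simp_all add: inverse_module_structureD(5)[OF t])
  then show "(\<lambda>(U, A) \<in> Obj C \<times> Obj M. inv_arrow M (t U A)) (Cod C f, Cod M g) \<cdot>\<^bsub>M\<^esub> actA M f (farr F g) =
      farr F (actA M f g) \<cdot>\<^bsub>M\<^esub> (\<lambda>(U, A) \<in> Obj C \<times> Obj M. inv_arrow M (t U A)) (Dom C f, Dom M g)"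
    by simp
next
  note [simp] = Rex_functor_simps[OF F] inverse_module_structureD(1-4)[OF t]
  fix A assume [simp]: "A \<in> Obj M"
  show "farr F (mun M A) \<cdot>\<^bsub>M\<^esub> (\<lambda>(U, A) \<in> Obj C \<times> Obj M. inv_arrow M (t U A)) (unt C, A) = mun M (fobj F A)"
    unfolding inverse_module_structureD(7)[OF t \<open>A \<in> Obj M\<close>, symmetric] by simp
next
  fix U A assume [simp]: "U \<in> Obj C" "A \<in> Obj M"
  note [simp] = inverse_module_structureD(1-4)[OF t \<open>U \<in> Obj C\<close> \<open>A \<in> Obj M\<close>]
  show "iso_arrow M ((\<lambda>(U, A) \<in> Obj C \<times> Obj M. inv_arrow M (t U A)) (U, A))"
    "(\<lambda>(U, A) \<in> Obj C \<times> Obj M. inv_arrow M (t U A)) (U, A) \<in> homset M (actO M U (fobj F A)) (fobj F (actO M U A))"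
    by (simp_all add: homset_iff)
qed simp

end

lemma components_simp [simp]: "components (F, G, \<alpha>) = \<alpha>"
  by (simp add: components_def)

lemma Rex_module_simps:
  "(F, s) \<in> Obj (Rex_module K C M) \<longleftrightarrow> F \<in> Obj (Rex K M) \<and> module_structure C M F s"
  "(S, T, \<alpha>) \<in> Arr (Rex_module K C M) \<longleftrightarrow>
     S \<in> Obj (Rex_module K C M) \<and> T \<in> Obj (Rex_module K C M) \<and> \<alpha> \<in> homset (Rex K M) (fst S) (fst T) \<and>
     (\<forall>U \<in> Obj C. \<forall>A \<in> Obj M. components \<alpha> (actO M U A) \<cdot>\<^bsub>M\<^esub> snd S (U, A) =
        snd T (U, A) \<cdot>\<^bsub>M\<^esub> actA M (idt C U) (components \<alpha> A))"
  "Dom (Rex_module K C M) (S, T, \<alpha>) = S"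
  "Cod (Rex_module K C M) (S, T, \<alpha>) = T"
  "idt (Rex_module K C M) S = (S, S, idt (Rex K M) (fst S))"
  "(T', T'', \<beta>) \<cdot>\<^bsub>Rex_module K C M\<^esub> (S, T, \<alpha>) = (S, T'', \<beta> \<cdot>\<^bsub>Rex K M\<^esub> \<alpha>)"
  by (auto simp: Rex_module_def Let_def split: prod.splits)

lemma Rex_module_homset:
  "f \<in> homset (Rex_module K C M) S T \<longleftrightarrow> (\<exists>f'. f = (S, T, f') \<and> (S, T, f') \<in> Arr (Rex_module K C M))"
  by (cases f) (auto simp: homset_iff Rex_module_simps)

lemma center_to_module_obj_simps:
  "fst (center_to_module_obj C M S) = fst S"
  "U \<in> Obj C \<Longrightarrow> A \<in> Obj M \<Longrightarrow>
     snd (center_to_module_obj C M S) (U, A) = inv_arrow M (components (snd S U) A)"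
  "fst (module_to_center_obj C M T) = fst T"
  "U \<in> Obj C \<Longrightarrow> snd (module_to_center_obj C M T) U =
     (rex_rO C M (fst T) U, rex_lO C M U (fst T), \<lambda>A \<in> Obj M. inv_arrow M (snd T (U, A)))"
  by (simp_all add: center_to_module_obj_def module_to_center_obj_def split: prod.splits)

lemma center_to_module_simps [simp]:
  "fobj (center_to_module C M) S = center_to_module_obj C M S"
  "farr (center_to_module C M) (S, T, \<alpha>) = (center_to_module_obj C M S, center_to_module_obj C M T, \<alpha>)"
  "fobj (module_to_center C M) S' = module_to_center_obj C M S'"
  "farr (module_to_center C M) (S', T', \<alpha>) = (module_to_center_obj C M S', module_to_center_obj C M T', \<alpha>)"
  by (simp_all add: center_to_module_def module_to_center_def)

context finite_module_category
begin

lemma center_Rex_objD: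
  assumes S: "S \<in> Obj (center C (rex_bimodule K C M))"
  shows "fst S \<in> Obj (Rex K M)" "snd S \<in> extensional (Obj C)"
    and "U \<in> Obj C \<Longrightarrow> snd S U = (rex_rO C M (fst S) U, rex_lO C M U (fst S), components (snd S U))"
    and "U \<in> Obj C \<Longrightarrow> components (snd S U) \<in> extensional (Obj M)"
    and "inverse_module_structure C M (fst S) (\<lambda>U. components (snd S U))"
proof -
  let ?F = "fst S" and ?\<sigma> = "snd S"
  show F: "?F \<in> Obj (Rex K M)" using center_objD(1)[OF S] by simp
  have hb: "half_braiding C (rex_bimodule K C M) ?F ?\<sigma>" by (rule center_objD(2)[OF S])
  then show \<sigma>: "?\<sigma> \<in> extensional (Obj C)" by (simp add: half_braiding_def)
  have "?\<sigma> U \<in> homset (Rex K M) (rex_rO C M ?F U) (rex_lO C M U ?F)" if "U \<in> Obj C" for U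
    using hb that by (simp add: half_braiding_def)
  then have eq: "?\<sigma> U = (rex_rO C M ?F U, rex_lO C M U ?F, components (?\<sigma> U))"
    and ext: "components (?\<sigma> U) \<in> extensional (Obj M)" if "U \<in> Obj C" for U
    using that unfolding Rex_homset_iff by (force dest: Rex_arrD(7))+
  show "U \<in> Obj C \<Longrightarrow> ?\<sigma> U = (rex_rO C M ?F U, rex_lO C M U ?F, components (?\<sigma> U))"
    "U \<in> Obj C \<Longrightarrow> components (?\<sigma> U) \<in> extensional (Obj M)"
    by (rule eq ext; assumption)+
  show "inverse_module_structure C M ?F (\<lambda>U. components (?\<sigma> U))"
    using half_braiding_Rex_iff[OF F \<sigma> eq ext] hb by simp
qed

lemma center_to_module_obj_closed:
  assumes S: "S \<in> Obj (center C (rex_bimodule K C M))"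
  shows "center_to_module_obj C M S \<in> Obj (Rex_module K C M)"
    and "module_to_center_obj C M (center_to_module_obj C M S) = S"
proof -
  note D = center_Rex_objD[OF S]
  obtain F \<sigma> where [simp]: "S = (F, \<sigma>)" by (cases S)
  note [simp] = inverse_module_structureD(1-4)[OF D(5)[simplified]]
  show "center_to_module_obj C M S \<in> Obj (Rex_module K C M)"
    using D(1) inverse_module_structure_inverse[OF D(1) D(5)]
    by (simp add: center_to_module_obj_def Rex_module_simps)
  show "module_to_center_obj C M (center_to_module_obj C M S) = S"
  proof (rule prod_eqI)
    show "snd (module_to_center_obj C M (center_to_module_obj C M S)) = snd S"
    proof (rule extensionalityI[of _ "Obj C"])
      show "snd (module_to_center_obj C M (center_to_module_obj C M S)) \<in> extensional (Obj C)"
        by (simp add: module_to_center_obj_def split: prod.splits)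
      fix U assume U [simp]: "U \<in> Obj C"
      have "(\<lambda>A \<in> Obj M. inv_arrow M (inv_arrow M (components (\<sigma> U) A))) = components (\<sigma> U)"
        using D(4)[OF U] by (auto intro!: extensionalityI[of _ "Obj M"])
      then show "snd (module_to_center_obj C M (center_to_module_obj C M S)) U = snd S U"
        using D(3)[OF U] by (simp add: center_to_module_obj_simps cong: restrict_cong)
    qed (rule D(2))
  qed (simp add: center_to_module_obj_simps)
qed

lemma module_to_center_obj_closed:
  assumes S: "S \<in> Obj (Rex_module K C M)"
  shows "module_to_center_obj C M S \<in> Obj (center C (rex_bimodule K C M))"
    and "center_to_module_obj C M (module_to_center_obj C M S) = S"
proof -
  obtain F s where [simp]: "S = (F, s)" by (cases S)
  have F: "F \<in> Obj (Rex K M)" and s: "module_structure C M F s" using S by (auto simp: Rex_module_simps)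
  note [simp] = module_structureD(1-4)[OF s]
  let ?t = "\<lambda>U. \<lambda>A \<in> Obj M. inv_arrow M (s (U, A))"
  have "inverse_module_structure C M F (\<lambda>U A. inv_arrow M (s (U, A)))"
    by (rule module_structure_inverse[OF F s])
  \<comment> \<open>Components of arrows of \<open>Rex K M\<close> are extensional, hence the restriction to \<open>Obj M\<close>.\<close>
  then have "inverse_module_structure C M F ?t"
    by (simp add: inverse_module_structure_def cong: ball_cong)
  then show "module_to_center_obj C M S \<in> Obj (center C (rex_bimodule K C M))"
    using F half_braiding_Rex_iff[OF F, of "snd (module_to_center_obj C M S)" ?t]
    by (simp add: center_simps module_to_center_obj_def)
  show "center_to_module_obj C M (module_to_center_obj C M S) = S"
  proof (rule prod_eqI)
    show "snd (center_to_module_obj C M (module_to_center_obj C M S)) = snd S"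
    proof (rule extensionalityI[of _ "Obj C \<times> Obj M"])
      show "snd (center_to_module_obj C M (module_to_center_obj C M S)) \<in> extensional (Obj C \<times> Obj M)"
        by (simp add: center_to_module_obj_def split: prod.splits)
      show "snd S \<in> extensional (Obj C \<times> Obj M)" using module_structureD(8)[OF s] by simp
    qed (auto simp: center_to_module_obj_simps)
  qed (simp add: center_to_module_obj_simps)
qed

text \<open>For arrows, the two compatibility conditions are each other's inverse squares.\<close>

lemma center_arr_iff_module_arr:
  assumes S: "S \<in> Obj (center C (rex_bimodule K C M))" and T: "T \<in> Obj (center C (rex_bimodule K C M))"
  shows "(S, T, a) \<in> Arr (center C (rex_bimodule K C M)) \<longleftrightarrow>
    (center_to_module_obj C M S, center_to_module_obj C M T, a) \<in> Arr (Rex_module K C M)"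
proof (cases "a \<in> homset (Rex K M) (fst S) (fst T)")
  case False
  then show ?thesis by (simp add: center_simps Rex_module_simps center_to_module_obj_simps)
next
  case True
  then obtain \<alpha> where [simp]: "a = (fst S, fst T, \<alpha>)" and \<alpha>: "(fst S, fst T, \<alpha>) \<in> Arr (Rex K M)"
    by (auto simp: Rex_homset_iff)
  note DS = center_Rex_objD[OF S] and DT = center_Rex_objD[OF T]
  let ?s = "\<lambda>U. components (snd S U)" and ?t = "\<lambda>U. components (snd T U)"
  note [simp] = Rex_arrD(3-5)[OF \<alpha>] Rex_functor_simps[OF DS(1)] Rex_functor_simps[OF DT(1)]
    inverse_module_structureD(1-4)[OF DS(5)] inverse_module_structureD(1-4)[OF DT(5)]
  have *: "(blA (rex_bimodule K C M) (idt C U) a \<cdot>\<^bsub>rex_bimodule K C M\<^esub> snd S U =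
        snd T U \<cdot>\<^bsub>rex_bimodule K C M\<^esub> brA (rex_bimodule K C M) a (idt C U)) \<longleftrightarrow>
      (\<forall>A \<in> Obj M. \<alpha> (actO M U A) \<cdot>\<^bsub>M\<^esub> inv_arrow M (?s U A) = inv_arrow M (?t U A) \<cdot>\<^bsub>M\<^esub> actA M (idt C U) (\<alpha> A))"
    if U [simp]: "U \<in> Obj C" for U
  proof -
    have "(blA (rex_bimodule K C M) (idt C U) a \<cdot>\<^bsub>rex_bimodule K C M\<^esub> snd S U =
        snd T U \<cdot>\<^bsub>rex_bimodule K C M\<^esub> brA (rex_bimodule K C M) a (idt C U)) \<longleftrightarrow>
      (\<forall>A \<in> Obj M. actA M (idt C U) (\<alpha> A) \<cdot>\<^bsub>M\<^esub> ?s U A = ?t U A \<cdot>\<^bsub>M\<^esub> \<alpha> (actO M U A))"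
      by (subst DS(3)[OF U], subst DT(3)[OF U]) (simp add: restrict_eq_iff)
    also have "\<dots> \<longleftrightarrow> (\<forall>A \<in> Obj M.
        \<alpha> (actO M U A) \<cdot>\<^bsub>M\<^esub> inv_arrow M (?s U A) = inv_arrow M (?t U A) \<cdot>\<^bsub>M\<^esub> actA M (idt C U) (\<alpha> A))"
    proof (intro ball_cong refl iffI)
      fix A assume [simp]: "A \<in> Obj M"
      assume "actA M (idt C U) (\<alpha> A) \<cdot>\<^bsub>M\<^esub> ?s U A = ?t U A \<cdot>\<^bsub>M\<^esub> \<alpha> (actO M U A)"
      then show "\<alpha> (actO M U A) \<cdot>\<^bsub>M\<^esub> inv_arrow M (?s U A) = inv_arrow M (?t U A) \<cdot>\<^bsub>M\<^esub> actA M (idt C U) (\<alpha> A)"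
        by (intro M.inv_square[symmetric]) simp_all
    next
      fix A assume [simp]: "A \<in> Obj M"
      assume "\<alpha> (actO M U A) \<cdot>\<^bsub>M\<^esub> inv_arrow M (?s U A) = inv_arrow M (?t U A) \<cdot>\<^bsub>M\<^esub> actA M (idt C U) (\<alpha> A)"
      then have "inv_arrow M (inv_arrow M (?t U A)) \<cdot>\<^bsub>M\<^esub> \<alpha> (actO M U A) =
          actA M (idt C U) (\<alpha> A) \<cdot>\<^bsub>M\<^esub> inv_arrow M (inv_arrow M (?s U A))"
        by (intro M.inv_square) simp_all
      then show "actA M (idt C U) (\<alpha> A) \<cdot>\<^bsub>M\<^esub> ?s U A = ?t U A \<cdot>\<^bsub>M\<^esub> \<alpha> (actO M U A)" by simp
    qed
    finally show ?thesis .
  qed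
  show ?thesis
    using S T True center_to_module_obj_closed(1)[OF S] center_to_module_obj_closed(1)[OF T] *
    by (simp add: center_simps Rex_module_simps center_to_module_obj_simps)
qed

text \<open>Arrows are closed under identities and composition because the corresponding arrows of the center
  are.\<close>

lemma Rex_module_category: "category (Rex_module K C M)"
proof -
  interpret R: two_sided_action C "rex_bimodule K C M" by (rule rex_two_sided_action)
  interpret Z: category "center C (rex_bimodule K C M)" by (rule R.center_category)
  interpret Rex: category "Rex K M" by (rule Rex_category[OF M.category_axioms])
  let ?z = "module_to_center_obj C M"
  have arr: "(S, T, a) \<in> Arr (Rex_module K C M) \<longleftrightarrow> S \<in> Obj (Rex_module K C M) \<and> T \<in> Obj (Rex_module K C M) \<and>
      (?z S, ?z T, a) \<in> Arr (center C (rex_bimodule K C M))" for S T a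
    using center_arr_iff_module_arr[of "?z S" "?z T" a] module_to_center_obj_closed[of S] module_to_center_obj_closed[of T]
    by (auto simp: Rex_module_simps(2))
  show ?thesis
  proof
    fix f assume "f \<in> Arr (Rex_module K C M)"
    then show "Dom (Rex_module K C M) f \<in> Obj (Rex_module K C M)" "Cod (Rex_module K C M) f \<in> Obj (Rex_module K C M)"
      by (cases f; auto simp: Rex_module_simps)+
  next
    fix S assume "S \<in> Obj (Rex_module K C M)"
    then show "idt (Rex_module K C M) S \<in> homset (Rex_module K C M) S S"
      using Z.arr_idt[of "?z S"] module_to_center_obj_closed(1)[of S]
      by (simp add: Rex_module_homset arr Rex_module_simps(5) center_simps(5) center_to_module_obj_simps)
  next
    fix f g S T R assume "f \<in> homset (Rex_module K C M) S T" "g \<in> homset (Rex_module K C M) T R"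
    then show "g \<cdot>\<^bsub>Rex_module K C M\<^esub> f \<in> homset (Rex_module K C M) S R"
      using Z.arr_comp[of "(?z S, ?z T, snd (snd f))" "(?z T, ?z R, snd (snd g))"]
      by (auto simp: Rex_module_homset arr Rex_module_simps(6) center_simps(3,4,6))
  next
    fix f S T assume "f \<in> homset (Rex_module K C M) S T"
    then show "idt (Rex_module K C M) T \<cdot>\<^bsub>Rex_module K C M\<^esub> f = f"
      "f \<cdot>\<^bsub>Rex_module K C M\<^esub> idt (Rex_module K C M) S = f"
      by (auto simp: Rex_module_homset Rex_module_simps(2,5,6) simp del: Rex_simps
          intro: Rex.Comp_idt_left Rex.Comp_idt_right)
  next
    fix f g h S T R Q
    assume "f \<in> homset (Rex_module K C M) S T" "g \<in> homset (Rex_module K C M) T R"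
      "h \<in> homset (Rex_module K C M) R Q"
    then show "(h \<cdot>\<^bsub>Rex_module K C M\<^esub> g) \<cdot>\<^bsub>Rex_module K C M\<^esub> f =
        h \<cdot>\<^bsub>Rex_module K C M\<^esub> g \<cdot>\<^bsub>Rex_module K C M\<^esub> f"
      by (auto simp: Rex_module_homset Rex_module_simps(2,6) simp del: Rex_simps intro: Rex.Comp_assoc)
  qed
qed

text \<open>Inverting a family of components twice gives it back, and extensionality turns this into an equality
  of objects. Arrows keep their underlying natural transformation, so functoriality is immediate.\<close>

theorem center_Rex_module_inverse_functors:
  "inverse_functors (center C (rex_bimodule K C M)) (Rex_module K C M) (center_to_module C M) (module_to_center C M)"
proof -
  interpret R: two_sided_action C "rex_bimodule K C M" by (rule rex_two_sided_action)
  interpret Z: category "center C (rex_bimodule K C M)" by (rule R.center_category)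
  interpret Mod: category "Rex_module K C M" by (rule Rex_module_category)
  let ?Z = "center C (rex_bimodule K C M)" and ?R = "Rex_module K C M"
  let ?m = "center_to_module_obj C M" and ?z = "module_to_center_obj C M"
  have to_module: "(?m S, ?m T, a) \<in> Arr ?R" if "(S, T, a) \<in> Arr ?Z" for S T a
    using that center_arr_iff_module_arr[of S T a] by (auto simp: center_simps(2))
  have of_module: "(?z S, ?z T, a) \<in> Arr ?Z" if "(S, T, a) \<in> Arr ?R" for S T a
    using that center_arr_iff_module_arr[of "?z S" "?z T" a] module_to_center_obj_closed[of S] module_to_center_obj_closed[of T]
    by (auto simp: Rex_module_simps(2))
  have "cat_functor ?Z ?R (center_to_module C M)"
  proof
    fix f S T assume "f \<in> homset ?Z S T"
    then obtain a where "f = (S, T, a)" "(S, T, a) \<in> Arr ?Z" unfolding center_homset by blast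
    then show "farr (center_to_module C M) f \<in> homset ?R (fobj (center_to_module C M) S) (fobj (center_to_module C M) T)"
      using to_module[of S T a] by (simp add: Rex_module_homset)
  next
    fix f g S T U assume "f \<in> homset ?Z S T" "g \<in> homset ?Z T U"
    then show "farr (center_to_module C M) (g \<cdot>\<^bsub>?Z\<^esub> f) = farr (center_to_module C M) g \<cdot>\<^bsub>?R\<^esub> farr (center_to_module C M) f"
      by (auto simp: center_homset center_simps(6) Rex_module_simps(6))
  qed (auto simp: center_to_module_obj_closed center_simps(5) Rex_module_simps(5) center_to_module_obj_simps)
  moreover have "cat_functor ?R ?Z (module_to_center C M)"
  proof
    fix f S T assume "f \<in> homset ?R S T"
    then obtain a where "f = (S, T, a)" "(S, T, a) \<in> Arr ?R" unfolding Rex_module_homset by blast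
    then show "farr (module_to_center C M) f \<in> homset ?Z (fobj (module_to_center C M) S) (fobj (module_to_center C M) T)"
      using of_module[of S T a] by (simp add: center_homset)
  next
    fix f g S T U assume "f \<in> homset ?R S T" "g \<in> homset ?R T U"
    then show "farr (module_to_center C M) (g \<cdot>\<^bsub>?R\<^esub> f) = farr (module_to_center C M) g \<cdot>\<^bsub>?Z\<^esub> farr (module_to_center C M) f"
      by (auto simp: Rex_module_homset center_simps(6) Rex_module_simps(6))
  qed (auto simp: module_to_center_obj_closed center_simps(5) Rex_module_simps(5) center_to_module_obj_simps)
  ultimately show ?thesis
    by (auto simp: inverse_functors_def center_to_module_obj_closed module_to_center_obj_closed
        center_simps(2) Rex_module_simps(2))
qed

end

section \<open>The adjunction\<close>

theorem theorem3p11: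
  fixes K :: "'k ring"
    and C :: "('o, 'm, 'k) moncat"
    and M :: "('n, 'p, 'k, 'o, 'm) modcat"
    and \<rho>ra :: "(('n, 'p) endof, ('n, 'p) endot, 'o, 'm, 'o) bimod_fctr"
    and \<eta> :: "'o \<Rightarrow> 'm"
    and \<epsilon> :: "('n, 'p) endof \<Rightarrow> ('n, 'p) endot"
  defines "\<rho> \<equiv> action_functor C M"
    and "RegC \<equiv> regular_bimodule C"
    and "RexM \<equiv> rex_bimodule K C M"
  assumes "finite_tensor_category K C"
    and "finite_module_category K C M"
    and "adjunction RegC RexM \<rho> \<rho>ra \<eta> \<epsilon>"
    and "bimodule_functor K C RexM RegC \<rho>ra"
    and "bimodule_transformation C RegC RegC (id_bimod_fctr RegC) (comp_bimod_fctr RegC \<rho>ra \<rho>) \<eta>"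
    and "bimodule_transformation C RexM RexM (comp_bimod_fctr RexM \<rho> \<rho>ra) (id_bimod_fctr RexM) \<epsilon>"
  shows "inverse_functors (center C RexM) (Rex_module K C M) (center_to_module C M) (module_to_center C M) \<and>
         adjoint_pair (drinfeld_center C) (Rex_module K C M)
           (comp_fctr (center_to_module C M) (center_fctr C RexM \<rho>))
           (comp_fctr (center_fctr C RegC \<rho>ra) (module_to_center C M))"
proof -
  interpret C: finite_tensor_category K C by fact
  interpret M: finite_module_category K C M by fact
  have reg: "two_sided_action C RegC" and rex: "two_sided_action C RexM"
    unfolding RegC_def RexM_def by (rule C.regular_two_sided_action M.rex_two_sided_action)+
  have "linear_category K C" using C.finite_abelian by (simp add: finite_abelian_def)
  then have "bimodule_functor K C RegC RexM \<rho>"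
    unfolding RegC_def RexM_def \<rho>_def by (rule M.action_functor_bimodule_functor)
  with reg rex assms(7) have "bimodule_functor_between K C RegC RexM \<rho>" "bimodule_functor_between K C RexM RegC \<rho>ra"
    by (simp_all add: bimodule_functor_between_def)
  then have "adjoint_pair (center C RegC) (center C RexM) (center_fctr C RexM \<rho>) (center_fctr C RegC \<rho>ra)"
    using assms(6,8,9) by (rule center_adjunction)
  moreover have "inverse_functors (center C RexM) (Rex_module K C M) (center_to_module C M) (module_to_center C M)"
    unfolding RexM_def by (rule M.center_Rex_module_inverse_functors)
  ultimately show ?thesis
    unfolding drinfeld_center_def RegC_def[symmetric] by (blast intro: adjoint_pair_transport)
qed

end
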